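(* Let $E$ and $E'$ be full Hilbert $\mathcal{B}$-modules over a $C^*$-algebra $\mathcal{B}$. Let $u\in\mathscr{B}^a(E,E')$ be a unitary and define the inner isomorphism $\alpha:=u\bullet u^*\colon\mathscr{B}^a(E)\to\mathscr{B}^a(E')$. Suppose $v,v'$ are left dilations of product systems $E^\odot,E'^\odot$ (of $\mathcal{B}$-correspondences) to $E$ and $E'$, respectively, such that $(\vartheta^v)^\alpha=\vartheta^{v'}$. Then there is a unique isomorphism $w^\odot$ from $E^\odot$ to $E'^\odot$ such that $$u(xy_t)=(ux)(w_ty_t)$$ for all $t\in\mathbb{S}$, $x\in E$, $y_t\in E_t$ (that is, $uv_t=v'_t(u\odot w_t)$). In particular: (1) If $u$ is the identity of $E=E'$, so that $\vartheta^v=\vartheta^{v'}$, then $w^\odot$ is the unique isomorphism satisfying $xy_t=x(w_ty_t)$. (2) If, in the situation of (1), $E'^\odot$ is the product system associated with $\vartheta^v$ and $v'$ its standard dilation, then $w^\odot$ is the unique isomorphism satisfying $w_t(\langle x,y\rangle z_t)=x^*\odot_t(yz_t)$. (3) Let $\vartheta$ be a strict $E_0$-semigroup on $\mathscr{B}^a(E)$. If $E^\odot$ and $E'^\odot$ are the product systems associated with $\vartheta$ and $\vartheta':=\vartheta^\alpha$, respectively, and if $v$ and $v'$ are their respective standard dilations, then $w^\odot$ is the unique isomorphism determined by $w_t(x^*\odot_ty)=(ux)^*\odot_t(uy)$.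
   Context: The index semigroup $\mathbb{S}$ is $\mathbb{N}_0$ or $\mathbb{R}_+$. For Hilbert $\mathcal{B}$-modules, $\mathscr{B}^a(E,E')$ denotes the adjointable operators, $\mathscr{B}^a(E)=\mathscr{B}^a(E,E)$, $xy^*$ the operator $z\mapsto x\langle y,z\rangle$, $\mathscr{K}(E)$ the closed span of all $xy^*$. $E$ is full if $\overline{\mathrm{span}}\,\langle E,E\rangle=\mathcal{B}$. A correspondence over $\mathcal{B}$ is a Hilbert $\mathcal{B}$-module with a nondegenerate left action of $\mathcal{B}$ by adjointable operators; $\odot$ is the interior tensor product. An $E_0$-semigroup on $\mathscr{B}^a(E)$ is a semigroup $(\vartheta_t)_{t\in\mathbb{S}}$ of unital $*$-endomorphisms with $\vartheta_0=\mathrm{id}$; it is strict if $\overline{\mathrm{span}}\,\vartheta_t(\mathscr{K}(E))E=E$ for every $t$. For an isomorphism $\alpha\colon\mathscr{B}^a(E)\to\mathscr{B}^a(E')$, $\vartheta^\alpha_t:=\alpha\circ\vartheta_t\circ\alpha^{-1}$. Product system of $\mathcal{B}$-correspondences: a family $E^\odot=(E_t)_{t\in\mathbb{S}}$ of correspondences over $\mathcal{B}$ with $E_0=\mathcal{B}$ and bilinear unitaries $u_{s,t}\colon E_s\odot E_t\to E_{s+t}$ such that $x_sy_t:=u_{s,t}(x_s\odot y_t)$ is associative and $u_{0,t},u_{t,0}$ are the canonical left and right action. It is full if every $E_t$ is full. Isomorphism: a family $w^\odot=(w_t)_{t\in\mathbb{S}}$ of bilinear unitaries $w_t\colon E_t\to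 E'_t$ with $w_0=\mathrm{id}_{\mathcal B}$, $w_s(x_s)w_t(y_t)=w_{s+t}(x_sy_t)$. A left dilation of a full product system $E^\odot$ to a full Hilbert $\mathcal{B}$-module $E$ is a family $v=(v_t)_{t\in\mathbb{S}}$ of unitaries $v_t\colon E\odot E_t\to E$ such that, with $xy_t:=v_t(x\odot y_t)$, $(xy_s)z_t=x(y_sz_t)$ for all $x\in E,y_s\in E_s,z_t\in E_t$ (and $v_0$ is the canonical identification $x\odot b\mapsto xb$). It induces the strict $E_0$-semigroup $\vartheta^v_t(a):=v_t(a\odot\mathrm{id}_{E_t})v_t^*$ on $\mathscr{B}^a(E)$. The product system associated with a strict $E_0$-semigroup $\vartheta$ on $\mathscr{B}^a(E)$: $E_t$ is the closed span of elements $x^*\odot_ty$ ($x,y\in E$) with $\langle x^*\odot_ty,x'^*\odot_ty'\rangle=\langle y,\vartheta_t(xx'^* )y'\rangle$, right action on $y$, left action $b(x^*\odot_ty)=(xb^* )^*\odot_ty$, product $(x^*\odot_sx')(y^*\odot_ty')=x^*\odot_{s+t}\vartheta_t(x'y^* )y'$, and $E_0=\mathcal{B}$ via $x^*\odot_0y=\langle x,y\rangle$. Its standard dilation is $v_t(x\odot(y^*\odot_tz)):=\vartheta_t(xy^* )z$, and $\vartheta^v=\vartheta$. *)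

theory Defs
  imports "HOL-Analysis.Analysis"
begin

section \<open>C*-algebras\<close>

text \<open>Complex C*-algebras, not necessarily unital.\<close>

class cstar_algebra = real_normed_algebra + complete_space +
  fixes scaleC :: "complex \<Rightarrow> 'a \<Rightarrow> 'a"
    and cstar :: "'a \<Rightarrow> 'a"
  assumes scaleC_add_right: "scaleC c (x + y) = scaleC c x + scaleC c y"
    and scaleC_add_left: "scaleC (c + d) x = scaleC c x + scaleC d x"
    and scaleC_scaleC: "scaleC c (scaleC d x) = scaleC (c * d) x"
    and scaleC_of_real: "scaleC (complex_of_real r) x = scaleR r x"
    and norm_scaleC: "norm (scaleC c x) = cmod c * norm x"
    and mult_scaleC_left: "scaleC c x * y = scaleC c (x * y)"
    and mult_scaleC_right: "x * scaleC c y = scaleC c (x * y)"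
    and cstar_add: "cstar (x + y) = cstar x + cstar y"
    and cstar_scaleC: "cstar (scaleC c x) = scaleC (cnj c) (cstar x)"
    and cstar_mult: "cstar (x * y) = cstar y * cstar x"
    and cstar_cstar: "cstar (cstar x) = x"
    and cstar_identity: "norm (cstar x * x) = (norm x)\<^sup>2"

definition cstar_positive :: "'b::cstar_algebra \<Rightarrow> bool" where
  "cstar_positive a \<longleftrightarrow> (\<exists>b. a = cstar b * b)"


section \<open>Hilbert modules\<close>

text \<open>
  A product system is a family of different modules, so modules are records with an explicit
  carrier set rather than types.
\<close>

record ('x, 'b) hmodule =
  carr :: "'x set"
  vadd :: "'x \<Rightarrow> 'x \<Rightarrow> 'x"
  zer :: "'x"
  sca :: "complex \<Rightarrow> 'x \<Rightarrow> 'x"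
  ract :: "'x \<Rightarrow> 'b \<Rightarrow> 'x"
  ip :: "'x \<Rightarrow> 'x \<Rightarrow> 'b"

definition hminus :: "('x, 'b::cstar_algebra, 'm) hmodule_scheme \<Rightarrow> 'x \<Rightarrow> 'x \<Rightarrow> 'x" where
  "hminus E x y = vadd E x (sca E (-1) y)"

definition hnorm :: "('x, 'b::cstar_algebra, 'm) hmodule_scheme \<Rightarrow> 'x \<Rightarrow> real" where
  "hnorm E x = sqrt (norm (ip E x x))"

locale hilbert_module =
  fixes E :: "('x, 'b::cstar_algebra, 'm) hmodule_scheme"
  assumes zer_closed: "zer E \<in> carr E"
    and vadd_closed: "\<lbrakk>x \<in> carr E; y \<in> carr E\<rbrakk> \<Longrightarrow> vadd E x y \<in> carr E"
    and sca_closed: "x \<in> carr E \<Longrightarrow> sca E c x \<in> carr E"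
    and ract_closed: "x \<in> carr E \<Longrightarrow> ract E x b \<in> carr E"
    and vadd_assoc: "\<lbrakk>x \<in> carr E; y \<in> carr E; z \<in> carr E\<rbrakk> \<Longrightarrow>
          vadd E (vadd E x y) z = vadd E x (vadd E y z)"
    and vadd_commute: "\<lbrakk>x \<in> carr E; y \<in> carr E\<rbrakk> \<Longrightarrow> vadd E x y = vadd E y x"
    and vadd_zer: "x \<in> carr E \<Longrightarrow> vadd E x (zer E) = x"
    and vadd_inverse: "x \<in> carr E \<Longrightarrow> \<exists>y\<in>carr E. vadd E x y = zer E"
    and sca_one: "x \<in> carr E \<Longrightarrow> sca E 1 x = x"
    and sca_sca: "x \<in> carr E \<Longrightarrow> sca E c (sca E d x) = sca E (c * d) x"
    and sca_vadd: "\<lbrakk>x \<in> carr E; y \<in> carr E\<rbrakk> \<Longrightarrow>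
          sca E c (vadd E x y) = vadd E (sca E c x) (sca E c y)"
    and sca_add: "x \<in> carr E \<Longrightarrow> sca E (c + d) x = vadd E (sca E c x) (sca E d x)"
    and ract_vadd: "\<lbrakk>x \<in> carr E; y \<in> carr E\<rbrakk> \<Longrightarrow>
          ract E (vadd E x y) b = vadd E (ract E x b) (ract E y b)"
    and ract_add: "x \<in> carr E \<Longrightarrow> ract E x (b + b') = vadd E (ract E x b) (ract E x b')"
    and ract_mult: "x \<in> carr E \<Longrightarrow> ract E x (b * b') = ract E (ract E x b) b'"
    and ract_sca: "x \<in> carr E \<Longrightarrow> ract E (sca E c x) b = sca E c (ract E x b)"
    and ract_scaleC: "x \<in> carr E \<Longrightarrow> ract E x (scaleC c b) = sca E c (ract E x b)"
    and ip_vadd: "\<lbrakk>x \<in> carr E; y \<in> carr E; z \<in> carr E\<rbrakk> \<Longrightarrow>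
          ip E x (vadd E y z) = ip E x y + ip E x z"
    and ip_sca: "\<lbrakk>x \<in> carr E; y \<in> carr E\<rbrakk> \<Longrightarrow> ip E x (sca E c y) = scaleC c (ip E x y)"
    and ip_ract: "\<lbrakk>x \<in> carr E; y \<in> carr E\<rbrakk> \<Longrightarrow> ip E x (ract E y b) = ip E x y * b"
    and ip_cstar: "\<lbrakk>x \<in> carr E; y \<in> carr E\<rbrakk> \<Longrightarrow> ip E y x = cstar (ip E x y)"
    and ip_positive: "x \<in> carr E \<Longrightarrow> cstar_positive (ip E x x)"
    and ip_definite: "\<lbrakk>x \<in> carr E; ip E x x = 0\<rbrakk> \<Longrightarrow> x = zer E"
    and complete: "\<lbrakk>\<forall>n. f n \<in> carr E;
          \<forall>e>0. \<exists>N. \<forall>m\<ge>N. \<forall>n\<ge>N. hnorm E (hminus E (f m) (f n)) < e\<rbrakk> \<Longrightarrow>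
          \<exists>l\<in>carr E. (\<lambda>n. hnorm E (hminus E (f n) l)) \<longlonglongrightarrow> 0"

inductive_set lin_span ::
    "('x \<Rightarrow> 'x \<Rightarrow> 'x) \<Rightarrow> 'x \<Rightarrow> (complex \<Rightarrow> 'x \<Rightarrow> 'x) \<Rightarrow> 'x set \<Rightarrow> 'x set"
  for p z s G where
    lin_span_zero: "z \<in> lin_span p z s G"
  | lin_span_base: "g \<in> G \<Longrightarrow> g \<in> lin_span p z s G"
  | lin_span_plus: "\<lbrakk>x \<in> lin_span p z s G; y \<in> lin_span p z s G\<rbrakk> \<Longrightarrow> p x y \<in> lin_span p z s G"
  | lin_span_scale: "x \<in> lin_span p z s G \<Longrightarrow> s c x \<in> lin_span p z s G"

definition closed_span :: "('x, 'b::cstar_algebra, 'm) hmodule_scheme \<Rightarrow> 'x set \<Rightarrow> 'x set" where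
  "closed_span E G = {x \<in> carr E. \<forall>e>0. \<exists>y\<in>lin_span (vadd E) (zer E) (sca E) G.
                         hnorm E (hminus E x y) < e}"

definition full :: "('x, 'b::cstar_algebra, 'm) hmodule_scheme \<Rightarrow> bool" where
  "full E \<longleftrightarrow>
     closure (lin_span (+) 0 scaleC {ip E x y | x y. x \<in> carr E \<and> y \<in> carr E}) = UNIV"


section \<open>Adjointable operators\<close>

text \<open>
  Operators are extensional functions (\<open>undefined\<close> outside the carrier), so that equality of
  operators is equality of functions.
\<close>

definition is_adjoint :: "('x, 'b::cstar_algebra, 'm) hmodule_scheme \<Rightarrow>
    ('y, 'b, 'n) hmodule_scheme \<Rightarrow> ('x \<Rightarrow> 'y) \<Rightarrow> ('y \<Rightarrow> 'x) \<Rightarrow> bool" where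
  "is_adjoint E F a b \<longleftrightarrow> b \<in> carr F \<rightarrow>\<^sub>E carr E \<and>
     (\<forall>x\<in>carr E. \<forall>y\<in>carr F. ip F (a x) y = ip E x (b y))"

definition Ba :: "('x, 'b::cstar_algebra, 'm) hmodule_scheme \<Rightarrow>
    ('y, 'b, 'n) hmodule_scheme \<Rightarrow> ('x \<Rightarrow> 'y) set" where
  "Ba E F = {a \<in> carr E \<rightarrow>\<^sub>E carr F. \<exists>b. is_adjoint E F a b}"

definition adj :: "('x, 'b::cstar_algebra, 'm) hmodule_scheme \<Rightarrow>
    ('y, 'b, 'n) hmodule_scheme \<Rightarrow> ('x \<Rightarrow> 'y) \<Rightarrow> ('y \<Rightarrow> 'x)" where
  "adj E F a = (THE b. is_adjoint E F a b)"

definition op_id :: "('x, 'b::cstar_algebra, 'm) hmodule_scheme \<Rightarrow> 'x \<Rightarrow> 'x" where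
  "op_id E = (\<lambda>x\<in>carr E. x)"

definition op_add :: "('x, 'b::cstar_algebra, 'm) hmodule_scheme \<Rightarrow>
    ('x \<Rightarrow> 'x) \<Rightarrow> ('x \<Rightarrow> 'x) \<Rightarrow> 'x \<Rightarrow> 'x" where
  "op_add E a b = (\<lambda>x\<in>carr E. vadd E (a x) (b x))"

definition op_zero :: "('x, 'b::cstar_algebra, 'm) hmodule_scheme \<Rightarrow> 'x \<Rightarrow> 'x" where
  "op_zero E = (\<lambda>x\<in>carr E. zer E)"

definition op_scale :: "('x, 'b::cstar_algebra, 'm) hmodule_scheme \<Rightarrow>
    complex \<Rightarrow> ('x \<Rightarrow> 'x) \<Rightarrow> 'x \<Rightarrow> 'x" where
  "op_scale E c a = (\<lambda>x\<in>carr E. sca E c (a x))"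

definition unitary :: "('x, 'b::cstar_algebra, 'm) hmodule_scheme \<Rightarrow>
    ('y, 'b, 'n) hmodule_scheme \<Rightarrow> ('x \<Rightarrow> 'y) \<Rightarrow> bool" where
  "unitary E F u \<longleftrightarrow> u \<in> Ba E F \<and>
     compose (carr E) (adj E F u) u = op_id E \<and> compose (carr F) u (adj E F u) = op_id F"

definition rank_one :: "('x, 'b::cstar_algebra, 'm) hmodule_scheme \<Rightarrow> 'x \<Rightarrow> 'x \<Rightarrow> 'x \<Rightarrow> 'x" where
  "rank_one E x y = (\<lambda>z\<in>carr E. ract E x (ip E y z))"

text \<open>The closure is with respect to the operator norm.\<close>

definition compacts :: "('x, 'b::cstar_algebra, 'm) hmodule_scheme \<Rightarrow> ('x \<Rightarrow> 'x) set" where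
  "compacts E = {a \<in> Ba E E. \<forall>e>0.
     \<exists>b\<in>lin_span (op_add E) (op_zero E) (op_scale E)
           {rank_one E x y | x y. x \<in> carr E \<and> y \<in> carr E}.
       \<forall>x\<in>carr E. hnorm E (hminus E (a x) (b x)) \<le> e * hnorm E x}"


section \<open>Correspondences and interior tensor products\<close>

record ('x, 'b) corr = "('x, 'b) hmodule" +
  lact :: "'b \<Rightarrow> 'x \<Rightarrow> 'x"

locale correspondence = hilbert_module F
  for F :: "('x, 'b::cstar_algebra, 'm) corr_scheme" +
  assumes lact_closed: "x \<in> carr F \<Longrightarrow> lact F b x \<in> carr F"
    and lact_adjoint: "\<lbrakk>x \<in> carr F; y \<in> carr F\<rbrakk> \<Longrightarrow>
          ip F (lact F b x) y = ip F x (lact F (cstar b) y)"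
    and lact_add: "x \<in> carr F \<Longrightarrow> lact F (b + b') x = vadd F (lact F b x) (lact F b' x)"
    and lact_scaleC: "x \<in> carr F \<Longrightarrow> lact F (scaleC c b) x = sca F c (lact F b x)"
    and lact_mult: "x \<in> carr F \<Longrightarrow> lact F (b * b') x = lact F b (lact F b' x)"
    and lact_nondegenerate: "closed_span F {lact F b x | b x. x \<in> carr F} = carr F"

definition alg_corr :: "('b::cstar_algebra, 'b) corr" where
  "alg_corr = \<lparr>carr = UNIV, vadd = (+), zer = 0, sca = scaleC, ract = (*),
     ip = (\<lambda>a b. cstar a * b), lact = (*)\<rparr>"

definition bilinear_unitary :: "('x, 'b::cstar_algebra, 'm) corr_scheme \<Rightarrow>
    ('y, 'b, 'n) corr_scheme \<Rightarrow> ('x \<Rightarrow> 'y) \<Rightarrow> bool" where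
  "bilinear_unitary E F u \<longleftrightarrow> unitary E F u \<and>
     (\<forall>b. \<forall>x\<in>carr E. u (lact E b x) = lact F b (u x) \<and> u (ract E x b) = ract F (u x) b)"

text \<open>
  The interior tensor product \<open>E \<odot> F\<close> is determined up to unique isomorphism: it is the
  Hilbert module generated by elements \<open>x \<odot> y\<close> with
  \<open>\<langle>x \<odot> y, x' \<odot> y'\<rangle> = \<langle>y, \<langle>x, x'\<rangle> y'\<rangle>\<close>. Here \<open>T\<close> is any such module and
  \<open>\<tau> x y\<close> stands for \<open>x \<odot> y\<close>; bilinearity, balancedness and
  \<open>(x \<odot> y) b = x \<odot> (y b)\<close> follow from the formula for the inner product.
\<close>

definition interior_tensor :: "('x, 'b::cstar_algebra, 'm) hmodule_scheme \<Rightarrow>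
    ('y, 'b, 'n) corr_scheme \<Rightarrow> ('t, 'b, 'k) hmodule_scheme \<Rightarrow> ('x \<Rightarrow> 'y \<Rightarrow> 't) \<Rightarrow> bool" where
  "interior_tensor E F T \<tau> \<longleftrightarrow> hilbert_module T \<and>
     (\<forall>x\<in>carr E. \<forall>y\<in>carr F. \<tau> x y \<in> carr T) \<and>
     (\<forall>x\<in>carr E. \<forall>y\<in>carr F. \<forall>x'\<in>carr E. \<forall>y'\<in>carr F.
        ip T (\<tau> x y) (\<tau> x' y') = ip F y (lact F (ip E x x') y')) \<and>
     closed_span T {\<tau> x y | x y. x \<in> carr E \<and> y \<in> carr F} = carr T"

definition interior_tensor_corr :: "('x, 'b::cstar_algebra, 'm) corr_scheme \<Rightarrow>
    ('y, 'b, 'n) corr_scheme \<Rightarrow> ('t, 'b, 'k) corr_scheme \<Rightarrow> ('x \<Rightarrow> 'y \<Rightarrow> 't) \<Rightarrow> bool" where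
  "interior_tensor_corr E F T \<tau> \<longleftrightarrow> interior_tensor E F T \<tau> \<and> correspondence T \<and>
     (\<forall>b. \<forall>x\<in>carr E. \<forall>y\<in>carr F. lact T b (\<tau> x y) = \<tau> (lact E b x) y)"

text \<open>
  \<open>a \<odot> b\<close> for (adjointable) \<open>a : E \<rightarrow> E'\<close> and (adjointable, bilinear) \<open>b : F \<rightarrow> F'\<close>.
\<close>

definition tensor_map :: "('x, 'b::cstar_algebra, 'm) hmodule_scheme \<Rightarrow>
    ('y, 'b, 'n) corr_scheme \<Rightarrow> ('t, 'b, 'k) hmodule_scheme \<Rightarrow> ('x \<Rightarrow> 'y \<Rightarrow> 't) \<Rightarrow>
    ('t2, 'b, 'k2) hmodule_scheme \<Rightarrow> ('x2 \<Rightarrow> 'y2 \<Rightarrow> 't2) \<Rightarrow>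
    ('x \<Rightarrow> 'x2) \<Rightarrow> ('y \<Rightarrow> 'y2) \<Rightarrow> 't \<Rightarrow> 't2" where
  "tensor_map E F T \<tau> T' \<tau>' a b =
     (THE c. c \<in> Ba T T' \<and> (\<forall>x\<in>carr E. \<forall>y\<in>carr F. c (\<tau> x y) = \<tau>' (a x) (b y)))"


section \<open>Product systems\<close>

text \<open>The index semigroup is a set of real numbers.\<close>

definition index_semigroup :: "real set \<Rightarrow> bool" where
  "index_semigroup S \<longleftrightarrow> S = \<nat> \<or> S = {0..}"

text \<open>
  All fibres live in one type \<open>'x\<close>, which in general does not contain \<open>'b\<close>. Hence the equality
  \<open>E\<^sub>0 = B\<close> is a specified bilinear unitary \<open>ps_unit\<close> from \<open>B\<close> onto the fibre at \<open>0\<close>.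
  The module \<open>ps_tensor s t\<close> with \<open>ps_elem s t\<close> is the tensor product of the fibres at \<open>s\<close>
  and \<open>t\<close>, and \<open>ps_map s t\<close> is the unitary \<open>u\<^sub>s\<^sub>,\<^sub>t\<close>.
\<close>

record ('x, 'z, 'b) product_system_data =
  ps_fib :: "real \<Rightarrow> ('x, 'b) corr"
  ps_unit :: "'b \<Rightarrow> 'x"
  ps_tensor :: "real \<Rightarrow> real \<Rightarrow> ('z, 'b) corr"
  ps_elem :: "real \<Rightarrow> real \<Rightarrow> 'x \<Rightarrow> 'x \<Rightarrow> 'z"
  ps_map :: "real \<Rightarrow> real \<Rightarrow> 'z \<Rightarrow> 'x"

abbreviation fibre :: "('x, 'z, 'b) product_system_data \<Rightarrow> real \<Rightarrow> 'x set" where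
  "fibre P t \<equiv> carr (ps_fib P t)"

definition ps_mult :: "('x, 'z, 'b) product_system_data \<Rightarrow> real \<Rightarrow> real \<Rightarrow> 'x \<Rightarrow> 'x \<Rightarrow> 'x" where
  "ps_mult P s t x y = ps_map P s t (ps_elem P s t x y)"

definition product_system ::
    "real set \<Rightarrow> ('x, 'z, 'b::cstar_algebra) product_system_data \<Rightarrow> bool" where
  "product_system S P \<longleftrightarrow>
     (\<forall>t\<in>S. correspondence (ps_fib P t)) \<and>
     bilinear_unitary alg_corr (ps_fib P 0) (ps_unit P) \<and>
     (\<forall>s\<in>S. \<forall>t\<in>S.
        interior_tensor_corr (ps_fib P s) (ps_fib P t) (ps_tensor P s t) (ps_elem P s t) \<and>
        bilinear_unitary (ps_tensor P s t) (ps_fib P (s + t)) (ps_map P s t)) \<and>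
     (\<forall>r\<in>S. \<forall>s\<in>S. \<forall>t\<in>S. \<forall>x\<in>fibre P r. \<forall>y\<in>fibre P s. \<forall>z\<in>fibre P t.
        ps_mult P (r + s) t (ps_mult P r s x y) z = ps_mult P r (s + t) x (ps_mult P s t y z)) \<and>
     (\<forall>t\<in>S. \<forall>b. \<forall>y\<in>fibre P t.
        ps_mult P 0 t (ps_unit P b) y = lact (ps_fib P t) b y \<and>
        ps_mult P t 0 y (ps_unit P b) = ract (ps_fib P t) y b)"

definition full_product_system ::
    "real set \<Rightarrow> ('x, 'z, 'b::cstar_algebra) product_system_data \<Rightarrow> bool" where
  "full_product_system S P \<longleftrightarrow> product_system S P \<and> (\<forall>t\<in>S. full (ps_fib P t))"

definition product_system_iso :: "real set \<Rightarrow> ('x, 'z, 'b::cstar_algebra) product_system_data \<Rightarrow>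
    ('x2, 'z2, 'b) product_system_data \<Rightarrow> (real \<Rightarrow> 'x \<Rightarrow> 'x2) \<Rightarrow> bool" where
  "product_system_iso S P P' w \<longleftrightarrow> w \<in> extensional S \<and>
     (\<forall>t\<in>S. bilinear_unitary (ps_fib P t) (ps_fib P' t) (w t)) \<and>
     (\<forall>b. w 0 (ps_unit P b) = ps_unit P' b) \<and>
     (\<forall>s\<in>S. \<forall>t\<in>S. \<forall>x\<in>fibre P s. \<forall>y\<in>fibre P t.
        ps_mult P' s t (w s x) (w t y) = w (s + t) (ps_mult P s t x y))"

text \<open>\<open>w\<close> is the unique isomorphism with the property \<open>Q\<close>.\<close>

definition is_unique_iso :: "real set \<Rightarrow> ('x, 'z, 'b::cstar_algebra) product_system_data \<Rightarrow>
    ('x2, 'z2, 'b) product_system_data \<Rightarrow> ((real \<Rightarrow> 'x \<Rightarrow> 'x2) \<Rightarrow> bool) \<Rightarrow>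
    (real \<Rightarrow> 'x \<Rightarrow> 'x2) \<Rightarrow> bool" where
  "is_unique_iso S P P' Q w \<longleftrightarrow> product_system_iso S P P' w \<and> Q w \<and>
     (\<forall>w'. product_system_iso S P P' w' \<and> Q w' \<longrightarrow> w' = w)"


section \<open>Strict \<open>E\<^sub>0\<close>-semigroups\<close>

definition unital_star_endo :: "('e, 'b::cstar_algebra, 'm) hmodule_scheme \<Rightarrow>
    (('e \<Rightarrow> 'e) \<Rightarrow> ('e \<Rightarrow> 'e)) \<Rightarrow> bool" where
  "unital_star_endo E \<theta> \<longleftrightarrow> \<theta> \<in> Ba E E \<rightarrow> Ba E E \<and>
     (\<forall>a\<in>Ba E E. \<forall>b\<in>Ba E E. \<theta> (op_add E a b) = op_add E (\<theta> a) (\<theta> b) \<and>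
        \<theta> (compose (carr E) a b) = compose (carr E) (\<theta> a) (\<theta> b)) \<and>
     (\<forall>c. \<forall>a\<in>Ba E E. \<theta> (op_scale E c a) = op_scale E c (\<theta> a)) \<and>
     (\<forall>a\<in>Ba E E. \<theta> (adj E E a) = adj E E (\<theta> a)) \<and>
     \<theta> (op_id E) = op_id E"

definition e0_semigroup :: "real set \<Rightarrow> ('e, 'b::cstar_algebra, 'm) hmodule_scheme \<Rightarrow>
    (real \<Rightarrow> ('e \<Rightarrow> 'e) \<Rightarrow> ('e \<Rightarrow> 'e)) \<Rightarrow> bool" where
  "e0_semigroup S E \<theta> \<longleftrightarrow> (\<forall>t\<in>S. unital_star_endo E (\<theta> t)) \<and>
     (\<forall>a\<in>Ba E E. \<theta> 0 a = a) \<and>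
     (\<forall>s\<in>S. \<forall>t\<in>S. \<forall>a\<in>Ba E E. \<theta> (s + t) a = \<theta> s (\<theta> t a))"

definition strict_e0_semigroup :: "real set \<Rightarrow> ('e, 'b::cstar_algebra, 'm) hmodule_scheme \<Rightarrow>
    (real \<Rightarrow> ('e \<Rightarrow> 'e) \<Rightarrow> ('e \<Rightarrow> 'e)) \<Rightarrow> bool" where
  "strict_e0_semigroup S E \<theta> \<longleftrightarrow> e0_semigroup S E \<theta> \<and>
     (\<forall>t\<in>S. closed_span E {\<theta> t k x | k x. k \<in> compacts E \<and> x \<in> carr E} = carr E)"

definition inner_iso :: "('e, 'b::cstar_algebra, 'm) hmodule_scheme \<Rightarrow>
    ('f, 'b, 'n) hmodule_scheme \<Rightarrow> ('e \<Rightarrow> 'f) \<Rightarrow> ('e \<Rightarrow> 'e) \<Rightarrow> ('f \<Rightarrow> 'f)" where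
  "inner_iso E E' u =
     (\<lambda>a\<in>Ba E E. compose (carr E') u (compose (carr E') a (adj E E' u)))"

definition conj_semigroup :: "real set \<Rightarrow> ('e, 'b::cstar_algebra, 'm) hmodule_scheme \<Rightarrow>
    ('f, 'b, 'n) hmodule_scheme \<Rightarrow> (('e \<Rightarrow> 'e) \<Rightarrow> ('f \<Rightarrow> 'f)) \<Rightarrow>
    (real \<Rightarrow> ('e \<Rightarrow> 'e) \<Rightarrow> ('e \<Rightarrow> 'e)) \<Rightarrow> real \<Rightarrow> ('f \<Rightarrow> 'f) \<Rightarrow> ('f \<Rightarrow> 'f)" where
  "conj_semigroup S E E' \<alpha> \<theta> =
     (\<lambda>t\<in>S. \<lambda>a\<in>Ba E' E'. \<alpha> (\<theta> t (inv_into (Ba E E) \<alpha> a)))"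


section \<open>Left dilations\<close>

text \<open>
  \<open>dil_tensor t\<close> with \<open>dil_elem t\<close> is the tensor product \<open>E \<odot> E\<^sub>t\<close>, and \<open>dil_map t\<close> is the
  unitary \<open>v\<^sub>t\<close>.
\<close>

record ('e, 'x, 't, 'b) dilation_data =
  dil_tensor :: "real \<Rightarrow> ('t, 'b) hmodule"
  dil_elem :: "real \<Rightarrow> 'e \<Rightarrow> 'x \<Rightarrow> 't"
  dil_map :: "real \<Rightarrow> 't \<Rightarrow> 'e"

definition dil_mult :: "('e, 'x, 't, 'b) dilation_data \<Rightarrow> real \<Rightarrow> 'e \<Rightarrow> 'x \<Rightarrow> 'e" where
  "dil_mult v t x y = dil_map v t (dil_elem v t x y)"

definition left_dilation :: "real set \<Rightarrow> ('e, 'b::cstar_algebra, 'm) hmodule_scheme \<Rightarrow>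
    ('x, 'z, 'b) product_system_data \<Rightarrow> ('e, 'x, 't, 'b) dilation_data \<Rightarrow> bool" where
  "left_dilation S E P v \<longleftrightarrow>
     hilbert_module E \<and> full E \<and> full_product_system S P \<and>
     (\<forall>t\<in>S. interior_tensor E (ps_fib P t) (dil_tensor v t) (dil_elem v t) \<and>
        unitary (dil_tensor v t) E (dil_map v t)) \<and>
     (\<forall>s\<in>S. \<forall>t\<in>S. \<forall>x\<in>carr E. \<forall>y\<in>fibre P s. \<forall>z\<in>fibre P t.
        dil_mult v t (dil_mult v s x y) z = dil_mult v (s + t) x (ps_mult P s t y z)) \<and>
     (\<forall>b. \<forall>x\<in>carr E. dil_mult v 0 x (ps_unit P b) = ract E x b)"

definition dil_semigroup :: "real set \<Rightarrow> ('e, 'b::cstar_algebra, 'm) hmodule_scheme \<Rightarrow>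
    ('x, 'z, 'b) product_system_data \<Rightarrow> ('e, 'x, 't, 'b) dilation_data \<Rightarrow>
    real \<Rightarrow> ('e \<Rightarrow> 'e) \<Rightarrow> ('e \<Rightarrow> 'e)" where
  "dil_semigroup S E P v = (\<lambda>t\<in>S. \<lambda>a\<in>Ba E E.
     compose (carr E) (dil_map v t)
       (compose (carr E)
         (tensor_map E (ps_fib P t) (dil_tensor v t) (dil_elem v t)
            (dil_tensor v t) (dil_elem v t) a (op_id (ps_fib P t)))
         (adj (dil_tensor v t) E (dil_map v t))))"


section \<open>The product system associated with a strict \<open>E\<^sub>0\<close>-semigroup\<close>

text \<open>
  \<open>d t x y\<close> stands for \<open>x\<^sup>* \<odot>\<^sub>t y\<close>. The product system is determined by the formulas below up
  to unique isomorphism respecting the elements \<open>d t x y\<close>; as \<open>E\<^sub>0 = B\<close> is expressed by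
  \<open>ps_unit\<close>, the identification \<open>x\<^sup>* \<odot>\<^sub>0 y = \<langle>x, y\<rangle>\<close> is too.
\<close>

definition associated_product_system :: "real set \<Rightarrow> ('e, 'b::cstar_algebra, 'm) hmodule_scheme \<Rightarrow>
    (real \<Rightarrow> ('e \<Rightarrow> 'e) \<Rightarrow> ('e \<Rightarrow> 'e)) \<Rightarrow> ('x, 'z, 'b) product_system_data \<Rightarrow>
    (real \<Rightarrow> 'e \<Rightarrow> 'e \<Rightarrow> 'x) \<Rightarrow> bool" where
  "associated_product_system S E \<theta> P d \<longleftrightarrow> product_system S P \<and>
     (\<forall>t\<in>S. \<forall>x\<in>carr E. \<forall>y\<in>carr E. d t x y \<in> fibre P t) \<and>
     (\<forall>t\<in>S. closed_span (ps_fib P t) {d t x y | x y. x \<in> carr E \<and> y \<in> carr E} = fibre P t) \<and>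
     (\<forall>t\<in>S. \<forall>x\<in>carr E. \<forall>y\<in>carr E. \<forall>x'\<in>carr E. \<forall>y'\<in>carr E.
        ip (ps_fib P t) (d t x y) (d t x' y') = ip E y (\<theta> t (rank_one E x x') y')) \<and>
     (\<forall>t\<in>S. \<forall>x\<in>carr E. \<forall>y\<in>carr E. \<forall>b.
        ract (ps_fib P t) (d t x y) b = d t x (ract E y b) \<and>
        lact (ps_fib P t) b (d t x y) = d t (ract E x (cstar b)) y) \<and>
     (\<forall>s\<in>S. \<forall>t\<in>S. \<forall>x\<in>carr E. \<forall>x'\<in>carr E. \<forall>y\<in>carr E. \<forall>y'\<in>carr E.
        ps_mult P s t (d s x x') (d t y y') = d (s + t) x (\<theta> t (rank_one E x' y) y')) \<and>
     (\<forall>x\<in>carr E. \<forall>y\<in>carr E. d 0 x y = ps_unit P (ip E x y))"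

definition standard_dilation :: "real set \<Rightarrow> ('e, 'b::cstar_algebra, 'm) hmodule_scheme \<Rightarrow>
    (real \<Rightarrow> ('e \<Rightarrow> 'e) \<Rightarrow> ('e \<Rightarrow> 'e)) \<Rightarrow> ('x, 'z, 'b) product_system_data \<Rightarrow>
    (real \<Rightarrow> 'e \<Rightarrow> 'e \<Rightarrow> 'x) \<Rightarrow> ('e, 'x, 't, 'b) dilation_data \<Rightarrow> bool" where
  "standard_dilation S E \<theta> P d v \<longleftrightarrow> left_dilation S E P v \<and>
     (\<forall>t\<in>S. \<forall>x\<in>carr E. \<forall>y\<in>carr E. \<forall>z\<in>carr E.
        dil_mult v t x (d t y z) = \<theta> t (rank_one E x y) z)"

end

theory Submission
  imports Defs
begin

text \<open>
  For a left dilation, write \<open>M x y = x y\<close> for the product of \<open>x \<in> E\<close> and \<open>y \<in> E\<^sub>t\<close>. Since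
  \<open>\<langle>x y, x' y'\<rangle> = \<langle>y, \<langle>x, x'\<rangle> y'\<rangle>\<close>, the map \<open>M x : E\<^sub>t \<rightarrow> E\<close> is bounded; its adjoint \<open>M\<^sup>* x\<close>, here called
  the annihilation operator, sends \<open>x' y\<close> to \<open>\<langle>x, x'\<rangle> y\<close>. The semigroup of the dilation is visible
  in these operators through its values on rank-one operators: \<open>\<theta>\<^sub>t(x x'\<^sup>*) = M x (M\<^sup>* x')\<close>.

  Hence \<open>\<langle>M\<^sup>* x \<xi>, M\<^sup>* x' \<xi>'\<rangle> = \<langle>\<xi>, \<theta>\<^sub>t(x x'\<^sup>*) \<xi>'\<rangle>\<close>, so that the Gram matrix of the family \<open>M\<^sup>* x \<xi>\<close> in
  \<open>E\<^sub>t\<close> depends only on the semigroup. If \<open>u\<close> conjugates one semigroup into another, then the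
  families \<open>M\<^sup>* x \<xi>\<close> in \<open>E\<^sub>t\<close> and \<open>M'\<^sup>* (u x) (u \<xi>)\<close> in \<open>E'\<^sub>t\<close> have the same Gram matrix. Both are
  total, because the elements \<open>\<langle>x, x'\<rangle> y\<close> are total by fullness of the module and nondegeneracy of
  the left action. So there is a unitary \<open>w\<^sub>t\<close> mapping the first family onto the second, and taking
  adjoints gives \<open>u (x y) = (u x) (w\<^sub>t y)\<close> (lemma \<open>intertwiner_exists\<close>). An element \<open>y'\<close> of \<open>E'\<^sub>t\<close> is
  determined by all products \<open>x' y'\<close>; this forces uniqueness, left linearity of \<open>w\<^sub>t\<close> and
  multiplicativity of the family \<open>w\<close> (lemma \<open>dilation_isomorphism\<close>).

  In the product system associated with a semigroup, \<open>x\<^sup>* \<odot>\<^sub>t \<xi>\<close> is \<open>M\<^sup>* x \<xi>\<close> for the standard dilation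
  (lemma \<open>standard_annihilation\<close>). The formulas for \<open>w\<^sub>t(\<langle>x, y\<rangle> z)\<close> and \<open>w\<^sub>t(x\<^sup>* \<odot>\<^sub>t y)\<close> are therefore the
  defining formula \<open>w\<^sub>t(M\<^sup>* x \<xi>) = M'\<^sup>* (u x) (u \<xi>)\<close> rewritten, and they determine \<open>w\<^sub>t\<close> because they
  prescribe it on a total set.

  The analysis behind this needs the Cauchy-Schwarz inequality in Hilbert modules over an arbitrary
  C*-algebra, and hence two facts on positive elements \<open>b\<^sup>* b\<close>: their sums are positive, and
  \<open>\<parallel>p\<parallel> \<le> \<parallel>p + q\<parallel>\<close> for positive \<open>p, q\<close>. They are proved without spectral theory: an element of a
  unital C*-algebra is called positive if \<open>\<parallel>t 1 - a\<parallel> \<le> t\<close> for some \<open>t\<close>, square roots come from an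
  iteration, and Kaplansky's argument shows that \<open>c\<^sup>* c\<close> is positive in this sense. The general
  case follows by adjoining a unit.
\<close>

section \<open>Square roots by iteration\<close>

lemma cstar_zero [simp]: "cstar (0 :: 'b::cstar_algebra) = 0"
  using cstar_add[of 0 "0::'b"] by simp

lemma scaleC_one [simp]: "scaleC 1 (x :: 'b::cstar_algebra) = x"
  using scaleC_of_real[of 1 x] by simp

lemma scaleC_minus_one [simp]: "scaleC (-1) (x :: 'b::cstar_algebra) = - x"
  using scaleC_of_real[of "-1" x] by simp

lemma scaleC_zero_right [simp]: "scaleC c (0 :: 'b::cstar_algebra) = 0"
  using scaleC_add_right[of c 0 "0::'b"] by simp

lemma scaleC_zero_left [simp]: "scaleC 0 (x :: 'b::cstar_algebra) = 0"
  using scaleC_add_left[of 0 0 x] by simp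

lemma scaleC_minus_right: "scaleC c (- x :: 'b::cstar_algebra) = - scaleC c x"
  using scaleC_add_right[of c x "- x"] by (simp add: eq_neg_iff_add_eq_0 add.commute)

lemma scaleC_diff_right: "scaleC c (x - y :: 'b::cstar_algebra) = scaleC c x - scaleC c y"
  using scaleC_add_right[of c x "- y"] by (simp add: scaleC_minus_right)

lemma cstar_minus [simp]: "cstar (- x :: 'b::cstar_algebra) = - cstar x"
  using cstar_add[of x "- x"] by (simp add: eq_neg_iff_add_eq_0 add.commute)

lemma cstar_diff: "cstar (x - y :: 'b::cstar_algebra) = cstar x - cstar y"
  using cstar_add[of x "- y"] by simp

lemma cstar_scaleR: "cstar (r *\<^sub>R x :: 'b::cstar_algebra) = r *\<^sub>R cstar x"
  by (simp flip: scaleC_of_real add: cstar_scaleC)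

lemmas cstar_simps = cstar_add cstar_diff cstar_scaleR cstar_mult cstar_cstar

lemma norm_cstar [simp]: "norm (cstar x :: 'b::cstar_algebra) = norm x"
proof -
  have le: "norm y \<le> norm (cstar y)" for y :: 'b
  proof (cases "y = 0")
    case False
    have "norm y * norm y \<le> norm (cstar y) * norm y"
      using cstar_identity[of y] norm_mult_ineq[of "cstar y" y] by (simp add: power2_eq_square)
    with False show ?thesis by simp
  qed simp
  from le[of x] le[of "cstar x"] show ?thesis by (simp add: cstar_cstar)
qed

lemma bounded_linear_cstar: "bounded_linear (cstar :: 'b::cstar_algebra \<Rightarrow> 'b)"
  by (rule bounded_linear_intro[where K = 1]) (auto simp: cstar_add cstar_scaleR)

lemma cstar_mult_self_eq_0: "cstar x * x = 0 \<longleftrightarrow> (x :: 'b::cstar_algebra) = 0"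
  using cstar_identity[of x] by auto

lemma selfadjoint_norm_square:
  fixes x :: "'b::cstar_algebra"
  assumes "cstar x = x"
  shows "norm (x * x) = (norm x)\<^sup>2"
  using cstar_identity[of x] assms by simp

lemma selfadjoint_square_eq_0:
  fixes x :: "'b::cstar_algebra"
  assumes "cstar x = x" "x * x = 0"
  shows "x = 0"
  using selfadjoint_norm_square[OF assms(1)] assms(2) by simp

instance cstar_algebra \<subseteq> banach ..

text \<open>
  The iteration \<open>k \<mapsto> (h + k\<^sup>2) / 2\<close> started at \<open>0\<close>. A fixed point \<open>k\<close> satisfies \<open>(1 - k)\<^sup>2 = 1 - h\<close>, but
  the iteration itself makes sense in an algebra without unit.
\<close>

primrec sqrt_iter :: "'b::real_normed_algebra \<Rightarrow> nat \<Rightarrow> 'b" where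
  "sqrt_iter h 0 = 0"
| "sqrt_iter h (Suc n) = (1/2) *\<^sub>R (h + sqrt_iter h n * sqrt_iter h n)"

lemma sqrt_iter_commute:
  fixes h c :: "'b::real_normed_algebra"
  assumes "h * c = c * h"
  shows "sqrt_iter h n * c = c * sqrt_iter h n"
proof (induction n)
  case (Suc n)
  have "sqrt_iter h n * sqrt_iter h n * c = c * (sqrt_iter h n * sqrt_iter h n)"
    using Suc by (metis mult.assoc)
  with assms show ?case by (simp add: algebra_simps)
qed simp

lemma sqrt_iter_one_bounds: "0 \<le> sqrt_iter (1::real) n \<and> sqrt_iter (1::real) n \<le> 1"
proof (induction n)
  case (Suc n)
  then have "sqrt_iter (1::real) n * sqrt_iter (1::real) n \<le> 1" by (simp add: mult_le_one)
  with Suc show ?case by simp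
qed simp

text \<open>
  The iterates are polynomials in \<open>h\<close> with nonnegative coefficients; hence for \<open>\<parallel>h\<parallel> \<le> 1\<close> they, and
  also their increments, are dominated by those of the real iteration with \<open>h = 1\<close>. The latter
  is increasing and bounded by \<open>1\<close>, which gives convergence also in the boundary case \<open>\<parallel>h\<parallel> = 1\<close>.
\<close>

lemma sqrt_iter_norm:
  fixes h :: "'b::real_normed_algebra"
  assumes "norm h \<le> 1"
  shows "norm (sqrt_iter h n) \<le> sqrt_iter 1 n"
proof (induction n)
  case (Suc n)
  have "norm (sqrt_iter h n * sqrt_iter h n) \<le> sqrt_iter 1 n * sqrt_iter 1 n"
    using Suc by (intro order_trans[OF norm_mult_ineq] mult_mono) (auto simp: sqrt_iter_one_bounds)
  with assms have "norm (h + sqrt_iter h n * sqrt_iter h n) \<le> 1 + sqrt_iter 1 n * sqrt_iter 1 n"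
    by (intro order_trans[OF norm_triangle_ineq] add_mono)
  then show ?case by simp
qed simp

lemma sqrt_iter_step:
  fixes h :: "'b::real_normed_algebra"
  assumes "norm h \<le> 1"
  shows "norm (sqrt_iter h (Suc n) - sqrt_iter h n) \<le> sqrt_iter 1 (Suc n) - sqrt_iter 1 n"
proof (induction n)
  case 0
  show ?case using assms by simp
next
  case (Suc n)
  let ?a = "sqrt_iter h (Suc n)" and ?b = "sqrt_iter h n"
  let ?p = "sqrt_iter (1::real) (Suc n)" and ?q = "sqrt_iter (1::real) n"
  have comm: "?a * ?b = ?b * ?a"
    by (rule sqrt_iter_commute, rule sqrt_iter_commute[symmetric]) simp
  have "sqrt_iter h (Suc (Suc n)) - ?a = (1/2) *\<^sub>R ((?a - ?b) * (?a + ?b))"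
    using comm by (subst (1) sqrt_iter.simps(2), subst (3) sqrt_iter.simps(2))
      (simp add: algebra_simps del: sqrt_iter.simps(2))
  also have "norm \<dots> \<le> (1/2) * ((?p - ?q) * (?p + ?q))"
  proof -
    have "norm ((?a - ?b) * (?a + ?b)) \<le> (?p - ?q) * (?p + ?q)"
      using Suc order_trans[OF norm_ge_zero Suc] sqrt_iter_norm[OF assms, of n] sqrt_iter_norm[OF assms, of "Suc n"]
      by (intro order_trans[OF norm_mult_ineq] mult_mono order_trans[OF norm_triangle_ineq] add_mono)
        (auto simp del: sqrt_iter.simps(2) intro: order_trans[OF norm_ge_zero])
    then show ?thesis by simp
  qed
  also have "\<dots> = (1 + ?p * ?p) / 2 - (1 + ?q * ?q) / 2"
    by (simp add: field_simps del: sqrt_iter.simps(2))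
  also have "\<dots> = sqrt_iter 1 (Suc (Suc n)) - ?p" by simp
  finally show ?case .
qed

lemma sqrt_iter_convergent:
  fixes h :: "'b::{real_normed_algebra, banach}"
  assumes h: "norm h \<le> 1"
  shows "convergent (sqrt_iter h)"
proof -
  have tel: "summable (\<lambda>n. sqrt_iter (1::real) (Suc n) - sqrt_iter 1 n)"
  proof -
    have "incseq (sqrt_iter (1::real))"
      by (rule incseq_SucI)
         (use order_trans[OF norm_ge_zero sqrt_iter_step[of "1::real"]] in \<open>simp del: sqrt_iter.simps(2)\<close>)
    then obtain l where "sqrt_iter (1::real) \<longlonglongrightarrow> l"
      using incseq_convergent[of "sqrt_iter 1" 1] sqrt_iter_one_bounds by metis
    then show ?thesis by (rule telescope_summable)
  qed
  have "summable (\<lambda>n. sqrt_iter h (Suc n) - sqrt_iter h n)"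
    by (rule summable_comparison_test'[OF tel, of 0]) (rule sqrt_iter_step[OF h])
  then have "convergent (\<lambda>n. \<Sum>i<n. sqrt_iter h (Suc i) - sqrt_iter h i)"
    by (simp add: summable_iff_convergent del: sqrt_iter.simps(2))
  then show ?thesis
    by (simp add: sum_lessThan_telescope del: sqrt_iter.simps(2))
qed

text \<open>
  In the presence of a unit, \<open>1 - k\<close> is a square root of \<open>1 - h\<close>; the equation is multiplied out so
  that it can be used in the algebra itself.
\<close>

lemma sqrt_one_minus:
  fixes h :: "'b::cstar_algebra"
  assumes h: "norm h \<le> 1"
  obtains k where "2 *\<^sub>R k = h + k * k" "norm k \<le> 1"
    "\<And>c. h * c = c * h \<Longrightarrow> k * c = c * k" "cstar h = h \<Longrightarrow> cstar k = k"
proof -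
  obtain k where k: "sqrt_iter h \<longlonglongrightarrow> k"
    using sqrt_iter_convergent[OF h] by (auto simp: convergent_def)
  show thesis
  proof
    have "(\<lambda>n. sqrt_iter h (Suc n)) \<longlonglongrightarrow> (1/2) *\<^sub>R (h + k * k)"
      unfolding sqrt_iter.simps by (intro tendsto_intros k)
    with LIMSEQ_Suc[OF k] have "k = (1/2) *\<^sub>R (h + k * k)" by (rule LIMSEQ_unique)
    then have "2 *\<^sub>R k = 2 *\<^sub>R ((1/2) *\<^sub>R (h + k * k))" by (rule arg_cong)
    then show "2 *\<^sub>R k = h + k * k" by simp
    have "norm (sqrt_iter h n) \<le> 1" for n
      using sqrt_iter_norm[OF h, of n] sqrt_iter_one_bounds[of n] by linarith
    then show "norm k \<le> 1"
      by (intro LIMSEQ_le_const2[OF tendsto_norm[OF k]]) auto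
    show "k * c = c * k" if "h * c = c * h" for c
    proof -
      have "(\<lambda>n. sqrt_iter h n * c) \<longlonglongrightarrow> k * c" "(\<lambda>n. c * sqrt_iter h n) \<longlonglongrightarrow> c * k"
        by (intro tendsto_intros k)+
      then show ?thesis
        by (simp add: sqrt_iter_commute[OF that] LIMSEQ_unique)
    qed
    show "cstar k = k" if "cstar h = h"
    proof -
      have "cstar (sqrt_iter h n) = sqrt_iter h n" for n
        by (induction n) (simp_all add: cstar_simps that)
      with bounded_linear.tendsto[OF bounded_linear_cstar k] k show ?thesis
        by (simp add: LIMSEQ_unique)
    qed
  qed
qed

section \<open>Positivity in unital C*-algebras\<close>

class unital_cstar_algebra = cstar_algebra + real_normed_algebra_1

lemma cstar_one [simp]: "cstar (1 :: 'a::unital_cstar_algebra) = 1"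
  using cstar_mult[of "cstar 1" "1::'a"] by (simp add: cstar_cstar)

text \<open>
  For self-adjoint \<open>a\<close> this says that the spectrum is nonnegative. Formulated with the norm, the
  property is obviously stable under sums.
\<close>

definition norm_positive :: "'a::unital_cstar_algebra \<Rightarrow> bool" where
  "norm_positive a \<longleftrightarrow> cstar a = a \<and> (\<exists>t\<ge>0. norm (t *\<^sub>R 1 - a) \<le> t)"

lemma norm_positiveI: "cstar a = a \<Longrightarrow> 0 \<le> t \<Longrightarrow> norm (t *\<^sub>R 1 - a) \<le> t \<Longrightarrow> norm_positive a"
  by (auto simp: norm_positive_def)

lemma norm_positive_add:
  assumes "norm_positive a" "norm_positive b"
  shows "norm_positive (a + b)"
proof -
  obtain s t where st: "s \<ge> 0" "norm (s *\<^sub>R 1 - a) \<le> s" "t \<ge> 0" "norm (t *\<^sub>R 1 - b) \<le> t"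
    using assms by (auto simp: norm_positive_def)
  have "norm ((s *\<^sub>R 1 - a) + (t *\<^sub>R 1 - b)) \<le> s + t"
    using st by (intro order_trans[OF norm_triangle_ineq] add_mono)
  then have "norm ((s + t) *\<^sub>R 1 - (a + b)) \<le> s + t"
    by (simp add: algebra_simps)
  with assms st show ?thesis
    by (intro norm_positiveI[where t = "s + t"]) (auto simp: norm_positive_def cstar_add)
qed

lemma norm_positive_scaleR:
  assumes "norm_positive a" "0 \<le> r"
  shows "norm_positive (r *\<^sub>R a)"
proof -
  obtain t where t: "t \<ge> 0" "norm (t *\<^sub>R 1 - a) \<le> t"
    using assms by (auto simp: norm_positive_def)
  have "norm ((r * t) *\<^sub>R 1 - r *\<^sub>R a) = r * norm (t *\<^sub>R 1 - a)"
    using assms(2) by (simp flip: scaleR_scaleR scaleR_diff_right)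
  also have "\<dots> \<le> r * t" using t assms(2) by (simp add: mult_left_mono)
  finally show ?thesis
    using assms t by (intro norm_positiveI[where t = "r * t"]) (auto simp: norm_positive_def cstar_scaleR)
qed

text \<open>
  If \<open>\<parallel>t 1 - a\<parallel> \<le> t\<close>, then \<open>h = 1 - a / t\<close> has norm at most \<open>1\<close>, and \<open>\<surd>t (1 - k)\<close> is the root, where
  \<open>(1 - k)\<^sup>2 = 1 - h\<close>. The root is again positive, since \<open>\<parallel>k\<parallel> \<le> 1\<close>.
\<close>

lemma norm_positive_sqrt:
  assumes "norm_positive a"
  obtains v where "cstar v = v" "v * v = a" "norm_positive v" "\<And>c. a * c = c * a \<Longrightarrow> v * c = c * v"
proof -
  obtain t where t: "t \<ge> 0" "norm (t *\<^sub>R 1 - a) \<le> t" and sa: "cstar a = a"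
    using assms by (auto simp: norm_positive_def)
  show thesis
  proof (cases "t = 0")
    case True
    with t have "a = 0" by simp
    then show thesis using assms by (intro that[of 0]) auto
  next
    case False
    with t have "t > 0" by simp
    define h where "h = 1 - (1/t) *\<^sub>R a"
    have "h = (1/t) *\<^sub>R (t *\<^sub>R 1 - a)"
      using \<open>t > 0\<close> by (simp add: h_def scaleR_diff_right)
    then have h1: "norm h \<le> 1"
      using t \<open>t > 0\<close> by (simp add: divide_simps)
    obtain k where k: "2 *\<^sub>R k = h + k * k" "norm k \<le> 1"
      "\<And>c. h * c = c * h \<Longrightarrow> k * c = c * k" "cstar h = h \<Longrightarrow> cstar k = k"
      using sqrt_one_minus[OF h1] by blast
    define v where "v = sqrt t *\<^sub>R (1 - k)"
    have "cstar h = h" by (simp add: h_def cstar_simps sa)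
    then have sk: "cstar k = k" by (rule k(4))
    have "(1 - k) * (1 - k) = 1 - 2 *\<^sub>R k + k * k"
      by (simp add: algebra_simps scaleR_2)
    also have "\<dots> = (1/t) *\<^sub>R a" by (simp add: k(1) h_def)
    finally have "v * v = a" using \<open>t > 0\<close> by (simp add: v_def)
    moreover have "cstar v = v" by (simp add: v_def cstar_simps sk)
    moreover have "norm_positive v"
    proof -
      have "norm_positive (1 - k)"
        by (rule norm_positiveI[where t = 1]) (auto simp: cstar_simps sk k(2))
      then show ?thesis unfolding v_def using t by (intro norm_positive_scaleR) auto
    qed
    moreover have "v * c = c * v" if "a * c = c * a" for c
    proof -
      have "h * c = c * h" using that by (simp add: h_def algebra_simps)
      from k(3)[OF this] show ?thesis by (simp add: v_def algebra_simps)
    qed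
    ultimately show thesis by (intro that)
  qed
qed

text \<open>
  The element \<open>u = s + i v\<close> is normal with \<open>u\<^sup>* u = s\<^sup>2 + v\<^sup>2\<close>, and \<open>s\<close> is its real part. This replaces
  the functional calculus for the commuting pair \<open>s, v\<close>.
\<close>

lemma norm_square_le_sum_squares:
  fixes s v :: "'a::unital_cstar_algebra"
  assumes "cstar s = s" "cstar v = v" "s * v = v * s"
  shows "(norm s)\<^sup>2 \<le> norm (s * s + v * v)"
proof -
  define u where "u = s + scaleC \<i> v"
  have cu: "cstar u = s - scaleC \<i> v"
    using scaleC_minus_right[of \<i> v] scaleC_scaleC[of "-1" \<i> v] scaleC_scaleC[of \<i> "-1" v]
    by (simp add: u_def cstar_add cstar_scaleC assms)
  have "cstar u * u = s * s + v * v"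
    using assms(3) scaleC_scaleC[of \<i> \<i> "v * v"]
    by (simp add: cu) (simp add: u_def algebra_simps mult_scaleC_left mult_scaleC_right scaleC_diff_right)
  then have "(norm u)\<^sup>2 = norm (s * s + v * v)"
    using cstar_identity[of u] by simp
  moreover have "2 *\<^sub>R s = u + cstar u" by (simp add: cu scaleR_2) (simp add: u_def)
  then have "2 * norm s \<le> norm u + norm (cstar u)"
    by (metis abs_numeral norm_scaleR norm_triangle_ineq)
  then have "(norm s)\<^sup>2 \<le> (norm u)\<^sup>2" by (intro power_mono) auto
  ultimately show ?thesis by simp
qed

text \<open>
  If \<open>\<parallel>s\<parallel> \<le> 1\<close>, then \<open>1 - s\<^sup>2 = v\<^sup>2\<close> with \<open>v\<close> commuting with \<open>s\<close>, so that \<open>\<parallel>1 - s\<^sup>2\<parallel> = \<parallel>v\<parallel>\<^sup>2 \<le> \<parallel>v\<^sup>2 + s\<^sup>2\<parallel> = 1\<close>.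
\<close>

lemma norm_positive_square:
  fixes s :: "'a::unital_cstar_algebra"
  assumes "cstar s = s"
  shows "norm_positive (s * s)"
proof -
  have 1: "norm_positive (s * s)" if sa: "cstar s = s" and le: "norm s \<le> 1" for s :: 'a
  proof (rule norm_positiveI[where t = 1])
    have "norm (s * s) \<le> 1"
      using selfadjoint_norm_square[OF sa] le by (simp add: power_le_one)
    moreover have "cstar (s * s) = s * s" by (simp add: cstar_mult sa)
    ultimately obtain k where k: "2 *\<^sub>R k = s * s + k * k"
      "\<And>c. s * s * c = c * (s * s) \<Longrightarrow> k * c = c * k" "cstar k = k"
      using sqrt_one_minus[of "s * s"] by metis
    define v where "v = 1 - k"
    have v: "v * v = 1 - s * s" "cstar v = v" "v * s = s * v"
      using k(2)[of s] k(1,3) by (auto simp: v_def algebra_simps scaleR_2 cstar_simps)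
    have "(norm v)\<^sup>2 \<le> norm (v * v + s * s)"
      by (rule norm_square_le_sum_squares) (auto simp: v sa)
    then show "norm (1 *\<^sub>R 1 - s * s) \<le> 1"
      using selfadjoint_norm_square[OF v(2)] by (simp add: v(1))
  qed (auto simp: cstar_mult sa)
  show ?thesis
  proof (cases "s = 0")
    case True
    then show ?thesis using 1[of 0] by simp
  next
    case False
    have "norm_positive ((1 / norm s) *\<^sub>R s * (1 / norm s) *\<^sub>R s)"
      by (rule 1) (auto simp: cstar_scaleR assms False)
    then have "norm_positive ((norm s)\<^sup>2 *\<^sub>R ((1 / norm s) *\<^sub>R s * (1 / norm s) *\<^sub>R s))"
      by (rule norm_positive_scaleR) simp
    then show ?thesis using False by (simp add: power2_eq_square)
  qed
qed

lemma norm_positive_antisym: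
  assumes "norm_positive a" "norm_positive (- a)"
  shows "a = 0"
proof -
  obtain s where s: "cstar s = s" "s * s = a" using norm_positive_sqrt[OF assms(1)] by metis
  obtain v where v: "cstar v = v" "v * v = - a" "\<And>c. - a * c = c * - a \<Longrightarrow> v * c = c * v"
    using norm_positive_sqrt[OF assms(2)] by metis
  have "s * v = v * s" using v(3)[of s] by (simp flip: s(2) add: mult.assoc)
  from norm_square_le_sum_squares[OF s(1) v(1) this] have "s = 0"
    by (simp add: s v)
  with s show ?thesis by simp
qed

lemma norm_power_two_power:
  fixes y :: "'a::unital_cstar_algebra"
  assumes "cstar y = y"
  shows "norm (y ^ 2 ^ m) = norm y ^ 2 ^ m"
proof (induction m)
  case (Suc m)
  have "cstar (y ^ n) = y ^ n" for n
    by (induction n) (simp_all add: cstar_mult assms power_commutes)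
  from selfadjoint_norm_square[OF this, of "2 ^ m"] Suc
  show ?case by (simp add: power_mult[symmetric] mult.commute power_add mult_2 power2_eq_square flip: power_add)
qed simp

text \<open>
  A substitute for the spectral radius formula: exponential growth of \<open>(r / t)\<^sup>n\<close> along \<open>n = 2\<^sup>m\<close> beats
  the linear factor. Only powers of two occur because only for these \<open>\<parallel>y\<^sup>n\<parallel> = \<parallel>y\<parallel>\<^sup>n\<close> follows at
  once from the C*-identity.
\<close>

lemma linear_bound_on_powers:
  fixes r t K :: real
  assumes t: "t > 0" and bound: "\<And>m. r ^ 2 ^ m \<le> t ^ 2 ^ m * (1 + 2 ^ m * K)"
  shows "r \<le> t"
proof (rule ccontr)
  assume "\<not> r \<le> t"
  define q where "q = r / t"
  have q: "1 < q" using \<open>\<not> r \<le> t\<close> t by (simp add: q_def)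
  have le: "q ^ 2 ^ m \<le> 1 + 2 ^ m * K" for m
    using bound[of m] t by (simp add: q_def power_divide divide_simps mult.commute)
  define d where "d = q - 1"
  have d: "d > 0" using q by (simp add: d_def)
  have small: "2 ^ m * d\<^sup>2 \<le> 2 * K" for m :: nat
  proof -
    let ?N = "2 ^ m :: nat"
    have "(1 + real ?N * d)\<^sup>2 \<le> (q ^ ?N)\<^sup>2"
      using Bernoulli_inequality[of d ?N] d by (intro power_mono) (auto simp: d_def)
    also have "(q ^ ?N)\<^sup>2 \<le> 1 + 2 ^ Suc m * K"
      using le[of "Suc m"] by (simp add: power_mult[symmetric] mult.commute)
    finally have "1 + 2 * 2 ^ m * d + (2 ^ m)\<^sup>2 * d\<^sup>2 \<le> 1 + 2 * 2 ^ m * K"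
      by (simp add: power2_eq_square algebra_simps)
    then have "2 ^ m * (2 * d + 2 ^ m * d\<^sup>2) \<le> 2 ^ m * (2 * K)"
      by (simp add: power2_eq_square algebra_simps)
    then have "2 * d + 2 ^ m * d\<^sup>2 \<le> 2 * K"
      by (rule mult_left_le_imp_le) simp
    with d show ?thesis by simp
  qed
  obtain m where "2 * K / d\<^sup>2 < 2 ^ m"
    using real_arch_pow[of 2 "2 * K / d\<^sup>2"] by auto
  with d have "2 * K < 2 ^ m * d\<^sup>2" by (simp add: divide_simps)
  with small[of m] show False by simp
qed

text \<open>
  Up to \<open>0\<close>, the spectra of \<open>c\<^sup>* c\<close> and \<open>c c\<^sup>*\<close> agree. In terms of norms: with \<open>X = t 1 + c\<^sup>* c\<close> and
  \<open>Y = t 1 + c c\<^sup>*\<close> one has \<open>Y\<^sup>n c = c X\<^sup>n\<close>, so a bound \<open>\<parallel>X\<parallel> \<le> t\<close> makes \<open>\<parallel>Y\<^sup>n\<parallel> / t\<^sup>n\<close> grow at most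
  linearly in \<open>n\<close>, and hence \<open>\<parallel>Y\<parallel> \<le> t\<close>.
\<close>

lemma norm_positive_neg_swap:
  fixes c :: "'a::unital_cstar_algebra"
  assumes "norm_positive (- (cstar c * c))"
  shows "norm_positive (- (c * cstar c))"
proof -
  obtain t0 where t0: "t0 \<ge> 0" "norm (t0 *\<^sub>R 1 + cstar c * c) \<le> t0"
    using assms by (auto simp: norm_positive_def)
  \<comment> \<open>\<open>t0\<close> may be \<open>0\<close>, and the estimate below divides by \<open>t\<close>.\<close>
  define t where "t = t0 + 1"
  have t: "t > 0" using t0 by (simp add: t_def)
  define X where "X = t *\<^sub>R 1 + cstar c * c"
  define Y where "Y = t *\<^sub>R 1 + c * cstar c"
  have X: "norm X \<le> t"
    using norm_triangle_ineq[of 1 "t0 *\<^sub>R 1 + cstar c * c"] t0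
    by (simp add: X_def t_def scaleR_add_left algebra_simps)
  have intertwine: "Y ^ n * c = c * X ^ n" for n
  proof (induction n)
    case (Suc n)
    have "Y * c = c * X" by (simp add: X_def Y_def algebra_simps)
    with Suc show ?case by (metis mult.assoc power_Suc power_Suc2)
  qed simp
  have Yn: "norm (Y ^ n) \<le> t ^ n * (1 + n * ((norm c)\<^sup>2 / t))" for n
  proof (induction n)
    case (Suc n)
    have "Y ^ Suc n = t *\<^sub>R Y ^ n + Y ^ n * c * cstar c"
      by (simp add: power_Suc2 Y_def algebra_simps del: power_Suc)
    also have "norm \<dots> \<le> t * norm (Y ^ n) + norm (c * X ^ n * cstar c)"
      unfolding intertwine using t by (intro order_trans[OF norm_triangle_ineq]) auto
    also have "norm (c * X ^ n * cstar c) \<le> norm c * norm (X ^ n) * norm c"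
      using norm_mult_ineq[of "c * X ^ n" "cstar c"] norm_mult_ineq[of c "X ^ n"]
      by (smt (verit) mult_right_mono norm_cstar norm_ge_zero)
    also have "norm c * norm (X ^ n) * norm c \<le> norm c * t ^ n * norm c"
      using X norm_power_ineq[of X n] power_mono[OF X, of n]
      using t by (intro mult_mono) (auto intro: order_trans)
    also have "t * norm (Y ^ n) \<le> t * (t ^ n * (1 + n * ((norm c)\<^sup>2 / t)))"
      using Suc t by simp
    finally show ?case using t by (simp add: field_simps power2_eq_square)
  qed simp
  have sa: "cstar Y = Y" by (simp add: Y_def cstar_simps)
  have "norm Y \<le> t"
    by (rule linear_bound_on_powers[OF t, where K = "(norm c)\<^sup>2 / t"])
      (use Yn norm_power_two_power[OF sa] in \<open>metis of_nat_numeral of_nat_power\<close>)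
  then show ?thesis using t by (intro norm_positiveI[where t = t]) (auto simp: Y_def cstar_simps)
qed

text \<open>
  Here \<open>y = h + i k\<close> is the decomposition into real and imaginary part. It shows that \<open>y\<^sup>* y + y y\<^sup>*\<close> is
  positive before anything is known about the two summands.
\<close>

lemma complex_parts:
  fixes y :: "'a::unital_cstar_algebra"
  obtains h k where "cstar h = h" "cstar k = k"
    "cstar y * y + y * cstar y = 2 *\<^sub>R (h * h) + 2 *\<^sub>R (k * k)"
proof -
  define h where "h = (1/2) *\<^sub>R (y + cstar y)"
  define k where "k = scaleC (\<i>/2) (cstar y - y)"
  have k': "scaleC c (cstar y - y) = scaleC (- c) (y - cstar y)" for c
    using scaleC_scaleC[of c "-1" "y - cstar y"] by simp
  show thesis
  proof
    show "cstar h = h" by (simp add: h_def cstar_simps add.commute)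
    show "cstar k = k" unfolding k_def cstar_scaleC by (subst k') (simp add: cstar_simps)
    have k4: "4 *\<^sub>R (k * k) = - ((cstar y - y) * (cstar y - y))"
      using scaleC_of_real[of "-1/4" "(cstar y - y) * (cstar y - y)"]
      by (simp add: k_def mult_scaleC_left mult_scaleC_right scaleC_scaleC)
    have h4: "4 *\<^sub>R (h * h) = (y + cstar y) * (y + cstar y)"
      by (simp add: h_def)
    have "2 *\<^sub>R (2 *\<^sub>R (h * h) + 2 *\<^sub>R (k * k)) = 2 *\<^sub>R (cstar y * y + y * cstar y)"
      by (simp add: scaleR_add_right h4 k4) (simp add: algebra_simps scaleR_2)
    then show "cstar y * y + y * cstar y = 2 *\<^sub>R (h * h) + 2 *\<^sub>R (k * k)" by simp
  qed
qed

text \<open>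
  Kaplansky's argument. Let \<open>a = c\<^sup>* c\<close>, let \<open>m = \<surd>(a\<^sup>2)\<close> be its absolute value, and let \<open>f = m - a\<close>, which is twice
  the negative part of \<open>a\<close>. For \<open>y = c f\<close> the element \<open>y\<^sup>* y = f a f = - m f\<^sup>2\<close> is negative, hence so is \<open>y y\<^sup>*\<close>.
  But \<open>y\<^sup>* y + y y\<^sup>*\<close> is positive, so \<open>y\<^sup>* y\<close> is positive as well and must vanish. Then \<open>a f = 0\<close>, which
  gives \<open>f\<^sup>2 = - 2 a f = 0\<close> and \<open>a = m\<close>.
\<close>

lemma norm_positive_cstar_mult:
  fixes c :: "'a::unital_cstar_algebra"
  shows "norm_positive (cstar c * c)"
proof -
  define a where "a = cstar c * c"
  have sa: "cstar a = a" by (simp add: a_def cstar_simps)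
  obtain m where m: "cstar m = m" "m * m = a * a" "norm_positive m" "m * a = a * m"
    using norm_positive_sqrt[OF norm_positive_square[OF sa]] by (metis mult.assoc)
  obtain r where r: "cstar r = r" "r * r = m" "\<And>c. m * c = c * m \<Longrightarrow> r * c = c * r"
    using norm_positive_sqrt[OF m(3)] by metis
  define f where "f = m - a"
  have sf: "cstar f = f" by (simp add: f_def cstar_simps sa m)
  have mf: "m * f = f * m" by (simp add: f_def algebra_simps m(4))
  have rf: "r * f = f * r" by (rule r(3)[OF mf])
  define y where "y = c * f"
  have "f * a = - (m * f)" by (simp add: f_def algebra_simps m)
  then have "cstar y * y = - (m * f * f)"
    by (simp add: y_def cstar_mult sf mult.assoc) (simp add: a_def flip: mult.assoc)
  also have "m * f * f = (r * f) * (r * f)"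
    using rf by (metis r(2) mult.assoc)
  finally have yy: "cstar y * y = - ((r * f) * (r * f))" .
  have "cstar (r * f) = r * f" by (simp add: cstar_mult sf r rf)
  from norm_positive_square[OF this] have neg: "norm_positive (- (cstar y * y))" by (simp add: yy)
  obtain h k where hk: "cstar h = h" "cstar k = k"
    "cstar y * y + y * cstar y = 2 *\<^sub>R (h * h) + 2 *\<^sub>R (k * k)"
    by (rule complex_parts)
  have "norm_positive (cstar y * y + y * cstar y)"
    unfolding hk(3) by (intro norm_positive_add norm_positive_scaleR norm_positive_square hk) auto
  from norm_positive_add[OF this norm_positive_neg_swap[OF neg]] have "norm_positive (cstar y * y)" by simp
  then have "cstar y * y = 0" using neg by (rule norm_positive_antisym)
  then have "y = 0" by (simp add: cstar_mult_self_eq_0)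
  then have "a * f = 0" by (simp add: a_def y_def mult.assoc)
  moreover have "f * f = - (a * f) - a * f"
    by (simp add: f_def algebra_simps m)
  ultimately have "f = 0" using selfadjoint_square_eq_0[OF sf] by simp
  with m(3) show ?thesis by (simp add: f_def a_def)
qed

lemma norm_positive_norm_minus:
  fixes x :: "'a::unital_cstar_algebra"
  assumes "cstar x = x"
  shows "norm_positive (norm x *\<^sub>R 1 - x)"
proof (rule norm_positiveI[where t = "norm x"])
qed (auto simp: cstar_simps assms)

text \<open>
  With \<open>R = \<parallel>a + b\<parallel>\<close>, the element \<open>R 1 - a = (R 1 - (a + b)) + b\<close> is positive. Square roots \<open>s\<close> of \<open>a\<close> and \<open>v\<close> of
  \<open>R 1 - a\<close> commute, so \<open>\<parallel>a\<parallel> = \<parallel>s\<parallel>\<^sup>2 \<le> \<parallel>s\<^sup>2 + v\<^sup>2\<parallel> = R\<close>.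
\<close>

lemma norm_positive_norm_mono:
  assumes "norm_positive a" "norm_positive b"
  shows "norm a \<le> norm (a + b)"
proof -
  let ?R = "norm (a + b)"
  have "cstar (a + b) = a + b"
    using assms by (simp add: norm_positive_def cstar_add)
  from norm_positive_add[OF norm_positive_norm_minus[OF this] assms(2)]
  have "norm_positive (?R *\<^sub>R 1 - a)" by (simp add: algebra_simps)
  then obtain v where v: "cstar v = v" "v * v = ?R *\<^sub>R 1 - a"
      "\<And>c. (?R *\<^sub>R 1 - a) * c = c * (?R *\<^sub>R 1 - a) \<Longrightarrow> v * c = c * v"
    using norm_positive_sqrt by metis
  obtain s where s: "cstar s = s" "s * s = a" using norm_positive_sqrt[OF assms(1)] by metis
  have "a * s = s * a" by (simp flip: s(2) add: mult.assoc)
  then have "s * v = v * s" using v(3)[of s] by (simp add: algebra_simps)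
  from norm_square_le_sum_squares[OF s(1) v(1) this] show ?thesis
    using selfadjoint_norm_square[OF s(1)] by (simp add: s v)
qed

section \<open>Adjoining a unit\<close>

datatype 'b unitization = Unitization (scalar: complex) (element: 'b)

text \<open>
  The norm of the unitization comes from its action on the algebra by left multiplication. If the
  algebra has a unit already, this action is not faithful; taking the maximum with the modulus of
  the scalar part repairs this and keeps the C*-identity.
\<close>

definition unitization_act :: "'b::cstar_algebra unitization \<Rightarrow> 'b \<Rightarrow> 'b" where
  "unitization_act x b = scaleC (scalar x) b + element x * b"

lemma bounded_linear_unitization_act: "bounded_linear (unitization_act x)"
proof -
  have "bounded_linear (\<lambda>b. scaleC (scalar x) b :: 'a)"
    by (rule bounded_linear_intro[where K = "cmod (scalar x)"])
       (auto simp: scaleC_add_right norm_scaleC mult.commute scaleC_scaleC simp flip: scaleC_of_real)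
  then show ?thesis
    unfolding unitization_act_def by (intro bounded_linear_add bounded_linear_mult_right)
qed

lemma norm_unitization_act_le: "norm (unitization_act x b) \<le> onorm (unitization_act x) * norm b"
  by (rule onorm[OF bounded_linear_unitization_act])

instantiation unitization :: (cstar_algebra) real_normed_algebra_1
begin

definition "0 = Unitization 0 0"
definition "1 = Unitization 1 0"
definition "x + y = Unitization (scalar x + scalar y) (element x + element y)"
definition "- x = Unitization (- scalar x) (- element x)"
definition "x - y = Unitization (scalar x - scalar y) (element x - element y)"
definition "x * y = Unitization (scalar x * scalar y)
  (scaleC (scalar x) (element y) + scaleC (scalar y) (element x) + element x * element y)"
definition "r *\<^sub>R x = Unitization (r *\<^sub>R scalar x) (r *\<^sub>R element x)"
definition "norm x = max (cmod (scalar x)) (onorm (unitization_act x))"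
definition "sgn (x :: 'a unitization) = inverse (norm x) *\<^sub>R x"
definition "dist (x :: 'a unitization) y = norm (x - y)"
definition "(uniformity :: ('a unitization \<times> 'a unitization) filter) =
  (INF e\<in>{0 <..}. principal {(x, y). dist x y < e})"
definition "open (U :: 'a unitization set) \<longleftrightarrow>
  (\<forall>x\<in>U. eventually (\<lambda>(x', y). x' = x \<longrightarrow> y \<in> U) uniformity)"

lemmas unitization_ops = zero_unitization_def one_unitization_def plus_unitization_def
  uminus_unitization_def minus_unitization_def times_unitization_def scaleR_unitization_def

lemma act_add: "unitization_act (x + y) b = unitization_act x b + unitization_act y b"
  by (simp add: unitization_act_def unitization_ops scaleC_add_left algebra_simps)

lemma act_mult: "unitization_act (x * y) b = unitization_act x (unitization_act y b)"
  by (simp add: unitization_act_def unitization_ops scaleC_add_right scaleC_scaleC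
      mult_scaleC_left mult_scaleC_right algebra_simps)

lemma act_scaleR: "unitization_act (r *\<^sub>R x) b = r *\<^sub>R unitization_act x b"
  by (simp add: unitization_act_def unitization_ops scaleC_add_right scaleC_scaleC mult_scaleC_left
      scaleR_conv_of_real flip: scaleC_of_real)

lemma act_eq_0_iff: "scalar x = 0 \<Longrightarrow> (\<forall>b. unitization_act x b = 0) \<longleftrightarrow> element x = 0"
proof
  assume "scalar x = 0" "\<forall>b. unitization_act x b = 0"
  then have "element x * cstar (element x) = 0" by (simp add: unitization_act_def)
  then show "element x = 0"
    using cstar_mult_self_eq_0[of "cstar (element x)"] norm_cstar[of "element x"]
    by (simp add: cstar_cstar)
qed (simp add: unitization_act_def)

lemma norm_mult_unitization: "norm (x * y) \<le> norm x * norm (y :: 'a unitization)"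
proof -
  have "onorm (unitization_act (x * y)) \<le> onorm (unitization_act x) * onorm (unitization_act y)"
    using onorm_compose[OF bounded_linear_unitization_act bounded_linear_unitization_act, of x y]
    by (simp add: act_mult[abs_def] o_def)
  also have "\<dots> \<le> norm x * norm y"
    unfolding norm_unitization_def
    by (intro mult_mono onorm_pos_le bounded_linear_unitization_act) (auto simp: le_max_iff_disj)
  moreover have "cmod (scalar (x * y)) \<le> norm x * norm y"
    unfolding norm_unitization_def times_unitization_def unitization.sel norm_mult
    by (intro mult_mono) (auto simp: le_max_iff_disj)
  ultimately show ?thesis by (simp add: norm_unitization_def)
qed

text \<open>
  Testing left multiplication by \<open>b\<close> on \<open>b\<^sup>*\<close> shows that the algebra embeds isometrically. All norm
  statements about positive elements pass to the algebra through this embedding.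
\<close>

lemma norm_element: "norm (Unitization 0 b :: 'a unitization) = norm b"
proof -
  have "onorm (unitization_act (Unitization 0 b)) = norm b"
  proof (rule antisym)
    show "onorm (unitization_act (Unitization 0 b)) \<le> norm b"
      by (rule onorm_bound) (auto simp: unitization_act_def norm_mult_ineq)
    show "norm b \<le> onorm (unitization_act (Unitization 0 b))"
    proof (cases "b = 0")
      case True
      then show ?thesis by (simp add: onorm_pos_le[OF bounded_linear_unitization_act])
    next
      case False
      have "norm b * norm b \<le> onorm (unitization_act (Unitization 0 b)) * norm b"
        using norm_unitization_act_le[of "Unitization 0 b" "cstar b"] cstar_identity[of "cstar b"]
        by (simp add: unitization_act_def cstar_cstar power2_eq_square)
      with False show ?thesis by simp
    qed
  qed
  then show ?thesis by (simp add: norm_unitization_def)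
qed

instance
proof
  fix x y z :: "'a unitization" and a b :: real
  show "x + y + z = x + (y + z)" "x + y = y + x" "0 + x = x" "- x + x = 0" "x - y = x + - y"
    by (simp_all add: unitization_ops add.assoc add.commute)
  show "a *\<^sub>R (x + y) = a *\<^sub>R x + a *\<^sub>R y" "(a + b) *\<^sub>R x = a *\<^sub>R x + b *\<^sub>R x"
    "a *\<^sub>R b *\<^sub>R x = (a * b) *\<^sub>R x" "1 *\<^sub>R x = x"
    by (simp_all add: unitization_ops algebra_simps)
  show "x * y * z = x * (y * z)" "(x + y) * z = x * z + y * z" "x * (y + z) = x * y + x * z"
    by (simp_all add: unitization_ops algebra_simps scaleC_add_right scaleC_add_left scaleC_scaleC
        mult_scaleC_left mult_scaleC_right)
  show "1 * x = x" "x * 1 = x" "(0 :: 'a unitization) \<noteq> 1"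
    by (simp_all add: unitization_ops)
  show "a *\<^sub>R x * y = a *\<^sub>R (x * y)" "x * a *\<^sub>R y = a *\<^sub>R (x * y)"
    by (simp_all add: unitization_ops mult_scaleC_left mult_scaleC_right scaleC_scaleC
        scaleR_conv_of_real scaleC_add_right algebra_simps flip: scaleC_of_real)
  show "dist x y = norm (x - y)" "sgn x = inverse (norm x) *\<^sub>R x"
    by (simp_all add: dist_unitization_def sgn_unitization_def)
  show "(uniformity :: ('a unitization \<times> 'a unitization) filter) =
      (INF e\<in>{0 <..}. principal {(x, y). dist x y < e})"
    by (simp add: uniformity_unitization_def)
  show "open U \<longleftrightarrow> (\<forall>x\<in>U. eventually (\<lambda>(x', y). x' = x \<longrightarrow> y \<in> U) uniformity)"
    for U :: "'a unitization set"
    by (simp add: open_unitization_def)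
  have onorm0: "onorm (unitization_act x) = 0 \<longleftrightarrow> (\<forall>b. unitization_act x b = 0)"
    by (rule onorm_eq_0[OF bounded_linear_unitization_act])
  show "norm x = 0 \<longleftrightarrow> x = 0"
  proof
    assume "norm x = 0"
    then have "cmod (scalar x) \<le> 0" "onorm (unitization_act x) \<le> 0"
      by (metis max.cobounded1 max.cobounded2 norm_unitization_def)+
    then have "scalar x = 0" "onorm (unitization_act x) = 0"
      using onorm_pos_le[OF bounded_linear_unitization_act, of x] by auto
    then show "x = 0" using onorm0 act_eq_0_iff[of x]
      by (simp add: zero_unitization_def unitization.expand)
  next
    assume "x = 0"
    then show "norm x = 0" using norm_element[of 0] by (simp add: zero_unitization_def)
  qed
  show "norm (x + y) \<le> norm x + norm y"
  proof -
    have "onorm (unitization_act (x + y)) \<le> onorm (unitization_act x) + onorm (unitization_act y)"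
      using onorm_triangle[OF bounded_linear_unitization_act bounded_linear_unitization_act, of x y]
      by (simp add: act_add[abs_def])
    moreover have "cmod (scalar (x + y)) \<le> cmod (scalar x) + cmod (scalar y)"
      by (simp add: plus_unitization_def norm_triangle_ineq)
    ultimately show ?thesis unfolding norm_unitization_def by linarith
  qed
  show "norm (a *\<^sub>R x) = \<bar>a\<bar> * norm x"
    using onorm_scaleR[OF bounded_linear_unitization_act, of a x]
    by (simp add: norm_unitization_def act_scaleR[abs_def] max_mult_distrib_left)
      (simp add: scaleR_unitization_def norm_mult)
  show "norm (x * y) \<le> norm x * norm y" by (rule norm_mult_unitization)
  show "norm (1 :: 'a unitization) = 1"
  proof -
    have "onorm (unitization_act (1 :: 'a unitization)) \<le> 1"
      by (rule onorm_bound) (auto simp: unitization_act_def one_unitization_def)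
    then show ?thesis by (simp add: norm_unitization_def) (simp add: one_unitization_def max_def)
  qed
qed

end

instantiation unitization :: (cstar_algebra) cstar_algebra
begin

definition "scaleC c x = Unitization (c * scalar x) (scaleC c (element x))"
definition "cstar x = Unitization (cnj (scalar x)) (cstar (element x))"
lemmas unitization_star_ops = unitization_ops scaleC_unitization_def cstar_unitization_def

lemma act_scaleC: "unitization_act (scaleC c x) b = scaleC c (unitization_act x b)"
  by (simp add: unitization_act_def unitization_star_ops scaleC_add_right scaleC_scaleC mult_scaleC_left)

lemma act_adjoint: "cstar (unitization_act x b) * c = cstar b * unitization_act (cstar x) c"
  by (simp add: unitization_act_def unitization_star_ops cstar_add cstar_scaleC cstar_mult
      mult_scaleC_left mult_scaleC_right algebra_simps)

lemma norm_scaleC_unitization: "norm (scaleC c (x :: 'a unitization)) = cmod c * norm x"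
proof -
  have le: "onorm (unitization_act (scaleC c x)) \<le> cmod c * onorm (unitization_act x)" for c and x :: "'a unitization"
    by (intro onorm_bound mult_nonneg_nonneg onorm_pos_le bounded_linear_unitization_act)
      (auto simp: act_scaleC norm_scaleC mult.assoc intro: mult_left_mono norm_unitization_act_le)
  have "onorm (unitization_act (scaleC c x)) = cmod c * onorm (unitization_act x)"
  proof (cases "c = 0")
    case True
    with le[of c x] onorm_pos_le[OF bounded_linear_unitization_act, of "scaleC c x"] show ?thesis
      by simp
  next
    case False
    have "scaleC (inverse c) (scaleC c x) = x"
      using False by (simp add: unitization_star_ops scaleC_scaleC flip: mult.assoc)
    with le[of "inverse c" "scaleC c x"]
    have "onorm (unitization_act x) \<le> inverse (cmod c) * onorm (unitization_act (scaleC c x))"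
      by (simp add: norm_inverse)
    with le[of c x] False show ?thesis by (simp add: field_simps)
  qed
  then show ?thesis
    by (simp add: norm_unitization_def max_mult_distrib_left) (simp add: unitization_star_ops norm_mult)
qed

lemma scaleC_of_real_unitization: "scaleC (complex_of_real r) (x :: 'a unitization) = r *\<^sub>R x"
  by (simp add: unitization_star_ops scaleC_of_real scaleR_conv_of_real)

text \<open>
  As for operators on a Hilbert space: \<open>\<parallel>x b\<parallel>\<^sup>2 = \<parallel>b\<^sup>* (x\<^sup>* x) b\<parallel>\<close> bounds \<open>\<parallel>x\<parallel>\<^sup>2\<close> by \<open>\<parallel>x\<^sup>* x\<parallel>\<close>. The reverse
  inequality uses \<open>\<parallel>x\<^sup>*\<parallel> \<le> \<parallel>x\<parallel>\<close>, which follows from the first.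
\<close>

lemma cstar_identity_unitization: "norm (cstar x * x) = (norm (x :: 'a unitization))\<^sup>2"
proof -
  have act_sq: "(norm (unitization_act x b))\<^sup>2 \<le> onorm (unitization_act (cstar x * x)) * (norm b)\<^sup>2"
    for x :: "'a unitization" and b
  proof -
    have "(norm (unitization_act x b))\<^sup>2 = norm (cstar b * unitization_act (cstar x * x) b)"
      by (simp add: act_mult act_adjoint flip: cstar_identity)
    also have "\<dots> \<le> norm b * (onorm (unitization_act (cstar x * x)) * norm b)"
      using norm_mult_ineq[of "cstar b"] norm_unitization_act_le
      by (intro order_trans[OF norm_mult_ineq] mult_mono) auto
    finally show ?thesis by (simp add: power2_eq_square algebra_simps)
  qed
  have sq: "(onorm (unitization_act x))\<^sup>2 \<le> onorm (unitization_act (cstar x * x))" for x :: "'a unitization"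
  proof -
    have pos: "0 \<le> onorm (unitization_act (cstar x * x))"
      by (rule onorm_pos_le[OF bounded_linear_unitization_act])
    have "onorm (unitization_act x) \<le> sqrt (onorm (unitization_act (cstar x * x)))"
    proof (rule onorm_bound)
      show "norm (unitization_act x b) \<le> sqrt (onorm (unitization_act (cstar x * x))) * norm b" for b
        using real_le_rsqrt[OF act_sq[of x b]] by (simp add: real_sqrt_mult)
    qed (simp add: pos)
    then show ?thesis
      using onorm_pos_le[OF bounded_linear_unitization_act, of x] pos
      by (metis power_mono real_sqrt_pow2)
  qed
  have sc: "cmod (scalar (cstar x * x)) = (cmod (scalar x))\<^sup>2" for x :: "'a unitization"
    by (simp add: unitization_star_ops norm_mult power2_eq_square)
  have ge: "(norm x)\<^sup>2 \<le> norm (cstar x * x)" for x :: "'a unitization"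
    using sq[of x] sc[of x] by (simp add: norm_unitization_def max_def)
  have "norm y \<le> norm (cstar y)" for y :: "'a unitization"
  proof (cases "norm y = 0")
    case False
    moreover have "norm y \<ge> 0" by simp
    moreover have "norm y * norm y \<le> norm (cstar y) * norm y"
      using ge[of y] norm_mult_unitization[of "cstar y" y] by (simp add: power2_eq_square)
    ultimately show ?thesis by simp
  qed simp
  from this[of "cstar x"] have "norm (cstar x) \<le> norm x"
    by (simp add: unitization_star_ops cstar_cstar)
  then have "norm (cstar x) * norm x \<le> norm x * norm x"
    by (intro mult_right_mono) auto
  with ge[of x] norm_mult_unitization[of "cstar x" x] show ?thesis
    by (simp add: power2_eq_square)
qed

lemma complete_unitization:
  fixes X :: "nat \<Rightarrow> 'a unitization"
  assumes "Cauchy X"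
  shows "convergent X"
proof -
  have C: "\<exists>M. \<forall>m\<ge>M. \<forall>n\<ge>M. norm (X m - X n) < e" if "0 < e" for e
    using assms that by (simp add: Cauchy_def dist_norm)
  have sc: "cmod (scalar x) \<le> norm x" for x :: "'a unitization"
    by (simp add: norm_unitization_def)
  have split: "norm x \<le> cmod (scalar x) + norm (element x)"
    and el: "norm (element x) \<le> 2 * norm x" for x :: "'a unitization"
  proof -
    have x: "x = scaleC (scalar x) 1 + Unitization 0 (element x)"
      by (simp add: unitization_star_ops)
    have s1: "norm (scaleC (scalar x) (1 :: 'a unitization)) = cmod (scalar x)"
      by (simp add: norm_scaleC_unitization)
    show "norm x \<le> cmod (scalar x) + norm (element x)"
      using norm_triangle_ineq[of "scaleC (scalar x) 1" "Unitization 0 (element x)"] s1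
      by (subst x) (simp add: norm_element)
    have "Unitization 0 (element x) = x - scaleC (scalar x) 1" 
      by (subst (2) x) simp
    then have "norm (element x) \<le> norm x + cmod (scalar x)"
      using norm_triangle_ineq4[of x "scaleC (scalar x) 1"] s1 by (metis norm_element)
    with sc[of x] show "norm (element x) \<le> 2 * norm x" by simp
  qed
  have "Cauchy (\<lambda>n. scalar (X n))"
  proof (rule CauchyI)
    fix e :: real assume "0 < e"
    from C[OF this] show "\<exists>M. \<forall>m\<ge>M. \<forall>n\<ge>M. cmod (scalar (X m) - scalar (X n)) < e"
      using sc[of "X _ - X _"] by (simp add: minus_unitization_def) (meson le_less_trans)
  qed
  then obtain l where l: "(\<lambda>n. scalar (X n)) \<longlonglongrightarrow> l"
    using Cauchy_convergent convergent_def by blast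
  have "Cauchy (\<lambda>n. element (X n))"
  proof (rule CauchyI)
    fix e :: real assume "0 < e"
    then have "0 < e / 2" by simp
    from C[OF this] obtain M where M: "\<And>m n. m \<ge> M \<Longrightarrow> n \<ge> M \<Longrightarrow> norm (X m - X n) < e / 2" by blast
    have "norm (element (X m) - element (X n)) < e" if "m \<ge> M" "n \<ge> M" for m n
      using el[of "X m - X n"] M[OF that] by (simp add: minus_unitization_def)
    then show "\<exists>M. \<forall>m\<ge>M. \<forall>n\<ge>M. norm (element (X m) - element (X n)) < e" by blast
  qed
  then obtain b where b: "(\<lambda>n. element (X n)) \<longlonglongrightarrow> b"
    using Cauchy_convergent convergent_def by blast
  have "(\<lambda>n. cmod (scalar (X n) - l) + norm (element (X n) - b)) \<longlonglongrightarrow> 0"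
    using tendsto_add[OF tendsto_norm_zero[OF LIM_zero[OF l]] tendsto_norm_zero[OF LIM_zero[OF b]]]
    by simp
  then have "(\<lambda>n. X n - Unitization l b) \<longlonglongrightarrow> 0"
    by (rule Lim_null_comparison[rotated])
      (use split[of "X _ - Unitization l b"] in \<open>simp add: minus_unitization_def\<close>)
  then show ?thesis by (auto simp: convergent_def dest: LIM_zero_cancel)
qed

instance
proof
  fix x y z :: "'a unitization" and a b :: real and c d :: complex
  show "scaleC c (x + y) = scaleC c x + scaleC c y" "scaleC (c + d) x = scaleC c x + scaleC d x"
    "scaleC c (scaleC d x) = scaleC (c * d) x" "scaleC c x * y = scaleC c (x * y)"
    "x * scaleC c y = scaleC c (x * y)" "cstar (x + y) = cstar x + cstar y"
    "cstar (scaleC c x) = scaleC (cnj c) (cstar x)" "cstar (x * y) = cstar y * cstar x"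
    "cstar (cstar x) = x"
    by (simp_all add: unitization_star_ops algebra_simps scaleC_add_right scaleC_add_left scaleC_scaleC
        mult_scaleC_left mult_scaleC_right cstar_simps cstar_scaleC)
  show "scaleC (complex_of_real a) x = a *\<^sub>R x" by (rule scaleC_of_real_unitization)
  show "norm (scaleC c x) = cmod c * norm x" by (rule norm_scaleC_unitization)
  show "norm (cstar x * x) = (norm x)\<^sup>2" by (rule cstar_identity_unitization)
qed (rule complete_unitization)

end

instance unitization :: (cstar_algebra) unital_cstar_algebra ..

lemma unitization_embed:
  "Unitization 0 b + Unitization 0 c = Unitization 0 (b + c)"
  "Unitization 0 b * Unitization 0 c = Unitization 0 (b * c)"
  "cstar (Unitization 0 b) = Unitization 0 (cstar b)"
  by (simp_all add: unitization_star_ops)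

lemma norm_positive_embed:
  fixes b :: "'b::cstar_algebra"
  assumes "cstar_positive b"
  shows "norm_positive (Unitization 0 b)"
proof -
  obtain c where "b = cstar c * c" using assms by (auto simp: cstar_positive_def)
  then show ?thesis using norm_positive_cstar_mult[of "Unitization 0 c"] by (simp add: unitization_embed)
qed

text \<open>
  The square root of \<open>a + b\<close> in the unitization has scalar part \<open>0\<close>, since its square does; so it lies
  in the algebra.
\<close>

lemma cstar_positive_add:
  fixes a b :: "'b::cstar_algebra"
  assumes "cstar_positive a" "cstar_positive b"
  shows "cstar_positive (a + b)"
proof -
  have "norm_positive (Unitization 0 (a + b))"
    using norm_positive_add[OF assms[THEN norm_positive_embed]] by (simp add: unitization_embed)
  then obtain v where v: "cstar v = v" "v * v = Unitization 0 (a + b)" by (metis norm_positive_sqrt)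
  then have "scalar v * scalar v = 0" by (simp add: times_unitization_def)
  then have "scalar v = 0" by simp
  then have e: "Unitization 0 (element v) = v" by (simp add: unitization.expand)
  then have "cstar (element v) * element v = a + b"
    using v by (metis unitization.inject unitization_embed(2) unitization_embed(3))
  then show ?thesis by (metis cstar_positive_def)
qed

lemma cstar_positive_norm_mono:
  fixes a b :: "'b::cstar_algebra"
  assumes "cstar_positive a" "cstar_positive b"
  shows "norm a \<le> norm (a + b)"
  using norm_positive_norm_mono[OF assms[THEN norm_positive_embed]] by (simp add: unitization_embed norm_element)

text \<open>
  This is \<open>b\<^sup>* (1 - h) b = ((1 - k) b)\<^sup>* ((1 - k) b)\<close>, written without a unit: the substitute for \<open>h \<le> 1\<close>.
\<close>

lemma cstar_positive_conjugate:
  fixes b h :: "'b::cstar_algebra"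
  assumes "norm h \<le> 1" "cstar h = h"
  shows "cstar_positive (cstar b * b - cstar b * h * b)"
proof -
  obtain k where k: "2 *\<^sub>R k = h + k * k" "cstar k = k"
    using sqrt_one_minus[OF assms(1)] assms(2) by metis
  have "cstar (b - k * b) * (b - k * b) = cstar b * b - cstar b * (2 *\<^sub>R k - k * k) * b"
    by (simp add: cstar_simps k(2) algebra_simps scaleR_2)
  also have "2 *\<^sub>R k - k * k = h" using k(1) by simp
  finally show ?thesis by (metis cstar_positive_def)
qed

lemma cstar_positive_scaleR:
  fixes a :: "'b::cstar_algebra"
  assumes "cstar_positive a" "0 \<le> r"
  shows "cstar_positive (r *\<^sub>R a)"
proof -
  obtain c where "a = cstar c * c" using assms by (auto simp: cstar_positive_def)
  then have "r *\<^sub>R a = cstar (sqrt r *\<^sub>R c) * (sqrt r *\<^sub>R c)"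
    using assms(2) by (simp add: cstar_simps)
  then show ?thesis by (metis cstar_positive_def)
qed

lemma cstar_positive_square: "cstar_positive (cstar c * c)"
  by (auto simp: cstar_positive_def)

section \<open>Hilbert modules: Cauchy-Schwarz and total sets\<close>

context hilbert_module
begin

lemma ip_zer_right [simp]:
  assumes "x \<in> carr E"
  shows "ip E x (zer E) = 0"
proof -
  have "ip E x (zer E) + 0 = ip E x (zer E) + ip E x (zer E)"
    using ip_vadd[OF assms zer_closed zer_closed] by (simp add: vadd_zer zer_closed)
  then show ?thesis by (simp only: add_left_cancel)
qed

lemma ip_zer_left [simp]:
  assumes "x \<in> carr E"
  shows "ip E (zer E) x = 0"
  by (simp add: ip_cstar[OF assms zer_closed] assms)

lemma ip_vadd_left:
  "\<lbrakk>x \<in> carr E; y \<in> carr E; z \<in> carr E\<rbrakk> \<Longrightarrow> ip E (vadd E x y) z = ip E x z + ip E y z"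
  using ip_cstar[of z "vadd E x y"] ip_cstar[of z x] ip_cstar[of z y]
  by (simp add: ip_vadd vadd_closed cstar_add)

lemma ip_sca_left:
  "\<lbrakk>x \<in> carr E; y \<in> carr E\<rbrakk> \<Longrightarrow> ip E (sca E c x) y = scaleC (cnj c) (ip E x y)"
  using ip_cstar[of y "sca E c x"] ip_cstar[of y x]
  by (simp add: ip_sca sca_closed cstar_scaleC)

lemma ip_ract_left:
  "\<lbrakk>x \<in> carr E; y \<in> carr E\<rbrakk> \<Longrightarrow> ip E (ract E x b) y = cstar b * ip E x y"
  using ip_cstar[of y "ract E x b"] ip_cstar[of y x]
  by (simp add: ip_ract ract_closed cstar_mult)

lemma hminus_closed: "\<lbrakk>x \<in> carr E; y \<in> carr E\<rbrakk> \<Longrightarrow> hminus E x y \<in> carr E"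
  by (simp add: hminus_def vadd_closed sca_closed)

lemma ip_hminus:
  "\<lbrakk>x \<in> carr E; y \<in> carr E; z \<in> carr E\<rbrakk> \<Longrightarrow> ip E x (hminus E y z) = ip E x y - ip E x z"
  by (simp add: hminus_def ip_vadd ip_sca sca_closed)

lemma ip_hminus_left:
  "\<lbrakk>x \<in> carr E; y \<in> carr E; z \<in> carr E\<rbrakk> \<Longrightarrow> ip E (hminus E x y) z = ip E x z - ip E y z"
  by (simp add: hminus_def ip_vadd_left ip_sca_left sca_closed)

lemmas closed = zer_closed vadd_closed sca_closed ract_closed hminus_closed
lemmas ip_simps = ip_vadd ip_vadd_left ip_sca ip_sca_left ip_ract ip_ract_left ip_hminus
  ip_hminus_left

lemma hminus_self: "x \<in> carr E \<Longrightarrow> hminus E x x = zer E"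
  by (intro ip_definite) (simp_all add: closed ip_simps)

lemma hminus_eq_zerD:
  assumes "x \<in> carr E" "y \<in> carr E" "hminus E x y = zer E"
  shows "x = y"
proof -
  note y' = sca_closed[OF assms(2), of "-1"]
  have "vadd E (sca E (-1) y) y = zer E"
    using hminus_self[OF assms(2)] by (simp only: hminus_def vadd_commute[OF y' assms(2)])
  then have "x = vadd E x (vadd E (sca E (-1) y) y)"
    using vadd_zer[OF assms(1)] by simp
  also have "\<dots> = vadd E (hminus E x y) y"
    using vadd_assoc[OF assms(1) y' assms(2)] by (simp only: hminus_def)
  also have "\<dots> = y"
    using vadd_commute[OF zer_closed assms(2)] vadd_zer[OF assms(2)] by (simp only: assms(3))
  finally show ?thesis .
qed

text \<open>
  Identities between vectors of a carrier are proved by pairing both sides with a vector \<open>z\<close>; this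
  moves the computation into the C*-algebra, where the arithmetic of the type is available.
\<close>

lemma vec_eqI:
  assumes "x \<in> carr E" "y \<in> carr E" "\<And>z. z \<in> carr E \<Longrightarrow> ip E z x = ip E z y"
  shows "x = y"
proof (rule hminus_eq_zerD[OF assms(1,2)], rule ip_definite)
  show "ip E (hminus E x y) (hminus E x y) = 0"
    using assms(3)[of "hminus E x y"] by (simp add: closed ip_hminus assms(1,2))
qed (simp add: closed assms)

lemma hnorm_nonneg [simp]: "0 \<le> hnorm E x"
  by (simp add: hnorm_def)

lemma hnorm_square: "(hnorm E x)\<^sup>2 = norm (ip E x x)"
  by (simp add: hnorm_def)

lemma hnorm_eq_0D: "x \<in> carr E \<Longrightarrow> hnorm E x = 0 \<Longrightarrow> x = zer E"
  by (simp add: hnorm_def ip_definite)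

text \<open>
  With \<open>b = \<langle>x, y\<rangle>\<close>, \<open>r = \<parallel>\<langle>x, x\<rangle>\<parallel>\<close> and \<open>h = \<langle>x, x\<rangle> / r\<close>, expanding \<open>\<langle>z, z\<rangle>\<close> for \<open>z = y - x b / r\<close> writes
  \<open>\<langle>y, y\<rangle>\<close> as the sum of \<open>b\<^sup>* b / r\<close> and the positive elements \<open>b\<^sup>* (1 - h) b / r\<close> and \<open>\<langle>z, z\<rangle>\<close>. Comparing
  norms gives the claim.
\<close>

lemma Cauchy_Schwarz:
  assumes x: "x \<in> carr E" and y: "y \<in> carr E"
  shows "norm (ip E x y) \<le> hnorm E x * hnorm E y"
proof (cases "ip E x x = 0")
  case True
  then have "x = zer E" using x by (simp add: ip_definite)
  with y show ?thesis by simp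
next
  case False
  define r where "r = norm (ip E x x)"
  define b where "b = ip E x y"
  define h where "h = (1/r) *\<^sub>R ip E x x"
  define z where "z = hminus E y (sca E (complex_of_real (1/r)) (ract E x b))"
  have r: "r > 0" using False by (simp add: r_def)
  have h: "norm h \<le> 1" "cstar h = h"
    using r ip_cstar[OF x x] by (auto simp: h_def cstar_scaleR) (simp add: r_def)
  have yx: "ip E y x = cstar b" by (simp add: b_def ip_cstar[OF x y])
  have zc: "z \<in> carr E" by (simp add: z_def x y closed)
  have "ip E z z = ip E y y - (1/r) *\<^sub>R (cstar b * b) - (1/r) *\<^sub>R (cstar b * b)
      + (1/r) *\<^sub>R (cstar b * h * b)"
    unfolding z_def using x y
    by (simp add: closed ip_simps yx scaleC_of_real del: of_real_divide)
      (simp add: b_def[symmetric] h_def mult.assoc algebra_simps)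
  then have "ip E y y = (1/r) *\<^sub>R (cstar b * b) +
      ((1/r) *\<^sub>R (cstar b * b - cstar b * h * b) + ip E z z)"
    by (simp add: scaleR_diff_right)
  also have "norm ((1/r) *\<^sub>R (cstar b * b)) \<le> norm \<dots>"
    using r by (intro cstar_positive_norm_mono cstar_positive_add cstar_positive_scaleR
        cstar_positive_square cstar_positive_conjugate h ip_positive zc) auto
  finally have "(norm b)\<^sup>2 \<le> r * norm (ip E y y)"
    using r by (simp add: cstar_identity divide_simps mult.commute)
  then have "(norm b)\<^sup>2 \<le> (hnorm E x * hnorm E y)\<^sup>2"
    by (simp add: power_mult_distrib hnorm_square r_def)
  then show ?thesis unfolding b_def by (rule power2_le_imp_le) simp
qed

lemma hnorm_triangle:
  assumes "x \<in> carr E" "y \<in> carr E"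
  shows "hnorm E (vadd E x y) \<le> hnorm E x + hnorm E y"
proof (rule power2_le_imp_le)
  have "(hnorm E (vadd E x y))\<^sup>2 = norm (ip E x x + ip E x y + (ip E y x + ip E y y))"
    using assms by (simp add: hnorm_square ip_simps closed algebra_simps)
  also have "\<dots> \<le> norm (ip E x x) + norm (ip E x y) + (norm (ip E y x) + norm (ip E y y))"
    by (intro order_trans[OF norm_triangle_ineq] add_mono norm_triangle_ineq)
  also have "\<dots> \<le> (hnorm E x)\<^sup>2 + hnorm E x * hnorm E y + (hnorm E y * hnorm E x + (hnorm E y)\<^sup>2)"
    by (intro add_mono Cauchy_Schwarz assms) (simp_all add: hnorm_square)
  also have "\<dots> = (hnorm E x + hnorm E y)\<^sup>2" by (simp add: power2_eq_square algebra_simps)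
  finally show "(hnorm E (vadd E x y))\<^sup>2 \<le> (hnorm E x + hnorm E y)\<^sup>2" .
qed simp

lemma hnorm_sca: "x \<in> carr E \<Longrightarrow> hnorm E (sca E c x) = cmod c * hnorm E x"
  by (simp add: hnorm_def ip_simps closed scaleC_scaleC norm_scaleC norm_mult real_sqrt_mult)

lemma hnorm_minus_triangle:
  assumes "x \<in> carr E" "y \<in> carr E" "z \<in> carr E"
  shows "hnorm E (hminus E x z) \<le> hnorm E (hminus E x y) + hnorm E (hminus E y z)"
proof -
  have "hminus E x z = vadd E (hminus E x y) (hminus E y z)"
    by (rule vec_eqI) (simp_all add: assms closed ip_simps)
  then show ?thesis using assms by (simp add: hnorm_triangle closed)
qed

lemma hnorm_minus_commute:
  "x \<in> carr E \<Longrightarrow> y \<in> carr E \<Longrightarrow> hnorm E (hminus E x y) = hnorm E (hminus E y x)"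
  by (rule power2_eq_imp_eq) (simp_all add: hnorm_square ip_simps closed algebra_simps)

end

text \<open>
  The inclusion is a separate condition because the closed span does not see which generators lie
  outside the carrier.
\<close>

definition total :: "('x, 'b::cstar_algebra, 'm) hmodule_scheme \<Rightarrow> 'x set \<Rightarrow> bool" where
  "total E G \<longleftrightarrow> G \<subseteq> carr E \<and> closed_span E G = carr E"

abbreviation hspan :: "('x, 'b::cstar_algebra, 'm) hmodule_scheme \<Rightarrow> 'x set \<Rightarrow> 'x set" where
  "hspan E G \<equiv> lin_span (vadd E) (zer E) (sca E) G"

context hilbert_module
begin

lemma hspan_closed: "G \<subseteq> carr E \<Longrightarrow> x \<in> hspan E G \<Longrightarrow> x \<in> carr E"
  by (erule lin_span.induct) (auto simp: closed)

lemma closed_spanI: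
  "x \<in> carr E \<Longrightarrow> (\<And>e. e > 0 \<Longrightarrow> \<exists>y\<in>hspan E G. hnorm E (hminus E x y) < e) \<Longrightarrow> x \<in> closed_span E G"
  by (simp add: closed_span_def)

lemma closed_spanE:
  assumes "x \<in> closed_span E G" "e > 0"
  obtains y where "y \<in> hspan E G" "hnorm E (hminus E x y) < e"
  using assms by (auto simp: closed_span_def)

lemma closed_span_carr: "x \<in> closed_span E G \<Longrightarrow> x \<in> carr E"
  by (simp add: closed_span_def)

lemma hspan_subset_closed_span:
  assumes "G \<subseteq> carr E" "x \<in> hspan E G"
  shows "x \<in> closed_span E G"
proof (rule closed_spanI)
  show x: "x \<in> carr E" by (rule hspan_closed[OF assms])
  show "\<exists>y\<in>hspan E G. hnorm E (hminus E x y) < e" if "e > 0" for e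
    using that assms(2) by (intro bexI[of _ x]) (simp_all add: hminus_self x hnorm_def zer_closed)
qed

lemma closed_span_closure:
  assumes G: "G \<subseteq> carr E" and x: "x \<in> carr E"
    and approx: "\<And>e. e > 0 \<Longrightarrow> \<exists>y\<in>closed_span E G. hnorm E (hminus E x y) < e"
  shows "x \<in> closed_span E G"
proof (rule closed_spanI[OF x])
  fix e :: real assume "e > 0"
  then have e2: "e / 2 > 0" by simp
  obtain y where y: "y \<in> closed_span E G" "hnorm E (hminus E x y) < e / 2"
    using approx[OF e2] by blast
  obtain z where z: "z \<in> hspan E G" "hnorm E (hminus E y z) < e / 2"
    using closed_spanE[OF y(1) e2] by blast
  have "hnorm E (hminus E x z) < e"
    using hnorm_minus_triangle[OF x closed_span_carr[OF y(1)] hspan_closed[OF G z(1)]] y z by simp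
  with z show "\<exists>z\<in>hspan E G. hnorm E (hminus E x z) < e" by blast
qed

lemma closed_span_vadd:
  assumes G: "G \<subseteq> carr E" and "x \<in> closed_span E G" "y \<in> closed_span E G"
  shows "vadd E x y \<in> closed_span E G"
proof (rule closed_spanI)
  note xy = closed_span_carr[OF assms(2)] closed_span_carr[OF assms(3)]
  then show "vadd E x y \<in> carr E" by (simp add: closed)
  fix e :: real assume "e > 0"
  then have e2: "e / 2 > 0" by simp
  obtain x' where x': "x' \<in> hspan E G" "hnorm E (hminus E x x') < e / 2"
    using closed_spanE[OF assms(2) e2] by blast
  obtain y' where y': "y' \<in> hspan E G" "hnorm E (hminus E y y') < e / 2"
    using closed_spanE[OF assms(3) e2] by blast
  note c = xy hspan_closed[OF G x'(1)] hspan_closed[OF G y'(1)]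
  have "hminus E (vadd E x y) (vadd E x' y') = vadd E (hminus E x x') (hminus E y y')"
    by (rule vec_eqI) (simp_all add: c closed ip_simps)
  then have "hnorm E (hminus E (vadd E x y) (vadd E x' y')) < e"
    using hnorm_triangle[of "hminus E x x'" "hminus E y y'"] c x' y' by (simp add: closed)
  then show "\<exists>z\<in>hspan E G. hnorm E (hminus E (vadd E x y) z) < e"
    using x' y' lin_span_plus by metis
qed

lemma closed_span_sca:
  assumes G: "G \<subseteq> carr E" and "x \<in> closed_span E G"
  shows "sca E c x \<in> closed_span E G"
proof (rule closed_spanI)
  note x = closed_span_carr[OF assms(2)]
  then show "sca E c x \<in> carr E" by (simp add: closed)
  fix e :: real assume e: "e > 0"
  have "e / (cmod c + 1) > 0" using e by (simp add: add_nonneg_pos)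
  then obtain y where y: "y \<in> hspan E G" "hnorm E (hminus E x y) < e / (cmod c + 1)"
    using closed_spanE[OF assms(2)] by blast
  note c = x hspan_closed[OF G y(1)]
  have "hminus E (sca E c x) (sca E c y) = sca E c (hminus E x y)"
    by (rule vec_eqI) (simp_all add: c closed ip_simps scaleC_diff_right)
  then have "hnorm E (hminus E (sca E c x) (sca E c y)) \<le> (cmod c + 1) * hnorm E (hminus E x y)"
    using c by (simp add: hnorm_sca closed mult_right_mono)
  also have "\<dots> < e" using y by (simp add: pos_less_divide_eq add_nonneg_pos mult.commute)
  finally show "\<exists>z\<in>hspan E G. hnorm E (hminus E (sca E c x) z) < e"
    using y lin_span_scale by metis
qed

lemma total_trans:
  assumes "total E G" "G \<subseteq> closed_span E H" "H \<subseteq> carr E"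
  shows "total E H"
proof -
  have span: "y \<in> closed_span E H" if "y \<in> hspan E G" for y
    using that
  proof induction
    case lin_span_zero
    show ?case by (intro hspan_subset_closed_span assms lin_span.lin_span_zero)
  qed (use assms in \<open>auto intro: closed_span_vadd closed_span_sca\<close>)
  have "x \<in> closed_span E H" if x: "x \<in> carr E" for x
  proof (rule closed_span_closure[OF assms(3) x])
    fix e :: real assume "e > 0"
    moreover have "x \<in> closed_span E G" using assms(1) x by (simp add: total_def)
    ultimately obtain y where "y \<in> hspan E G" "hnorm E (hminus E x y) < e" by (metis closed_spanE)
    with span show "\<exists>y\<in>closed_span E H. hnorm E (hminus E x y) < e" by blast
  qed
  with assms(3) closed_span_carr show ?thesis by (auto simp: total_def)
qed

text \<open>
  The difference \<open>d\<close> is orthogonal to the span of the total set, and \<open>\<langle>d, d\<rangle> = \<langle>d - z, d\<rangle>\<close> for every \<open>z\<close> in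
  that span. This is the form in which density is used almost everywhere below.
\<close>

lemma total_eqI:
  assumes G: "total E G" and x: "x \<in> carr E" and y: "y \<in> carr E"
    and eq: "\<And>g. g \<in> G \<Longrightarrow> ip E g x = ip E g y"
  shows "x = y"
proof -
  define d where "d = hminus E x y"
  have d: "d \<in> carr E" by (simp add: d_def x y closed)
  have Gc: "G \<subseteq> carr E" using G by (simp add: total_def)
  have ortho: "z \<in> carr E \<and> ip E z d = 0" if "z \<in> hspan E G" for z
    using that by induction (use Gc in \<open>auto simp: closed ip_simps d d_def x y eq\<close>)
  have "hnorm E d \<le> e" if e: "e > 0" for e
  proof (cases "hnorm E d = 0")
    case False
    have "d \<in> closed_span E G" using G d by (simp add: total_def)
    then obtain z where z: "z \<in> hspan E G" "hnorm E (hminus E d z) < e"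
      using e by (metis closed_spanE)
    have "hnorm E d * hnorm E d = norm (ip E (hminus E d z) d)"
      using ortho[OF z(1)] d by (simp add: ip_simps power2_eq_square flip: hnorm_square)
    also have "\<dots> \<le> hnorm E (hminus E d z) * hnorm E d"
      using ortho[OF z(1)] d by (intro Cauchy_Schwarz) (simp_all add: closed)
    also have "\<dots> \<le> e * hnorm E d" using z by (intro mult_right_mono) auto
    finally show ?thesis using False by (simp add: mult_le_cancel_right less_le)
  qed (use e in simp)
  then have "hnorm E d \<le> 0" by (meson field_le_epsilon add_increasing order_refl dense_ge)
  then have "hnorm E d = 0" by (simp add: antisym)
  from hnorm_eq_0D[OF d this] show ?thesis
    unfolding d_def by (rule hminus_eq_zerD[OF x y])
qed

lemma approximating_sequence:
  assumes "total E G" "x \<in> carr E"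
  obtains y where "\<And>n. y n \<in> hspan E G" "\<And>n. hnorm E (hminus E x (y n)) < inverse (real (Suc n))"
proof -
  have "x \<in> closed_span E G" using assms by (simp add: total_def)
  then have "\<exists>y. y \<in> hspan E G \<and> hnorm E (hminus E x y) < inverse (real (Suc n))" for n
    by (metis closed_spanE inverse_positive_iff_positive of_nat_0_less_iff zero_less_Suc)
  then show thesis using that by metis
qed

end

text \<open>
  The relation \<open>Q\<close>, being given by equations between inner products, is a closed subspace of \<open>E \<oplus> F\<close>.
  If it is moreover bounded, then its domain is a closed subspace of \<open>E\<close>, by completeness of \<open>F\<close>; so it is all of
  \<open>E\<close> once it contains a total set. Adjoints as well as isometric extensions arise in this way, for
  suitable sets \<open>D\<close>.
\<close>

lemma relation_extends_from_total:
  fixes E :: "('x, 'b::cstar_algebra, 'm) hmodule_scheme"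
    and F :: "('y, 'b, 'n) hmodule_scheme"
  assumes "hilbert_module E" "hilbert_module F" and G: "total E G"
    and D: "D \<subseteq> carr E \<times> carr F"
    and Q: "\<And>z z'. Q z z' \<longleftrightarrow> (\<forall>(y, y')\<in>D. ip E y z = ip F y' z')"
    and ex: "\<And>g. g \<in> G \<Longrightarrow> \<exists>g'\<in>carr F. Q g g'"
    and bounded: "\<And>z z'. \<lbrakk>z \<in> carr E; z' \<in> carr F; Q z z'\<rbrakk> \<Longrightarrow> hnorm F z' \<le> C * hnorm E z"
    and z: "z \<in> carr E"
  shows "\<exists>z'\<in>carr F. Q z z'"
proof -
  interpret E: hilbert_module E by fact
  interpret F: hilbert_module F by fact
  have Gc: "G \<subseteq> carr E" using G by (simp add: total_def)
  have Dc: "y \<in> carr E" "y' \<in> carr F" if "(y, y') \<in> D" for y y'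
    using that D by auto
  have span: "\<exists>y'\<in>carr F. Q y y'" if "y \<in> hspan E G" for y
    using that
  proof induction
    case lin_span_zero
    show ?case using Dc by (intro bexI[of _ "zer F"]) (auto simp: Q F.closed)
  next
    case (lin_span_base g)
    then show ?case by (rule ex)
  next
    case (lin_span_plus x y)
    then obtain x' y' where c: "x' \<in> carr F" "Q x x'" "y' \<in> carr F" "Q y y'" by blast
    have "x \<in> carr E" "y \<in> carr E" using lin_span_plus E.hspan_closed[OF Gc] by auto
    with c Dc show ?case
      by (intro bexI[of _ "vadd F x' y'"]) (fastforce simp: Q F.ip_vadd E.ip_vadd F.closed)+
  next
    case (lin_span_scale x c)
    then obtain x' where c: "x' \<in> carr F" "Q x x'" by blast
    have "x \<in> carr E" using lin_span_scale E.hspan_closed[OF Gc] by auto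
    with c Dc show ?case
      by (intro bexI[of _ "sca F c x'"]) (fastforce simp: Q F.ip_sca E.ip_sca F.closed)+
  qed
  obtain y where y: "\<And>n. y n \<in> hspan E G"
      "\<And>n. hnorm E (hminus E z (y n)) < inverse (real (Suc n))"
    using E.approximating_sequence[OF G z] by blast
  have yc: "y n \<in> carr E" for n by (rule E.hspan_closed[OF Gc y(1)])
  from span[OF y(1)] obtain y' where y': "\<And>n. y' n \<in> carr F" "\<And>n. Q (y n) (y' n)" by metis
  have diff: "hnorm F (hminus F (y' m) (y' n)) \<le> \<bar>C\<bar> * (inverse (real (Suc m)) + inverse (real (Suc n)))"
    for m n
  proof -
    have "Q (hminus E (y m) (y n)) (hminus F (y' m) (y' n))"
      using y'(2)[of m] y'(2)[of n] y'(1) yc Dc by (fastforce simp: Q E.ip_hminus F.ip_hminus)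
    then have "hnorm F (hminus F (y' m) (y' n)) \<le> C * hnorm E (hminus E (y m) (y n))"
      by (intro bounded E.closed F.closed yc y')
    also have "\<dots> \<le> \<bar>C\<bar> * hnorm E (hminus E (y m) (y n))"
      by (intro mult_right_mono) auto
    also have "hnorm E (hminus E (y m) (y n)) \<le> hnorm E (hminus E z (y m)) + hnorm E (hminus E z (y n))"
      using E.hnorm_minus_triangle[OF yc z yc, of m n] E.hnorm_minus_commute[OF yc z, of m] by simp
    also have "\<dots> \<le> inverse (real (Suc m)) + inverse (real (Suc n))"
      using y(2)[of m] y(2)[of n] by simp
    finally show ?thesis by (simp add: mult_left_mono)
  qed
  have "\<forall>e>0. \<exists>N. \<forall>m\<ge>N. \<forall>n\<ge>N. hnorm F (hminus F (y' m) (y' n)) < e"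
  proof (intro allI impI)
    fix e :: real assume "e > 0"
    then have "e / (2 * (\<bar>C\<bar> + 1)) > 0" by simp
    then obtain N where N: "inverse (real (Suc N)) < e / (2 * (\<bar>C\<bar> + 1))"
      using reals_Archimedean by blast
    have "hnorm F (hminus F (y' m) (y' n)) < e" if "m \<ge> N" "n \<ge> N" for m n
    proof -
      have "inverse (real (Suc m)) \<le> inverse (real (Suc N))" "inverse (real (Suc n)) \<le> inverse (real (Suc N))"
        using that by (auto intro!: le_imp_inverse_le)
      then have "inverse (real (Suc m)) + inverse (real (Suc n)) \<le> 2 * inverse (real (Suc N))"
        by linarith
      then have "\<bar>C\<bar> * (inverse (real (Suc m)) + inverse (real (Suc n)))
          \<le> (\<bar>C\<bar> + 1) * (2 * inverse (real (Suc N)))"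
        by (rule mult_mono[rotated]) auto
      also have "\<dots> < e" using N by (simp add: pos_less_divide_eq algebra_simps)
      finally show ?thesis using diff[of m n] by simp
    qed
    then show "\<exists>N. \<forall>m\<ge>N. \<forall>n\<ge>N. hnorm F (hminus F (y' m) (y' n)) < e" by blast
  qed
  then obtain l where l: "l \<in> carr F" "(\<lambda>n. hnorm F (hminus F (y' n) l)) \<longlonglongrightarrow> 0"
    using F.complete[of y'] y'(1) by blast
  have "norm (hnorm E (hminus E z (y n))) \<le> inverse (real (Suc n))" for n
    using y(2)[of n] by simp
  then have y0: "(\<lambda>n. hnorm E (hminus E z (y n))) \<longlonglongrightarrow> 0"
    by (intro Lim_null_comparison[OF always_eventually LIMSEQ_inverse_real_of_nat] allI)
  have "ip E x z = ip F x' l" if xx': "(x, x') \<in> D" for x x'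
  proof -
    note c = Dc[OF xx']
    have le: "norm (ip E x z - ip F x' l) \<le>
        hnorm E x * hnorm E (hminus E z (y n)) + hnorm F x' * hnorm F (hminus F (y' n) l)" for n
    proof -
      have "ip E x (y n) = ip F x' (y' n)" using y'(2)[of n] xx' by (auto simp: Q)
      then have "ip E x z - ip F x' l = ip E x (hminus E z (y n)) + ip F x' (hminus F (y' n) l)"
        by (simp add: E.ip_hminus F.ip_hminus c z yc y' l)
      also have "norm \<dots> \<le> norm (ip E x (hminus E z (y n))) + norm (ip F x' (hminus F (y' n) l))"
        by (rule norm_triangle_ineq)
      also have "\<dots> \<le> hnorm E x * hnorm E (hminus E z (y n)) + hnorm F x' * hnorm F (hminus F (y' n) l)"
        by (intro add_mono E.Cauchy_Schwarz F.Cauchy_Schwarz c E.hminus_closed F.hminus_closed z yc y' l)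
      finally show ?thesis .
    qed
    have lim: "(\<lambda>n. hnorm E x * hnorm E (hminus E z (y n)) + hnorm F x' * hnorm F (hminus F (y' n) l))
        \<longlonglongrightarrow> 0"
      using tendsto_add[OF tendsto_mult_right_zero[OF y0, of "hnorm E x"]
          tendsto_mult_right_zero[OF l(2), of "hnorm F x'"]] by simp
    have "norm (ip E x z - ip F x' l) \<le> 0"
      by (rule LIMSEQ_le_const[OF lim]) (intro exI allI impI le)
    then show ?thesis by simp
  qed
  with l(1) show ?thesis by (auto simp: Q)
qed

text \<open>
  The pairs \<open>(a x, x)\<close> serve as \<open>D\<close>: being related to \<open>f\<close> then means that \<open>f\<close> is the value of the adjoint.
  The adjoint, where it exists, is bounded by the bound of \<open>a\<close>.
\<close>

lemma adjoint_from_total: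
  fixes E :: "('x, 'b::cstar_algebra, 'm) hmodule_scheme"
    and F :: "('y, 'b, 'n) hmodule_scheme"
  assumes E: "hilbert_module E" and F: "hilbert_module F" and G: "total F G"
    and a: "\<And>x. x \<in> carr E \<Longrightarrow> a x \<in> carr F"
    and "0 \<le> C" and bounded: "\<And>x. x \<in> carr E \<Longrightarrow> hnorm F (a x) \<le> C * hnorm E x"
    and ex: "\<And>g. g \<in> G \<Longrightarrow> \<exists>f\<in>carr E. \<forall>x\<in>carr E. ip F (a x) g = ip E x f"
    and y: "y \<in> carr F"
  shows "\<exists>f\<in>carr E. \<forall>x\<in>carr E. ip F (a x) y = ip E x f"
proof -
  interpret E: hilbert_module E by fact
  interpret F: hilbert_module F by fact
  show ?thesis
  proof (rule relation_extends_from_total[OF F E G, where D = "(\<lambda>x. (a x, x)) ` carr E" and C = C])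
    fix z z' assume z: "z \<in> carr F" "z' \<in> carr E" and adj: "\<forall>x\<in>carr E. ip F (a x) z = ip E x z'"
    show "hnorm E z' \<le> C * hnorm F z"
    proof (cases "hnorm E z' = 0")
      case False
      have "hnorm E z' * hnorm E z' = norm (ip F (a z') z)"
        using adj z by (simp add: power2_eq_square flip: E.hnorm_square)
      also have "\<dots> \<le> hnorm F (a z') * hnorm F z" by (intro F.Cauchy_Schwarz a z)
      also have "\<dots> \<le> C * hnorm E z' * hnorm F z" using bounded[OF z(2)] by (intro mult_right_mono) auto
      finally have "hnorm E z' * hnorm E z' \<le> hnorm E z' * (C * hnorm F z)" by (simp add: mult_ac)
      with False show ?thesis by (simp add: mult_le_cancel_left less_le)
    qed (use \<open>0 \<le> C\<close> in simp)
  qed (use a ex y in auto)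
qed

section \<open>Adjointable operators and unitaries\<close>

lemma adjoint_unique:
  assumes "hilbert_module E" "hilbert_module F"
    and b: "is_adjoint E F a b" and b': "is_adjoint E F a b'"
  shows "b = b'"
proof
  interpret E: hilbert_module E by fact
  fix y
  show "b y = b' y"
  proof (cases "y \<in> carr F")
    case True
    show ?thesis
    proof (rule E.vec_eqI)
      show "b y \<in> carr E" "b' y \<in> carr E" using b b' True by (auto simp: is_adjoint_def)
      show "ip E x (b y) = ip E x (b' y)" if "x \<in> carr E" for x
        using b b' True that by (metis is_adjoint_def)
    qed
  next
    case False
    with b b' show ?thesis by (auto simp: is_adjoint_def PiE_iff extensional_def)
  qed
qed

lemma adj_eqI:
  assumes "hilbert_module E" "hilbert_module F" "is_adjoint E F a b"
  shows "adj E F a = b"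
  unfolding adj_def using assms adjoint_unique[OF assms(1,2)] by blast

lemma BaI:
  "\<lbrakk>a \<in> carr E \<rightarrow>\<^sub>E carr F; b \<in> carr F \<rightarrow>\<^sub>E carr E;
    \<And>x y. \<lbrakk>x \<in> carr E; y \<in> carr F\<rbrakk> \<Longrightarrow> ip F (a x) y = ip E x (b y)\<rbrakk> \<Longrightarrow> a \<in> Ba E F"
  by (auto simp: Ba_def is_adjoint_def)

text \<open>
  Pairing with the total set shows that the adjoints agree everywhere; hence so do the operators.
\<close>

lemma Ba_eq_on_total:
  assumes "hilbert_module E" "hilbert_module F" "total E G"
    and a: "a \<in> Ba E F" and b: "b \<in> Ba E F" and eq: "\<And>g. g \<in> G \<Longrightarrow> a g = b g"
  shows "a = b"
proof
  interpret E: hilbert_module E by fact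
  interpret F: hilbert_module F by fact
  obtain a' where a': "is_adjoint E F a a'" using a by (auto simp: Ba_def)
  obtain b' where b': "is_adjoint E F b b'" using b by (auto simp: Ba_def)
  have ab: "a' y = b' y" if "y \<in> carr F" for y
  proof (rule E.total_eqI[OF assms(3)])
    show "a' y \<in> carr E" "b' y \<in> carr E" using a' b' that by (auto simp: is_adjoint_def)
    show "ip E g (a' y) = ip E g (b' y)" if "g \<in> G" for g
    proof -
      have "g \<in> carr E" using assms(3) that by (auto simp: total_def)
      with a' b' eq[OF that] \<open>y \<in> carr F\<close> show ?thesis by (metis is_adjoint_def)
    qed
  qed
  fix x
  show "a x = b x"
  proof (cases "x \<in> carr E")
    case True
    have "ip F (a x) y = ip F (b x) y" if "y \<in> carr F" for y
      using a' b' ab[OF that] True that by (simp add: is_adjoint_def)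
    moreover have c: "a x \<in> carr F" "b x \<in> carr F" using a b True by (auto simp: Ba_def)
    ultimately show ?thesis
      using F.ip_cstar[OF c(1)] F.ip_cstar[OF c(2)] by (intro F.vec_eqI) simp_all
  next
    case False
    with a b show ?thesis by (auto simp: Ba_def PiE_iff extensional_def)
  qed
qed

locale adjointable = E: hilbert_module E + F: hilbert_module F
  for E :: "('x, 'b::cstar_algebra, 'm) hmodule_scheme"
    and F :: "('y, 'b, 'n) hmodule_scheme" +
  fixes a :: "'x \<Rightarrow> 'y"
  assumes Ba: "a \<in> Ba E F"
begin

lemma is_adjoint_adj: "is_adjoint E F a (adj E F a)"
proof -
  obtain b where b: "is_adjoint E F a b" using Ba by (auto simp: Ba_def)
  with adj_eqI[OF E.hilbert_module_axioms F.hilbert_module_axioms b] show ?thesis by simp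
qed

lemma apply_closed [simp]: "x \<in> carr E \<Longrightarrow> a x \<in> carr F"
  using Ba by (auto simp: Ba_def)

lemma adj_closed [simp]: "y \<in> carr F \<Longrightarrow> adj E F a y \<in> carr E"
  using is_adjoint_adj by (auto simp: is_adjoint_def)

lemma ip_apply: "\<lbrakk>x \<in> carr E; y \<in> carr F\<rbrakk> \<Longrightarrow> ip F (a x) y = ip E x (adj E F a y)"
  using is_adjoint_adj by (auto simp: is_adjoint_def)

lemma ip_apply_right: "\<lbrakk>x \<in> carr E; y \<in> carr F\<rbrakk> \<Longrightarrow> ip F y (a x) = ip E (adj E F a y) x"
  by (subst F.ip_cstar, simp, simp, subst E.ip_cstar[of x], simp, simp, simp add: ip_apply)

lemma apply_vadd: "\<lbrakk>x \<in> carr E; y \<in> carr E\<rbrakk> \<Longrightarrow> a (vadd E x y) = vadd F (a x) (a y)"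
  by (rule F.vec_eqI) (simp_all add: E.closed F.closed F.ip_vadd E.ip_vadd ip_apply_right)

lemma apply_sca: "x \<in> carr E \<Longrightarrow> a (sca E c x) = sca F c (a x)"
  by (rule F.vec_eqI) (simp_all add: E.closed F.closed F.ip_sca E.ip_sca ip_apply_right)

lemma apply_ract: "x \<in> carr E \<Longrightarrow> a (ract E x b) = ract F (a x) b"
  by (rule F.vec_eqI) (simp_all add: E.closed F.closed F.ip_ract E.ip_ract ip_apply_right)

lemma apply_hminus: "\<lbrakk>x \<in> carr E; y \<in> carr E\<rbrakk> \<Longrightarrow> a (hminus E x y) = hminus F (a x) (a y)"
  by (simp add: hminus_def apply_vadd apply_sca E.closed)

lemma apply_zer: "a (zer E) = zer F"
  by (rule F.vec_eqI) (simp_all add: E.closed F.closed ip_apply_right)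

end

locale unitary_operator = E: hilbert_module E + F: hilbert_module F
  for E :: "('x, 'b::cstar_algebra, 'm) hmodule_scheme"
    and F :: "('y, 'b, 'n) hmodule_scheme" +
  fixes u :: "'x \<Rightarrow> 'y"
  assumes unitary: "unitary E F u"
begin

sublocale adjointable E F u
  using unitary by unfold_locales (simp add: unitary_def)

lemma adj_apply [simp]: "x \<in> carr E \<Longrightarrow> adj E F u (u x) = x"
  using unitary by (auto simp: unitary_def compose_def op_id_def fun_eq_iff split: if_splits)

lemma apply_adj [simp]: "y \<in> carr F \<Longrightarrow> u (adj E F u y) = y"
  using unitary by (auto simp: unitary_def compose_def op_id_def fun_eq_iff split: if_splits)

lemma ip_preserved: "\<lbrakk>x \<in> carr E; y \<in> carr E\<rbrakk> \<Longrightarrow> ip F (u x) (u y) = ip E x y"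
  by (simp add: ip_apply)

lemma hnorm_preserved: "x \<in> carr E \<Longrightarrow> hnorm F (u x) = hnorm E x"
  by (simp add: hnorm_def ip_preserved)

lemma total_image:
  assumes "total E G"
  shows "total F (u ` G)"
proof -
  have Gc: "G \<subseteq> carr E" using assms by (simp add: total_def)
  have span: "u x \<in> hspan F (u ` G)" if "x \<in> hspan E G" for x
    using that
  proof induction
    case (lin_span_plus x y)
    then show ?case using E.hspan_closed[OF Gc] by (simp add: apply_vadd lin_span.lin_span_plus)
  next
    case (lin_span_scale x c)
    then show ?case using E.hspan_closed[OF Gc] by (simp add: apply_sca lin_span.lin_span_scale)
  qed (auto simp: apply_zer intro: lin_span.intros)
  have "y \<in> closed_span F (u ` G)" if y: "y \<in> carr F" for y
  proof (rule F.closed_spanI[OF y])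
    fix e :: real assume "e > 0"
    moreover have "adj E F u y \<in> closed_span E G" using assms y by (simp add: total_def)
    ultimately obtain x where x: "x \<in> hspan E G" "hnorm E (hminus E (adj E F u y) x) < e"
      by (metis E.closed_spanE)
    have "hminus F y (u x) = u (hminus E (adj E F u y) x)"
      using y E.hspan_closed[OF Gc x(1)] by (simp add: apply_hminus)
    then have "hnorm F (hminus F y (u x)) < e"
      using x y E.hspan_closed[OF Gc x(1)] by (simp add: hnorm_preserved E.closed)
    with span[OF x(1)] show "\<exists>z\<in>hspan F (u ` G). hnorm F (hminus F y z) < e" by blast
  qed
  with Gc show ?thesis using F.closed_span_carr by (fastforce simp: total_def)
qed

end

lemma unitaryI:
  assumes "hilbert_module E" "hilbert_module F"
    and u: "u \<in> carr E \<rightarrow>\<^sub>E carr F" and v: "v \<in> carr F \<rightarrow>\<^sub>E carr E"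
    and adj: "\<And>x y. \<lbrakk>x \<in> carr E; y \<in> carr F\<rbrakk> \<Longrightarrow> ip F (u x) y = ip E x (v y)"
    and inv: "\<And>x. x \<in> carr E \<Longrightarrow> v (u x) = x" "\<And>y. y \<in> carr F \<Longrightarrow> u (v y) = y"
  shows "unitary E F u"
proof -
  have "is_adjoint E F u v" using v adj by (simp add: is_adjoint_def)
  with assms(1,2) have "adj E F u = v" by (rule adj_eqI)
  with BaI[OF u v adj] inv show ?thesis
    by (simp add: unitary_def compose_def op_id_def cong: restrict_cong)
qed

lemma unitary_op_id:
  assumes "hilbert_module E"
  shows "unitary E E (op_id E)"
  by (rule unitaryI[OF assms assms, where v = "op_id E"]) (auto simp: op_id_def)

text \<open>
  Here \<open>D\<close> consists of all pairs \<open>(y, y')\<close> with the same coefficients with respect to the two families. It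
  contains the pairs \<open>(g i, g' i)\<close>; therefore a pair \<open>(z, z')\<close> that is compatible with \<open>D\<close> belongs to \<open>D\<close> itself, whence \<open>z\<close> and \<open>z'\<close>
  have equal norms, and the bound required for the extension comes for free.
\<close>

lemma gram_partner:
  fixes E :: "('x, 'b::cstar_algebra, 'm) hmodule_scheme"
    and F :: "('y, 'b, 'n) hmodule_scheme"
  assumes E: "hilbert_module E" and F: "hilbert_module F"
    and g: "total E (g ` I)" and g': "g' ` I \<subseteq> carr F"
    and gram: "\<And>i j. \<lbrakk>i \<in> I; j \<in> I\<rbrakk> \<Longrightarrow> ip E (g i) (g j) = ip F (g' i) (g' j)"
    and z: "z \<in> carr E"
  shows "\<exists>z'\<in>carr F. \<forall>y\<in>carr E. \<forall>y'\<in>carr F.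
    (\<forall>i\<in>I. ip E (g i) y = ip F (g' i) y') \<longrightarrow> ip E y z = ip F y' z'"
proof -
  interpret E: hilbert_module E by fact
  interpret F: hilbert_module F by fact
  have gc: "g i \<in> carr E" "g' i \<in> carr F" if "i \<in> I" for i
    using g g' that by (auto simp: total_def)
  define D where "D = {(y, y'). y \<in> carr E \<and> y' \<in> carr F \<and> (\<forall>i\<in>I. ip E (g i) y = ip F (g' i) y')}"
  have Dg: "(g i, g' i) \<in> D" if "i \<in> I" for i
    using that by (simp add: D_def gc gram)
  have "\<exists>z'\<in>carr F. \<forall>(y, y')\<in>D. ip E y z = ip F y' z'"
  proof (rule relation_extends_from_total[OF E F g, where D = D and C = 1])
    fix h assume "h \<in> g ` I"
    then obtain i where i: "i \<in> I" "h = g i" by blast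
    have "ip E y h = ip F y' (g' i)" if "(y, y') \<in> D" for y y'
    proof -
      have c: "y \<in> carr E" "y' \<in> carr F" "ip E (g i) y = ip F (g' i) y'"
        using that i by (auto simp: D_def)
      show ?thesis
        using E.ip_cstar[OF gc(1)[OF i(1)] c(1)] F.ip_cstar[OF gc(2)[OF i(1)] c(2)] c(3) i(2) by simp
    qed
    then show "\<exists>z'\<in>carr F. \<forall>(y, y')\<in>D. ip E y h = ip F y' z'"
      using gc[OF i(1)] by blast
  next
    fix z z' assume z: "z \<in> carr E" "z' \<in> carr F" and Q: "\<forall>(y, y')\<in>D. ip E y z = ip F y' z'"
    have "ip E (g i) z = ip F (g' i) z'" if "i \<in> I" for i
      using Q Dg[OF that] by blast
    with z have "(z, z') \<in> D" by (simp add: D_def)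
    with Q have "ip E z z = ip F z' z'" by blast
    then show "hnorm F z' \<le> 1 * hnorm E z" by (simp add: hnorm_def)
  next
    show "D \<subseteq> carr E \<times> carr F" by (auto simp: D_def)
  qed (rule refl, rule z)
  then show ?thesis unfolding D_def by blast
qed

text \<open>
  The previous lemma is applied in both directions; the two maps are inverse to each other since
  an element is determined by its coefficients with respect to a total family.
\<close>

lemma unitary_from_gram:
  fixes E :: "('x, 'b::cstar_algebra, 'm) hmodule_scheme"
    and F :: "('y, 'b, 'n) hmodule_scheme"
  assumes E: "hilbert_module E" and F: "hilbert_module F"
    and g: "total E (g ` I)" and g': "total F (g' ` I)"
    and gram: "\<And>i j. \<lbrakk>i \<in> I; j \<in> I\<rbrakk> \<Longrightarrow> ip E (g i) (g j) = ip F (g' i) (g' j)"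
  obtains u where "unitary E F u" "\<And>i. i \<in> I \<Longrightarrow> u (g i) = g' i"
proof -
  interpret E: hilbert_module E by fact
  interpret F: hilbert_module F by fact
  have gc: "g i \<in> carr E" "g' i \<in> carr F" if "i \<in> I" for i
    using g g' that by (auto simp: total_def)
  have sub: "g ` I \<subseteq> carr E" "g' ` I \<subseteq> carr F" using gc by auto
  define R where "R y y' \<longleftrightarrow> (\<forall>i\<in>I. ip E (g i) y = ip F (g' i) y')" for y y'
  have Rg: "R (g i) (g' i)" if "i \<in> I" for i
    using that gram by (simp add: R_def)
  have "\<forall>z. \<exists>z'. z \<in> carr E \<longrightarrow> z' \<in> carr F \<and>
      (\<forall>y\<in>carr E. \<forall>y'\<in>carr F. R y y' \<longrightarrow> ip E y z = ip F y' z')"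
    using gram_partner[OF E F g sub(2) gram] unfolding R_def by blast
  then obtain U where U: "\<And>z. z \<in> carr E \<Longrightarrow> U z \<in> carr F"
      "\<And>y y' z. \<lbrakk>z \<in> carr E; y \<in> carr E; y' \<in> carr F; R y y'\<rbrakk> \<Longrightarrow> ip E y z = ip F y' (U z)"
    by metis
  have "\<forall>z. \<exists>z'. z \<in> carr F \<longrightarrow> z' \<in> carr E \<and>
      (\<forall>y\<in>carr F. \<forall>y'\<in>carr E. R y' y \<longrightarrow> ip F y z = ip E y' z')"
    using gram_partner[OF F E g' sub(1) gram[symmetric]] unfolding R_def by metis
  then obtain V where V: "\<And>z. z \<in> carr F \<Longrightarrow> V z \<in> carr E"
      "\<And>y y' z. \<lbrakk>z \<in> carr F; y \<in> carr F; y' \<in> carr E; R y' y\<rbrakk> \<Longrightarrow> ip F y z = ip E y' (V z)"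
    by metis
  have RU: "R z (U z)" if "z \<in> carr E" for z
    unfolding R_def using U(2)[OF that gc Rg] by blast
  have RV: "R (V z) z" if "z \<in> carr F" for z
    unfolding R_def using V(2)[OF that gc(2,1) Rg] by metis
  have VU: "V (U z) = z" if z: "z \<in> carr E" for z
    by (rule E.total_eqI[OF g V(1)[OF U(1)[OF z]] z])
      (use RU[OF z] RV[OF U(1)[OF z]] in \<open>auto simp: R_def\<close>)
  have UV: "U (V z) = z" if z: "z \<in> carr F" for z
  proof (rule F.total_eqI[OF g' U(1)[OF V(1)[OF z]] z])
    fix h assume "h \<in> g' ` I"
    then obtain i where "i \<in> I" "h = g' i" by blast
    with RV[OF z] RU[OF V(1)[OF z]] show "ip F h (U (V z)) = ip F h z" by (metis R_def)
  qed
  have adj: "ip F (U x) y = ip E x (V y)" if "x \<in> carr E" "y \<in> carr F" for x y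
    using U(2)[OF V(1)[OF that(2)] that(1) U(1)[OF that(1)] RU[OF that(1)]] by (simp add: UV that)
  have Ug: "U (g i) = g' i" if "i \<in> I" for i
  proof (rule F.total_eqI[OF g' U(1)[OF gc(1)[OF that]] gc(2)[OF that]])
    fix h assume "h \<in> g' ` I"
    then obtain j where "j \<in> I" "h = g' j" by blast
    with RU[OF gc(1)[OF that]] Rg[OF that] show "ip F h (U (g i)) = ip F h (g' i)"
      by (metis R_def)
  qed
  show thesis
  proof
    show "unitary E F (restrict U (carr E))"
      by (rule unitaryI[OF E F, where v = "restrict V (carr F)"])
        (simp_all add: U(1) V(1) VU UV adj)
    show "restrict U (carr E) (g i) = g' i" if "i \<in> I" for i
      using that by (simp add: gc Ug)
  qed
qed

section \<open>Left actions of correspondences\<close>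

context correspondence
begin

lemma lact_zero:
  assumes x: "x \<in> carr F"
  shows "lact F 0 x = zer F"
proof (rule vec_eqI)
  fix z assume z: "z \<in> carr F"
  have "lact F 0 x = sca F 0 (lact F 0 x)" using lact_scaleC[OF x, of 0 0] by simp
  then have "ip F z (lact F 0 x) = scaleC 0 (ip F z (lact F 0 x))"
    using ip_sca[OF z lact_closed[OF x], of 0 0] by simp
  then show "ip F z (lact F 0 x) = ip F z (zer F)" using z by simp
qed (simp_all add: lact_closed zer_closed x)

lemma lact_diff: "x \<in> carr F \<Longrightarrow> lact F (b - c) x = hminus F (lact F b x) (lact F c x)"
  using lact_add[of x b "- c"] lact_scaleC[of x "-1" c] by (simp add: hminus_def)

text \<open>
  Continuity of the left action is automatic. With \<open>h = b\<^sup>* b / \<parallel>b\<^sup>* b\<parallel>\<close> and \<open>(1 - k)\<^sup>2 = 1 - h\<close>, one has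
  \<open>\<langle>x, x\<rangle> = \<langle>x, h x\<rangle> + \<langle>x - k x, x - k x\<rangle>\<close>, a sum of two positive elements, so \<open>\<parallel>\<langle>x, h x\<rangle>\<parallel> \<le> \<parallel>\<langle>x, x\<rangle>\<parallel>\<close>.
\<close>

lemma hnorm_lact:
  assumes x: "x \<in> carr F"
  shows "hnorm F (lact F b x) \<le> norm b * hnorm F x"
proof (cases "b = 0")
  case True
  then show ?thesis using x by (simp add: lact_zero hnorm_def zer_closed)
next
  case False
  define r where "r = norm (cstar b * b)"
  have r: "r > 0" using False by (simp add: r_def cstar_identity)
  define h where "h = (1/r) *\<^sub>R (cstar b * b)"
  have h: "norm h \<le> 1" "cstar h = h"
    using r by (auto simp: h_def cstar_simps r_def)
  obtain k where k: "2 *\<^sub>R k = h + k * k" "cstar k = k"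
    using sqrt_one_minus[OF h(1)] h(2) by metis
  define \<phi> where "\<phi> a = ip F x (lact F a x)" for a
  have \<phi>_add: "\<phi> (a + c) = \<phi> a + \<phi> c" for a c
    using x by (simp add: \<phi>_def lact_add ip_vadd lact_closed)
  have \<phi>_scaleR: "\<phi> (s *\<^sub>R a) = s *\<^sub>R \<phi> a" for s a
    using x by (simp add: \<phi>_def lact_scaleC ip_sca lact_closed flip: scaleC_of_real)
  have \<phi>_mult: "\<phi> (cstar a * c) = ip F (lact F a x) (lact F c x)" for a c
    using x by (simp add: \<phi>_def lact_mult lact_adjoint lact_closed)
  have eq1: "ip F x x = \<phi> h + ip F (hminus F x (lact F k x)) (hminus F x (lact F k x))"
  proof -
    have "\<phi> h + \<phi> (k * k) = \<phi> k + \<phi> k"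
      using \<phi>_add[of h "k * k"] \<phi>_scaleR[of 2 k] k(1) by (simp add: scaleR_2)
    moreover have "\<phi> (k * k) = ip F (lact F k x) (lact F k x)"
      using \<phi>_mult[of k k] k(2) by simp
    moreover have "ip F x (lact F k x) = \<phi> k" "ip F (lact F k x) x = \<phi> k"
      using x lact_adjoint[of x x k] k(2) by (simp_all add: \<phi>_def)
    ultimately show ?thesis using x
      by (simp add: ip_hminus ip_hminus_left closed lact_closed algebra_simps)
  qed
  have eq2: "\<phi> h = (1/r) *\<^sub>R ip F (lact F b x) (lact F b x)"
    by (simp add: h_def \<phi>_scaleR \<phi>_mult)
  have "norm (\<phi> h) \<le> norm (ip F x x)"
    unfolding eq1 using r x
    by (intro cstar_positive_norm_mono)
      (auto simp: eq2 lact_closed closed intro!: cstar_positive_scaleR ip_positive)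
  then have "(hnorm F (lact F b x))\<^sup>2 \<le> r * (hnorm F x)\<^sup>2"
    using r by (simp add: eq2 hnorm_square divide_simps mult.commute)
  also have "\<dots> = (norm b * hnorm F x)\<^sup>2"
    by (simp add: r_def cstar_identity power_mult_distrib)
  finally show ?thesis by (rule power2_le_imp_le) simp
qed

text \<open>
  Nondegeneracy, restricted to a set \<open>B\<close> whose span is dense; for the inner products of a full module this yields
  the total set of all \<open>\<langle>x, x'\<rangle> y\<close>.
\<close>

lemma total_lact:
  assumes dense: "closure (lin_span (+) 0 scaleC B) = UNIV"
  shows "total F {lact F b y | b y. b \<in> B \<and> y \<in> carr F}" (is "total F ?H")
proof (rule total_trans)
  show "total F {lact F b y | b y. y \<in> carr F}"
    using lact_nondegenerate lact_closed by (auto simp: total_def)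
  show H: "?H \<subseteq> carr F" by (auto simp: lact_closed)
  have span: "lact F c y \<in> hspan F ?H" if "c \<in> lin_span (+) 0 scaleC B" "y \<in> carr F" for c y
    using that(1)
  proof induction
    case (lin_span_base g)
    then show ?case using that(2) by (intro lin_span.lin_span_base) auto
  qed (auto simp: lact_zero lact_add lact_scaleC that(2) intro: lin_span.intros)
  show "{lact F b y | b y. y \<in> carr F} \<subseteq> closed_span F ?H"
  proof safe
    fix b y assume y: "y \<in> carr F"
    show "lact F b y \<in> closed_span F ?H"
    proof (rule closed_spanI)
      fix e :: real assume "e > 0"
      then have "e / (hnorm F y + 1) > 0" by (simp add: add_nonneg_pos)
      moreover have "b \<in> closure (lin_span (+) 0 scaleC B)" by (simp add: dense)
      ultimately obtain c where c: "c \<in> lin_span (+) 0 scaleC B" "dist c b < e / (hnorm F y + 1)"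
        by (metis closure_approachable)
      have "hnorm F (hminus F (lact F b y) (lact F c y)) \<le> norm (b - c) * hnorm F y"
        using hnorm_lact[OF y, of "b - c"] y by (simp add: lact_diff)
      also have "\<dots> \<le> dist c b * (hnorm F y + 1)"
        by (intro mult_mono) (auto simp: dist_norm norm_minus_commute)
      also have "\<dots> < e" using c(2) by (simp add: pos_less_divide_eq add_nonneg_pos)
      finally show "\<exists>z\<in>hspan F ?H. hnorm F (hminus F (lact F b y) z) < e"
        using span[OF c(1) y] by blast
    qed (simp add: lact_closed y)
  qed
qed

end

section \<open>Interior tensor products and their annihilation operators\<close>

locale interior_tensor_product = E: hilbert_module E + F: correspondence F + T: hilbert_module T
  for E :: "('x, 'b::cstar_algebra, 'm) hmodule_scheme"
    and F :: "('y, 'b, 'n) corr_scheme"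
    and T :: "('t, 'b, 'k) hmodule_scheme" +
  fixes \<tau> :: "'x \<Rightarrow> 'y \<Rightarrow> 't"
  assumes tensor: "interior_tensor E F T \<tau>"

lemma interior_tensor_productI:
  assumes "hilbert_module E" "correspondence F" "interior_tensor E F T \<tau>"
  shows "interior_tensor_product E F T \<tau>"
proof -
  interpret E: hilbert_module E by fact
  interpret F: correspondence F by fact
  interpret T: hilbert_module T using assms(3) by (simp add: interior_tensor_def)
  show ?thesis by unfold_locales fact
qed

text \<open>
  The adjoint of \<open>y \<mapsto> \<tau> x y\<close>, applied to \<open>t\<close>. For a dilation and a vector \<open>\<xi>\<close> of the module in the place of
  \<open>t\<close>, it is the element written \<open>M\<^sup>* x \<xi>\<close> above, the counterpart of \<open>x\<^sup>* \<odot> \<xi>\<close>.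
\<close>

definition annihilation :: "('y, 'b::cstar_algebra, 'n) corr_scheme \<Rightarrow> ('t, 'b, 'k) hmodule_scheme
    \<Rightarrow> ('x \<Rightarrow> 'y \<Rightarrow> 't) \<Rightarrow> 'x \<Rightarrow> 't \<Rightarrow> 'y" where
  "annihilation F T \<tau> x t = (THE f. f \<in> carr F \<and> (\<forall>y\<in>carr F. ip T (\<tau> x y) t = ip F y f))"

context interior_tensor_product
begin

abbreviation "ann \<equiv> annihilation F T \<tau>"

lemma elem_closed [simp]: "\<lbrakk>x \<in> carr E; y \<in> carr F\<rbrakk> \<Longrightarrow> \<tau> x y \<in> carr T"
  using tensor by (simp add: interior_tensor_def)

lemma ip_elem: "\<lbrakk>x \<in> carr E; y \<in> carr F; x' \<in> carr E; y' \<in> carr F\<rbrakk> \<Longrightarrow>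
    ip T (\<tau> x y) (\<tau> x' y') = ip F y (lact F (ip E x x') y')"
  using tensor by (simp add: interior_tensor_def)

lemma total_elem: "total T {\<tau> x y | x y. x \<in> carr E \<and> y \<in> carr F}"
  using tensor by (auto simp: interior_tensor_def total_def)

lemma hnorm_elem:
  assumes x: "x \<in> carr E" and y: "y \<in> carr F"
  shows "hnorm T (\<tau> x y) \<le> hnorm E x * hnorm F y"
proof (rule power2_le_imp_le)
  have "(hnorm T (\<tau> x y))\<^sup>2 = norm (ip F y (lact F (ip E x x) y))"
    by (simp add: T.hnorm_square ip_elem x y)
  also have "\<dots> \<le> hnorm F y * (norm (ip E x x) * hnorm F y)"
    using F.Cauchy_Schwarz[OF y F.lact_closed[OF y]] F.hnorm_lact[OF y]
    by (meson F.hnorm_nonneg mult_left_mono order_trans)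
  also have "\<dots> = (hnorm E x * hnorm F y)\<^sup>2"
    unfolding E.hnorm_square[symmetric] by (simp add: power2_eq_square mult_ac)
  finally show "(hnorm T (\<tau> x y))\<^sup>2 \<le> (hnorm E x * hnorm F y)\<^sup>2" .
qed simp

lemma annihilation_exists:
  assumes x: "x \<in> carr E" and t: "t \<in> carr T"
  shows "\<exists>f\<in>carr F. \<forall>y\<in>carr F. ip T (\<tau> x y) t = ip F y f"
proof (rule adjoint_from_total[OF F.hilbert_module_axioms T.hilbert_module_axioms total_elem,
      where C = "hnorm E x"])
  show "\<exists>f\<in>carr F. \<forall>y\<in>carr F. ip T (\<tau> x y) g = ip F y f"
    if g: "g \<in> {\<tau> x y | x y. x \<in> carr E \<and> y \<in> carr F}" for g
  proof -
    obtain x' y' where g: "x' \<in> carr E" "y' \<in> carr F" "g = \<tau> x' y'" using g by blast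
    then have "\<forall>y\<in>carr F. ip T (\<tau> x y) g = ip F y (lact F (ip E x x') y')"
      using x by (simp add: ip_elem)
    then show ?thesis using F.lact_closed[OF g(2)] by blast
  qed
qed (use x t hnorm_elem in auto)

lemma annihilation_eqI:
  assumes "f \<in> carr F" "\<And>y. y \<in> carr F \<Longrightarrow> ip T (\<tau> x y) t = ip F y f"
  shows "ann x t = f"
  unfolding annihilation_def
proof (rule the_equality)
  fix f' assume "f' \<in> carr F \<and> (\<forall>y\<in>carr F. ip T (\<tau> x y) t = ip F y f')"
  with assms show "f' = f" by (intro F.vec_eqI) auto
qed (use assms in blast)

lemma
  assumes x: "x \<in> carr E" and t: "t \<in> carr T"
  shows ann_closed [simp]: "ann x t \<in> carr F"
    and ip_ann: "y \<in> carr F \<Longrightarrow> ip F y (ann x t) = ip T (\<tau> x y) t"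
proof -
  obtain f where f: "f \<in> carr F" "\<forall>y\<in>carr F. ip T (\<tau> x y) t = ip F y f"
    using annihilation_exists[OF assms] by blast
  then have "ann x t = f" by (intro annihilation_eqI) auto
  with f show "ann x t \<in> carr F" "y \<in> carr F \<Longrightarrow> ip F y (ann x t) = ip T (\<tau> x y) t" by auto
qed

lemma ip_ann_left:
  "\<lbrakk>x \<in> carr E; t \<in> carr T; y \<in> carr F\<rbrakk> \<Longrightarrow> ip F (ann x t) y = ip T t (\<tau> x y)"
  using F.ip_cstar[of y "ann x t"] T.ip_cstar[of "\<tau> x y" t] by (simp add: ip_ann)

lemma ann_elem:
  "\<lbrakk>x \<in> carr E; x' \<in> carr E; y \<in> carr F\<rbrakk> \<Longrightarrow> ann x (\<tau> x' y) = lact F (ip E x x') y"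
  by (rule annihilation_eqI) (simp_all add: F.lact_closed ip_elem)

lemma elem_ract:
  assumes "x \<in> carr E" "y \<in> carr F"
  shows "\<tau> (ract E x b) y = \<tau> x (lact F b y)"
proof (rule T.total_eqI[OF total_elem])
  fix g assume "g \<in> {\<tau> x y | x y. x \<in> carr E \<and> y \<in> carr F}"
  then obtain x' y' where "x' \<in> carr E" "y' \<in> carr F" "g = \<tau> x' y'" by blast
  with assms show "ip T g (\<tau> (ract E x b) y) = ip T g (\<tau> x (lact F b y))"
    by (simp add: ip_elem E.closed F.lact_closed E.ip_ract F.lact_mult)
qed (use assms in \<open>simp_all add: E.closed F.lact_closed\<close>)

text \<open>The family already contains all \<open>\<langle>x, x'\<rangle> y\<close>, as the images of the elementary tensors \<open>x' \<odot> y\<close>.\<close>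

lemma total_ann:
  assumes "full E"
  shows "total F ((\<lambda>(x, t). ann x t) ` (carr E \<times> carr T))"
proof (rule F.total_trans)
  show "total F {lact F b y | b y. b \<in> {ip E x x' | x x'. x \<in> carr E \<and> x' \<in> carr E} \<and> y \<in> carr F}"
    using assms by (intro F.total_lact) (simp add: full_def)
  show sub: "(\<lambda>(x, t). ann x t) ` (carr E \<times> carr T) \<subseteq> carr F" by auto
  show "{lact F b y | b y. b \<in> {ip E x x' | x x'. x \<in> carr E \<and> x' \<in> carr E} \<and> y \<in> carr F}
      \<subseteq> closed_span F ((\<lambda>(x, t). ann x t) ` (carr E \<times> carr T))"
  proof safe
    fix x x' y assume c: "x \<in> carr E" "x' \<in> carr E" "y \<in> carr F"
    then have "(x, \<tau> x' y) \<in> carr E \<times> carr T" by simp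
    then have "lact F (ip E x x') y \<in> (\<lambda>(x, t). ann x t) ` (carr E \<times> carr T)"
      by (intro image_eqI[where x = "(x, \<tau> x' y)"]) (simp_all add: ann_elem c)
    then show "lact F (ip E x x') y \<in> closed_span F ((\<lambda>(x, t). ann x t) ` (carr E \<times> carr T))"
      by (intro F.hspan_subset_closed_span[OF sub] lin_span.lin_span_base)
  qed
qed

text \<open>
  Products with elements of a full module determine a vector of the correspondence. The
  uniqueness of the intertwining maps and their algebraic identities rest on this.
\<close>

lemma elem_separates:
  assumes "full E" "y \<in> carr F" "y' \<in> carr F" "\<And>x. x \<in> carr E \<Longrightarrow> \<tau> x y = \<tau> x y'"
  shows "y = y'"
proof (rule F.total_eqI[OF total_ann[OF assms(1)] assms(2,3)])
  fix g assume "g \<in> (\<lambda>(x, t). ann x t) ` (carr E \<times> carr T)"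
  then obtain x t where "x \<in> carr E" "t \<in> carr T" "g = ann x t" by auto
  with assms show "ip F g y = ip F g y'" by (simp add: ip_ann_left)
qed

lemma ip_elem_ann:
  "\<lbrakk>x \<in> carr E; x' \<in> carr E; s \<in> carr T; t \<in> carr T\<rbrakk> \<Longrightarrow>
    ip F (ann x s) (ann x' t) = ip T s (\<tau> x (ann x' t))"
  by (simp add: ip_ann_left)

end

text \<open>
  An adjointable operator with the right values on elementary tensors identifies \<open>a \<odot> b\<close>; so the
  construction of \<open>a \<odot> b\<close> for general \<open>a\<close> can be avoided where such an operator is at hand.
\<close>

lemma tensor_map_eqI:
  assumes "hilbert_module T" "hilbert_module T'"
    and tot: "total T {\<tau> x y | x y. x \<in> carr E \<and> y \<in> carr F}"
    and c: "c \<in> Ba T T'" "\<And>x y. \<lbrakk>x \<in> carr E; y \<in> carr F\<rbrakk> \<Longrightarrow> c (\<tau> x y) = \<tau>' (a x) (b y)"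
  shows "tensor_map E F T \<tau> T' \<tau>' a b = c"
  unfolding tensor_map_def
proof (rule the_equality)
  fix c' assume c': "c' \<in> Ba T T' \<and> (\<forall>x\<in>carr E. \<forall>y\<in>carr F. c' (\<tau> x y) = \<tau>' (a x) (b y))"
  show "c' = c"
    by (rule Ba_eq_on_total[OF assms(1,2) tot]) (use c c' in auto)
qed (use c in blast)

lemma rank_one_Ba:
  assumes "hilbert_module E" and x: "x \<in> carr E" and y: "y \<in> carr E"
  shows "rank_one E x y \<in> Ba E E"
proof -
  interpret E: hilbert_module E by fact
  show ?thesis
    by (rule BaI[where b = "rank_one E y x"])
      (use E.ip_cstar[OF x] E.ip_cstar[OF y] in
        \<open>auto simp: rank_one_def E.closed E.ip_ract E.ip_ract_left x y E.ip_cstar[OF _ x]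
          intro!: arg_cong2[where f = "(*)"]\<close>)
qed

text \<open>
  In particular, a dilation makes the module itself a model of its tensor product with the fibre,
  with \<open>x y\<close> in the place of \<open>x \<odot> y\<close>. This is how dilations are treated from here on.
\<close>

lemma interior_tensor_transport:
  assumes "hilbert_module E" "correspondence F" "hilbert_module T'"
    and "interior_tensor E F T \<tau>" "unitary T T' v"
  shows "interior_tensor_product E F T' (\<lambda>x y. v (\<tau> x y))"
proof -
  interpret A: interior_tensor_product E F T \<tau>
    using assms(1,2,4) by (rule interior_tensor_productI)
  interpret v: unitary_operator T T' v
    by (simp add: unitary_operator_def unitary_operator_axioms_def A.T.hilbert_module_axioms assms)
  have "v ` {\<tau> x y | x y. x \<in> carr E \<and> y \<in> carr F} = {v (\<tau> x y) | x y. x \<in> carr E \<and> y \<in> carr F}"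
    by blast
  then show ?thesis
    using v.total_image[OF A.total_elem] assms(1-3)
    by (intro interior_tensor_productI)
      (simp_all add: interior_tensor_def v.ip_preserved A.ip_elem total_def)
qed

context interior_tensor_product
begin

text \<open>This operator is \<open>x y\<^sup>* \<odot> id\<close>, and its adjoint is \<open>y x\<^sup>* \<odot> id\<close>.\<close>

lemma elem_ann_Ba:
  assumes x: "x \<in> carr E" and y: "y \<in> carr E"
  shows "(\<lambda>t\<in>carr T. \<tau> x (ann y t)) \<in> Ba T T"
proof (rule BaI[where b = "\<lambda>t\<in>carr T. \<tau> y (ann x t)"])
  fix s t assume c: "s \<in> carr T" "t \<in> carr T"
  then have "ip T (\<tau> x (ann y s)) t = ip F (ann y s) (ann x t)"
    using x y by (simp add: ip_ann)
  then show "ip T ((\<lambda>t\<in>carr T. \<tau> x (ann y t)) s) t = ip T s ((\<lambda>t\<in>carr T. \<tau> y (ann x t)) t)"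
    using c x y by (simp add: ip_elem_ann)
qed (use x y in auto)

end

section \<open>The bilinear unitary between two fibres\<close>

text \<open>
  The hypothesis on \<open>u\<close> says that it conjugates \<open>x y\<^sup>* \<odot> id\<close> into \<open>(u x) (u y)\<^sup>* \<odot> id\<close>, so
  that the families \<open>M\<^sup>* x \<xi>\<close> and \<open>M'\<^sup>* (u x) (u \<xi>)\<close> of annihilated vectors have the same Gram matrix.
\<close>

lemma intertwiner_exists:
  assumes A: "interior_tensor_product E F E m" and B: "interior_tensor_product E' F' E' m'"
    and "full E" "full E'" and u: "unitary E E' u"
    and H: "\<And>x y z. \<lbrakk>x \<in> carr E; y \<in> carr E; z \<in> carr E\<rbrakk> \<Longrightarrow>
      u (m x (annihilation F E m y z)) = m' (u x) (annihilation F' E' m' (u y) (u z))"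
  shows "\<exists>w. bilinear_unitary F F' w \<and>
    (\<forall>x\<in>carr E. \<forall>y\<in>carr F. u (m x y) = m' (u x) (w y)) \<and>
    (\<forall>x\<in>carr E. \<forall>z\<in>carr E. w (annihilation F E m x z) = annihilation F' E' m' (u x) (u z))"
proof -
  interpret A: interior_tensor_product E F E m by fact
  interpret B: interior_tensor_product E' F' E' m' by fact
  interpret u: unitary_operator E E' u by unfold_locales fact
  let ?g = "\<lambda>(x, t). A.ann x t"
  let ?g' = "\<lambda>(x, t). B.ann (u x) (u t)"
  let ?I = "carr E \<times> carr E"
  have img: "?g' ` ?I = (\<lambda>(x, t). B.ann x t) ` (carr E' \<times> carr E')" (is "?L = ?R")
  proof
    show "?R \<subseteq> ?L"
    proof safe
      fix x t assume "x \<in> carr E'" "t \<in> carr E'"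
      then show "B.ann x t \<in> ?L"
        by (intro image_eqI[where x = "(adj E E' u x, adj E E' u t)"]) simp_all
    qed
  qed auto
  have gram: "ip F (?g i) (?g j) = ip F' (?g' i) (?g' j)" if ij: "i \<in> ?I" "j \<in> ?I" for i j
  proof -
    obtain x s y t where c: "x \<in> carr E" "s \<in> carr E" "y \<in> carr E" "t \<in> carr E" "i = (x, s)" "j = (y, t)"
      using ij by auto
    then have "ip F (?g i) (?g j) = ip E s (m x (A.ann y t))" by (simp add: A.ip_elem_ann)
    also have "\<dots> = ip E' (u s) (u (m x (A.ann y t)))" using c by (simp add: u.ip_preserved)
    also have "\<dots> = ip F' (?g' i) (?g' j)" using c by (simp add: H B.ip_elem_ann)
    finally show ?thesis .
  qed
  obtain w where w: "unitary F F' w" "\<And>i. i \<in> ?I \<Longrightarrow> w (?g i) = ?g' i"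
    using unitary_from_gram[OF A.F.hilbert_module_axioms B.F.hilbert_module_axioms
        A.total_ann[OF \<open>full E\<close>], of ?g' ] B.total_ann[OF \<open>full E'\<close>] gram unfolding img by metis
  interpret w: unitary_operator F F' w by unfold_locales (rule w(1))
  have w_ann: "w (A.ann x z) = B.ann (u x) (u z)" if "x \<in> carr E" "z \<in> carr E" for x z
    using w(2)[of "(x, z)"] that by simp
  have eq: "u (m x y) = m' (u x) (w y)" if c: "x \<in> carr E" "y \<in> carr F" for x y
  proof (rule B.E.vec_eqI)
    fix z' assume z': "z' \<in> carr E'"
    define z where "z = adj E E' u z'"
    have z: "z \<in> carr E" "z' = u z" using z' by (simp_all add: z_def)
    have "ip E' z' (u (m x y)) = ip F (A.ann x z) y"
      using z c by (simp add: u.ip_preserved A.ip_ann_left)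
    also have "\<dots> = ip F' (B.ann (u x) (u z)) (w y)"
      using z c by (simp add: w.ip_preserved flip: w_ann)
    also have "\<dots> = ip E' z' (m' (u x) (w y))"
      using z c by (simp add: B.ip_ann_left)
    finally show "ip E' z' (u (m x y)) = ip E' z' (m' (u x) (w y))" .
  qed (use c in simp_all)
  have lact: "w (lact F b y) = lact F' b (w y)" if y: "y \<in> carr F" for b y
  proof (rule B.elem_separates[OF \<open>full E'\<close>])
    fix x' assume x': "x' \<in> carr E'"
    define x where "x = adj E E' u x'"
    have x: "x \<in> carr E" "x' = u x" using x' by (simp_all add: x_def)
    have "m' x' (w (lact F b y)) = u (m (ract E x b) y)"
      using x y by (simp add: A.elem_ract A.F.lact_closed flip: eq)
    also have "\<dots> = m' (ract E' (u x) b) (w y)"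
      using x y by (simp add: eq A.E.closed u.apply_ract)
    also have "\<dots> = m' x' (lact F' b (w y))"
      using x y by (simp add: B.elem_ract)
    finally show "m' x' (w (lact F b y)) = m' x' (lact F' b (w y))" .
  qed (use y in \<open>simp_all add: A.F.lact_closed B.F.lact_closed\<close>)
  have "bilinear_unitary F F' w"
    using w(1) lact w.apply_ract by (simp add: bilinear_unitary_def)
  with eq w_ann show ?thesis by blast
qed

section \<open>Left dilations and their semigroups\<close>

lemma index_semigroup_closed:
  assumes "index_semigroup S"
  shows "0 \<in> S" "s \<in> S \<Longrightarrow> t \<in> S \<Longrightarrow> s + t \<in> S"
  using assms by (auto simp: index_semigroup_def)

lemma total_associated:
  assumes assoc: "associated_product_system S E \<theta> P d" and t: "t \<in> S"
  shows "total (ps_fib P t) {d t x y | x y. x \<in> carr E \<and> y \<in> carr E}"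
proof -
  have "d t x y \<in> fibre P t" if "x \<in> carr E" "y \<in> carr E" for x y
    using assoc t that by (simp add: associated_product_system_def)
  with assoc t show ?thesis by (auto simp: associated_product_system_def total_def)
qed

locale left_dilation_at =
  fixes S :: "real set" and E :: "('e, 'b::cstar_algebra, 'm) hmodule_scheme"
    and P :: "('x, 'z, 'b) product_system_data" and v :: "('e, 'x, 't, 'b) dilation_data" and t :: real
  assumes dilation: "left_dilation S E P v" and t: "t \<in> S"
begin

lemma full_module: "full E" and module: "hilbert_module E"
  and fibre_corr: "correspondence (ps_fib P t)"
  and dil_tensor: "interior_tensor E (ps_fib P t) (dil_tensor v t) (dil_elem v t)"
  and dil_unitary: "unitary (dil_tensor v t) E (dil_map v t)"
  using dilation t by (simp_all add: left_dilation_def full_product_system_def product_system_def)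

lemma tensor_mult: "interior_tensor_product E (ps_fib P t) E (dil_mult v t)"
  using interior_tensor_transport[OF module fibre_corr module dil_tensor dil_unitary]
  by (simp add: dil_mult_def[abs_def])

sublocale mult: interior_tensor_product E "ps_fib P t" E "dil_mult v t"
  by (rule tensor_mult)

sublocale elem: interior_tensor_product E "ps_fib P t" "dil_tensor v t" "dil_elem v t"
  by (rule interior_tensor_productI[OF module fibre_corr dil_tensor])

sublocale V: unitary_operator "dil_tensor v t" E "dil_map v t"
  by unfold_locales (rule dil_unitary)

abbreviation "annih \<equiv> annihilation (ps_fib P t) E (dil_mult v t)"

text \<open>
  The operator \<open>c\<close> is \<open>x y\<^sup>* \<odot> id\<close> on the tensor product; under the unitary of the dilation it becomes the
  composition of an annihilation operator with a multiplication operator.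
\<close>

lemma dil_semigroup_rank_one:
  assumes x: "x \<in> carr E" and y: "y \<in> carr E"
  shows "dil_semigroup S E P v t (rank_one E x y) = (\<lambda>z\<in>carr E. dil_mult v t x (annih y z))"
proof -
  let ?T = "dil_tensor v t" and ?V = "dil_map v t"
  let ?Vs = "adj ?T E ?V"
  have a: "rank_one E x y \<in> Ba E E" by (rule rank_one_Ba[OF module x y])
  define c where "c = (\<lambda>s\<in>carr ?T. ?Vs (dil_mult v t x (annih y (?V s))))"
  have "c = (\<lambda>s\<in>carr ?T. dil_elem v t x (elem.ann y s))"
  proof -
    have "annih y (?V s) = elem.ann y s" if s: "s \<in> carr ?T" for s
      by (rule mult.annihilation_eqI) (use s y in \<open>simp_all add: elem.ip_ann dil_mult_def V.ip_preserved\<close>)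
    then show ?thesis using x y by (auto simp: c_def dil_mult_def fun_eq_iff)
  qed
  then have cBa: "c \<in> Ba ?T ?T" using elem.elem_ann_Ba[OF x y] by simp
  have "tensor_map E (ps_fib P t) ?T (dil_elem v t) ?T (dil_elem v t) (rank_one E x y) (op_id (ps_fib P t)) = c"
  proof (rule tensor_map_eqI[OF elem.T.hilbert_module_axioms elem.T.hilbert_module_axioms elem.total_elem cBa])
    fix x' y' assume c': "x' \<in> carr E" "y' \<in> fibre P t"
    then have "c (dil_elem v t x' y') = ?Vs (dil_mult v t x (annih y (dil_mult v t x' y')))"
      by (simp add: c_def dil_mult_def)
    also have "\<dots> = ?Vs (dil_mult v t (ract E x (ip E y x')) y')"
      using x y c' by (simp add: mult.ann_elem mult.elem_ract)
    also have "\<dots> = dil_elem v t (rank_one E x y x') (op_id (ps_fib P t) y')"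
      using x c' by (simp add: dil_mult_def rank_one_def op_id_def mult.E.closed)
    finally show "c (dil_elem v t x' y') = dil_elem v t (rank_one E x y x') (op_id (ps_fib P t) y')" .
  qed
  then show ?thesis using a t x y
    by (auto simp: dil_semigroup_def compose_def c_def fun_eq_iff)
qed

lemma dil_semigroup_rank_one_Ba:
  "\<lbrakk>x \<in> carr E; y \<in> carr E\<rbrakk> \<Longrightarrow> dil_semigroup S E P v t (rank_one E x y) \<in> Ba E E"
  by (simp add: dil_semigroup_rank_one mult.elem_ann_Ba)

text \<open>
  Pairing with the total family \<open>y\<^sup>* \<odot>\<^sub>t \<zeta>\<close>: the product \<open>x (y\<^sup>* \<odot>\<^sub>t \<zeta>)\<close> is \<open>\<theta>\<^sub>t(x y\<^sup>*) \<zeta>\<close> by definition of the standard dilation,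
  and its inner product with \<open>z\<close> is that of \<open>y\<^sup>* \<odot>\<^sub>t \<zeta>\<close> and \<open>x\<^sup>* \<odot>\<^sub>t z\<close> in the associated product system.
\<close>

lemma standard_annihilation:
  assumes assoc: "associated_product_system S E \<theta> P d" and std: "standard_dilation S E \<theta> P d v"
    and x: "x \<in> carr E" and z: "z \<in> carr E"
  shows "annih x z = d t x z"
proof -
  have d: "d t x y \<in> fibre P t" if "x \<in> carr E" "y \<in> carr E" for x y
    using assoc t that by (simp add: associated_product_system_def)
  note tot = total_associated[OF assoc t]
  have gram: "ip (ps_fib P t) (d t x y) (d t x' y') = ip E y (\<theta> t (rank_one E x x') y')"
    if "x \<in> carr E" "y \<in> carr E" "x' \<in> carr E" "y' \<in> carr E" for x y x' y'
    using assoc t that by (simp add: associated_product_system_def)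
  have act: "dil_mult v t x (d t y z) = \<theta> t (rank_one E x y) z"
    if "x \<in> carr E" "y \<in> carr E" "z \<in> carr E" for x y z
    using std t that by (simp add: standard_dilation_def)
  show ?thesis
  proof (rule mult.F.total_eqI[OF tot])
    fix g assume "g \<in> {d t x y | x y. x \<in> carr E \<and> y \<in> carr E}"
    then obtain y \<zeta> where g: "y \<in> carr E" "\<zeta> \<in> carr E" "g = d t y \<zeta>" by blast
    have "ip (ps_fib P t) g (annih x z) = ip E (dil_mult v t x (d t y \<zeta>)) z"
      using g x z d by (simp add: mult.ip_ann)
    also have "\<dots> = cstar (ip E z (dil_mult v t x (d t y \<zeta>)))"
      using g x z d by (intro mult.E.ip_cstar) simp_all
    also have "\<dots> = cstar (ip (ps_fib P t) (d t x z) g)"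
      using g x z by (simp add: act gram)
    also have "\<dots> = ip (ps_fib P t) g (d t x z)"
      using g x z d by (intro mult.F.ip_cstar[symmetric]) simp_all
    finally show "ip (ps_fib P t) g (annih x z) = ip (ps_fib P t) g (d t x z)" .
  qed (use x z d in simp_all)
qed

end

section \<open>Isomorphisms of product systems\<close>

lemma product_system_iso_bilinear:
  "product_system_iso S P P' w \<Longrightarrow> t \<in> S \<Longrightarrow> bilinear_unitary (ps_fib P t) (ps_fib P' t) (w t)"
  unfolding product_system_iso_def by blast

lemma product_system_iso_extensional: "product_system_iso S P P' w \<Longrightarrow> w \<in> extensional S"
  unfolding product_system_iso_def by blast

lemma bilinear_unitary_Ba: "bilinear_unitary E F u \<Longrightarrow> u \<in> Ba E F"
  unfolding bilinear_unitary_def unitary_def by blast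

lemma Ba_apply: "a \<in> Ba E F \<Longrightarrow> x \<in> carr E \<Longrightarrow> a x \<in> carr F"
  by (auto simp: Ba_def)

lemma Ba_arb: "a \<in> Ba E F \<Longrightarrow> x \<notin> carr E \<Longrightarrow> a x = undefined"
  by (auto simp: Ba_def PiE_iff extensional_def)

definition intertwines :: "real set \<Rightarrow> ('e, 'b::cstar_algebra, 'm) hmodule_scheme \<Rightarrow>
    ('x, 'z, 'b) product_system_data \<Rightarrow> ('e, 'x, 't, 'b) dilation_data \<Rightarrow>
    ('f, 'x2, 't2, 'b) dilation_data \<Rightarrow> ('e \<Rightarrow> 'f) \<Rightarrow> (real \<Rightarrow> 'x \<Rightarrow> 'x2) \<Rightarrow> bool" where
  "intertwines S E P v v' u w \<longleftrightarrow> (\<forall>t\<in>S. \<forall>x\<in>carr E. \<forall>y\<in>fibre P t.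
     u (dil_mult v t x y) = dil_mult v' t (u x) (w t y))"

text \<open>
  All identities of an isomorphism are obtained by multiplying with \<open>u x\<close> from the left, where the defining property
  of \<open>w\<close> transports them to the corresponding identity for \<open>v\<close>. For instance
  \<open>(u x) (w\<^sub>s y\<^sub>s w\<^sub>t z\<^sub>t) = (u (x y\<^sub>s)) (w\<^sub>t z\<^sub>t) = u (x y\<^sub>s z\<^sub>t) = (u x) (w\<^sub>s\<^sub>+\<^sub>t (y\<^sub>s z\<^sub>t))\<close>.
\<close>

lemma dilation_isomorphism:
  fixes E :: "('e, 'b::cstar_algebra, 'm) hmodule_scheme"
    and E' :: "('f, 'b, 'n) hmodule_scheme"
    and P :: "('x, 'z, 'b) product_system_data" and v :: "('e, 'x, 't, 'b) dilation_data"
    and P' :: "('x2, 'z2, 'b) product_system_data" and v' :: "('f, 'x2, 't2, 'b) dilation_data"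
  assumes S: "index_semigroup S" and v: "left_dilation S E P v" and v': "left_dilation S E' P' v'"
    and u: "unitary E E' u"
    and H: "\<And>t x y z. \<lbrakk>t \<in> S; x \<in> carr E; y \<in> carr E; z \<in> carr E\<rbrakk> \<Longrightarrow>
      u (dil_mult v t x (annihilation (ps_fib P t) E (dil_mult v t) y z)) =
      dil_mult v' t (u x) (annihilation (ps_fib P' t) E' (dil_mult v' t) (u y) (u z))"
  shows "\<exists>w. is_unique_iso S P P' (intertwines S E P v v' u) w \<and>
    (\<forall>t\<in>S. \<forall>x\<in>carr E. \<forall>z\<in>carr E. w t (annihilation (ps_fib P t) E (dil_mult v t) x z) =
      annihilation (ps_fib P' t) E' (dil_mult v' t) (u x) (u z))"
proof -
  have at: "left_dilation_at S E P v t" "left_dilation_at S E' P' v' t" if "t \<in> S" for t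
    using v v' that by (simp_all add: left_dilation_at_def)
  have E: "hilbert_module E" "full E" and E': "hilbert_module E'" "full E'"
    using v v' by (simp_all add: left_dilation_def)
  interpret E: hilbert_module E by fact
  interpret E': hilbert_module E' by fact
  interpret u: unitary_operator E E' u by unfold_locales (rule u)
  note S0 = index_semigroup_closed(1)[OF S] and Splus = index_semigroup_closed(2)[OF S]
  have mult: "interior_tensor_product E (ps_fib P t) E (dil_mult v t)"
    and mult': "interior_tensor_product E' (ps_fib P' t) E' (dil_mult v' t)" if "t \<in> S" for t
    by (rule left_dilation_at.tensor_mult[OF at(1)[OF that]], rule left_dilation_at.tensor_mult[OF at(2)[OF that]])
  let ?W = "\<lambda>t w. bilinear_unitary (ps_fib P t) (ps_fib P' t) w \<and>
    (\<forall>x\<in>carr E. \<forall>y\<in>fibre P t. u (dil_mult v t x y) = dil_mult v' t (u x) (w y)) \<and>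
    (\<forall>x\<in>carr E. \<forall>z\<in>carr E. w (annihilation (ps_fib P t) E (dil_mult v t) x z) =
      annihilation (ps_fib P' t) E' (dil_mult v' t) (u x) (u z))"
  have ex: "\<exists>w. ?W t w" if t: "t \<in> S" for t
  proof (rule intertwiner_exists[OF mult[OF t] mult'[OF t] E(2) E'(2) u])
    fix x y z assume "x \<in> carr E" "y \<in> carr E" "z \<in> carr E"
    with t show "u (dil_mult v t x (annihilation (ps_fib P t) E (dil_mult v t) y z)) =
      dil_mult v' t (u x) (annihilation (ps_fib P' t) E' (dil_mult v' t) (u y) (u z))" by (rule H)
  qed
  define w0 where "w0 t = (SOME w. ?W t w)" for t
  have W: "?W t (w0 t)" if "t \<in> S" for t
    unfolding w0_def by (rule someI_ex[OF ex[OF that]])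
  note w0 = W[THEN conjunct1] W[THEN conjunct2, THEN conjunct1, THEN bspec, THEN bspec]
    W[THEN conjunct2, THEN conjunct2, THEN bspec, THEN bspec]
  define w where "w = restrict w0 S"
  have w: "\<And>t. t \<in> S \<Longrightarrow> bilinear_unitary (ps_fib P t) (ps_fib P' t) (w t)"
    "\<And>t x y. \<lbrakk>t \<in> S; x \<in> carr E; y \<in> fibre P t\<rbrakk> \<Longrightarrow> u (dil_mult v t x y) = dil_mult v' t (u x) (w t y)"
    using w0 by (simp_all add: w_def)
  have bu_closed: "W y \<in> fibre P' t"
    if "bilinear_unitary (ps_fib P t) (ps_fib P' t) W" "y \<in> fibre P t" for W t y
    by (rule Ba_apply[OF bilinear_unitary_Ba[OF that(1)] that(2)])
  have separate: "y = y'"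
    if "t \<in> S" "y \<in> fibre P' t" "y' \<in> fibre P' t"
      "\<And>x. x \<in> carr E \<Longrightarrow> dil_mult v' t (u x) y = dil_mult v' t (u x) y'" for t y y'
  proof (rule interior_tensor_product.elem_separates[OF mult'[OF that(1)] E'(2) that(2,3)])
    fix x' assume "x' \<in> carr E'"
    then show "dil_mult v' t x' y = dil_mult v' t x' y'"
      using that(4)[of "adj E E' u x'"] by simp
  qed
  have P: "product_system S P" and P': "product_system S P'"
    using v v' by (simp_all add: left_dilation_def full_product_system_def)
  have mult_closed: "ps_mult Q s t x y \<in> fibre Q (s + t)"
    if "product_system S Q" "s \<in> S" "t \<in> S" "x \<in> fibre Q s" "y \<in> fibre Q t"
    for Q :: "('y, 'w, 'b) product_system_data" and s t x y
  proof -
    have "ps_elem Q s t x y \<in> carr (ps_tensor Q s t)"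
      and "bilinear_unitary (ps_tensor Q s t) (ps_fib Q (s + t)) (ps_map Q s t)"
      using that by (simp_all add: product_system_def interior_tensor_corr_def interior_tensor_def)
    then show ?thesis by (auto simp: ps_mult_def bilinear_unitary_def unitary_def Ba_def)
  qed
  have unit_closed: "ps_unit Q b \<in> fibre Q 0" if "product_system S Q"
    for Q :: "('y, 'w, 'b) product_system_data" and b
    using that by (auto simp: product_system_def bilinear_unitary_def unitary_def Ba_def alg_corr_def)
  have mult_closed': "dil_mult v t x y \<in> carr E" if "t \<in> S" "x \<in> carr E" "y \<in> fibre P t" for t x y
    by (rule interior_tensor_product.elem_closed[OF mult[OF that(1)] that(2,3)])
  have iso: "product_system_iso S P P' w"
    unfolding product_system_iso_def
  proof (intro conjI ballI allI)
    show "w \<in> extensional S" by (simp add: w_def)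
    show "bilinear_unitary (ps_fib P t) (ps_fib P' t) (w t)" if "t \<in> S" for t by (rule w(1)[OF that])
    show "w 0 (ps_unit P b) = ps_unit P' b" for b
    proof (rule separate[OF S0])
      show "w 0 (ps_unit P b) \<in> fibre P' 0" by (rule bu_closed[OF w(1)[OF S0] unit_closed[OF P]])
      show "ps_unit P' b \<in> fibre P' 0" by (rule unit_closed[OF P'])
      fix x assume x: "x \<in> carr E"
      have "dil_mult v' 0 (u x) (w 0 (ps_unit P b)) = u (ract E x b)"
        using w(2)[OF S0 x unit_closed[OF P]] v x by (simp add: left_dilation_def)
      also have "\<dots> = dil_mult v' 0 (u x) (ps_unit P' b)"
        using v' x by (simp add: u.apply_ract left_dilation_def)
      finally show "dil_mult v' 0 (u x) (w 0 (ps_unit P b)) = dil_mult v' 0 (u x) (ps_unit P' b)" .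
    qed
    show "ps_mult P' s t (w s y) (w t z) = w (s + t) (ps_mult P s t y z)"
      if c: "s \<in> S" "t \<in> S" "y \<in> fibre P s" "z \<in> fibre P t" for s t y z
    proof (rule separate[OF Splus[OF c(1,2)]])
      note wc = bu_closed[OF w(1)[OF c(1)] c(3)] bu_closed[OF w(1)[OF c(2)] c(4)]
      note yz = mult_closed[OF P c]
      show "ps_mult P' s t (w s y) (w t z) \<in> fibre P' (s + t)"
        by (rule mult_closed[OF P' c(1,2) wc])
      show "w (s + t) (ps_mult P s t y z) \<in> fibre P' (s + t)"
        by (rule bu_closed[OF w(1)[OF Splus[OF c(1,2)]] yz])
      fix x assume x: "x \<in> carr E"
      have "dil_mult v' (s + t) (u x) (ps_mult P' s t (w s y) (w t z)) =
          dil_mult v' t (dil_mult v' s (u x) (w s y)) (w t z)"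
        using v' c(1,2) wc x by (simp add: left_dilation_def)
      also have "\<dots> = u (dil_mult v t (dil_mult v s x y) z)"
        using c x mult_closed' by (simp flip: w(2))
      also have "\<dots> = u (dil_mult v (s + t) x (ps_mult P s t y z))"
        using v c x by (simp add: left_dilation_def)
      also have "\<dots> = dil_mult v' (s + t) (u x) (w (s + t) (ps_mult P s t y z))"
        by (rule w(2)[OF Splus[OF c(1,2)] x yz])
      finally show "dil_mult v' (s + t) (u x) (ps_mult P' s t (w s y) (w t z)) =
          dil_mult v' (s + t) (u x) (w (s + t) (ps_mult P s t y z))" .
    qed
  qed
  have "w' = w" if iso': "product_system_iso S P P' w'" and Q: "intertwines S E P v v' u w'" for w'
  proof
    fix t
    show "w' t = w t"
    proof (cases "t \<in> S")
      case True
      have bu': "bilinear_unitary (ps_fib P t) (ps_fib P' t) (w' t)"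
        by (rule product_system_iso_bilinear[OF iso' True])
      show ?thesis
      proof
        fix y
        show "w' t y = w t y"
        proof (cases "y \<in> fibre P t")
          case y: True
          show ?thesis
          proof (rule separate[OF True bu_closed[OF bu' y] bu_closed[OF w(1)[OF True] y]])
            fix x assume x: "x \<in> carr E"
            then have "u (dil_mult v t x y) = dil_mult v' t (u x) (w' t y)"
              using Q True y unfolding intertwines_def by blast
            with w(2)[OF True x y] show "dil_mult v' t (u x) (w' t y) = dil_mult v' t (u x) (w t y)"
              by metis
          qed
        next
          case False
          then show ?thesis
            using Ba_arb[OF bilinear_unitary_Ba[OF bu']] Ba_arb[OF bilinear_unitary_Ba[OF w(1)[OF True]]]
            by metis
        qed
      qed
    next
      case False
      then show ?thesis
        using iso[THEN product_system_iso_extensional] iso'[THEN product_system_iso_extensional]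
        by (metis extensional_arb)
    qed
  qed
  moreover have "intertwines S E P v v' u w" using w(2) by (simp add: intertwines_def)
  ultimately have "is_unique_iso S P P' (intertwines S E P v v' u) w"
    using iso unfolding is_unique_iso_def by blast
  moreover have "\<forall>t\<in>S. \<forall>x\<in>carr E. \<forall>z\<in>carr E. w t (annihilation (ps_fib P t) E (dil_mult v t) x z) =
      annihilation (ps_fib P' t) E' (dil_mult v' t) (u x) (u z)"
    using w0(3) by (simp add: w_def)
  ultimately show ?thesis by blast
qed

lemma product_system_iso_eqI:
  assumes P: "product_system S P" "product_system S P'"
    and w: "product_system_iso S P P' w" and w': "product_system_iso S P P' w'"
    and G: "\<And>t. t \<in> S \<Longrightarrow> total (ps_fib P t) (G t)"
    and eq: "\<And>t g. \<lbrakk>t \<in> S; g \<in> G t\<rbrakk> \<Longrightarrow> w t g = w' t g"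
  shows "w = w'"
proof
  fix t
  show "w t = w' t"
  proof (cases "t \<in> S")
    case True
    have "hilbert_module (ps_fib P t)" "hilbert_module (ps_fib P' t)"
      using P True by (simp_all add: product_system_def correspondence_def)
    moreover have "w t \<in> Ba (ps_fib P t) (ps_fib P' t)" "w' t \<in> Ba (ps_fib P t) (ps_fib P' t)"
      by (rule bilinear_unitary_Ba[OF product_system_iso_bilinear[OF w True]],
        rule bilinear_unitary_Ba[OF product_system_iso_bilinear[OF w' True]])
    ultimately show ?thesis using Ba_eq_on_total[OF _ _ G[OF True]] eq[OF True] by blast
  next
    case False
    then show ?thesis
      using w[THEN product_system_iso_extensional] w'[THEN product_system_iso_extensional]
      by (metis extensional_arb)
  qed
qed

text \<open>
  Replaces the property that characterizes an isomorphism by one that prescribes its values on a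
  total subset of each fibre.
\<close>

lemma unique_iso_by_total_values:
  assumes P: "product_system S P" "product_system S P'"
    and w: "is_unique_iso S P P' Q w" and Rw: "R w"
    and G: "\<And>t. t \<in> S \<Longrightarrow> total (ps_fib P t) (G t)"
    and R: "\<And>w' t g. \<lbrakk>R w'; t \<in> S; g \<in> G t\<rbrakk> \<Longrightarrow> w' t g = w t g"
  shows "is_unique_iso S P P' R w"
proof -
  have iso: "product_system_iso S P P' w" using w by (simp add: is_unique_iso_def)
  have "w' = w" if "product_system_iso S P P' w'" "R w'" for w'
    by (rule product_system_iso_eqI[OF P that(1) iso G R[OF that(2)]])
  with iso Rw show ?thesis unfolding is_unique_iso_def by blast
qed

section \<open>Conjugate semigroups\<close>

lemma (in unitary_operator) inner_iso_apply:
  assumes "a \<in> Ba E E" "z \<in> carr E"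
  shows "inner_iso E F u a (u z) = u (a z)"
  using assms by (simp add: inner_iso_def compose_def)

text \<open>Injectivity identifies the inverse that occurs in the conjugate semigroup.\<close>

lemma (in unitary_operator) inj_on_inner_iso: "inj_on (inner_iso E F u) (Ba E E)"
proof (rule inj_onI, rule ext)
  fix a b z assume a: "a \<in> Ba E E" and b: "b \<in> Ba E E" and eq: "inner_iso E F u a = inner_iso E F u b"
  show "a z = b z"
  proof (cases "z \<in> carr E")
    case True
    have c: "a z \<in> carr E" "b z \<in> carr E" using a b True by (auto simp: Ba_def)
    have "u (a z) = u (b z)"
      by (simp only: eq inner_iso_apply[OF a True, symmetric] inner_iso_apply[OF b True, symmetric])
    then have "adj E F u (u (a z)) = adj E F u (u (b z))" by (rule arg_cong)
    then show ?thesis by (simp only: adj_apply c)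
  next
    case False
    then show ?thesis using Ba_arb[OF a] Ba_arb[OF b] by metis
  qed
qed

lemma (in unitary_operator) inner_iso_rank_one:
  assumes x: "x \<in> carr E" and y: "y \<in> carr E"
  shows "inner_iso E F u (rank_one E x y) = rank_one F (u x) (u y)"
proof
  fix z
  show "inner_iso E F u (rank_one E x y) z = rank_one F (u x) (u y) z"
  proof (cases "z \<in> carr F")
    case True
    then have "inner_iso E F u (rank_one E x y) z = u (ract E x (ip E y (adj E F u z)))"
      using rank_one_Ba[OF E.hilbert_module_axioms x y]
      by (simp add: inner_iso_def compose_def) (simp add: rank_one_def)
    then show ?thesis using True by (simp add: rank_one_def apply_ract ip_apply x y)
  next
    case False
    then show ?thesis
      using rank_one_Ba[OF E.hilbert_module_axioms x y]
      by (simp add: inner_iso_def compose_def) (simp add: rank_one_def)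
  qed
qed

lemma (in unitary_operator) conj_semigroup_rank_one:
  assumes "t \<in> S" and x: "x \<in> carr E" and y: "y \<in> carr E" and z: "z \<in> carr E"
    and \<theta>: "\<theta> t (rank_one E x y) \<in> Ba E E"
  shows "conj_semigroup S E F (inner_iso E F u) \<theta> t (rank_one F (u x) (u y)) (u z) =
    u (\<theta> t (rank_one E x y) z)"
proof -
  have "inv_into (Ba E E) (inner_iso E F u) (rank_one F (u x) (u y)) = rank_one E x y"
    using inv_into_f_f[OF inj_on_inner_iso rank_one_Ba[OF E.hilbert_module_axioms x y]]
    by (simp add: inner_iso_rank_one x y)
  moreover have "rank_one F (u x) (u y) \<in> Ba F F"
    by (rule rank_one_Ba[OF F.hilbert_module_axioms]) (simp_all add: x y)
  ultimately show ?thesis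
    using \<open>t \<in> S\<close> inner_iso_apply[OF \<theta> z] by (simp add: conj_semigroup_def)
qed

section \<open>Uniqueness of dilations\<close>

lemma unique_iso_of_conjugate_dilations:
  fixes E :: "('e, 'b::cstar_algebra, 'm) hmodule_scheme"
    and E' :: "('f, 'b, 'n) hmodule_scheme"
    and P :: "('x, 'z, 'b) product_system_data" and v :: "('e, 'x, 't, 'b) dilation_data"
    and P' :: "('x2, 'z2, 'b) product_system_data" and v' :: "('f, 'x2, 't2, 'b) dilation_data"
  assumes S: "index_semigroup S" and u: "unitary E E' u"
    and v: "left_dilation S E P v" and v': "left_dilation S E' P' v'"
    and conj: "conj_semigroup S E E' (inner_iso E E' u) (dil_semigroup S E P v) = dil_semigroup S E' P' v'"
  shows "\<exists>w. is_unique_iso S P P' (intertwines S E P v v' u) w \<and>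
    (\<forall>t\<in>S. compose (carr (dil_tensor v t)) u (dil_map v t) =
      compose (carr (dil_tensor v t)) (dil_map v' t)
        (tensor_map E (ps_fib P t) (dil_tensor v t) (dil_elem v t)
          (dil_tensor v' t) (dil_elem v' t) u (w t)))"
proof -
  have E: "hilbert_module E" and E': "hilbert_module E'"
    using v v' by (simp_all add: left_dilation_def)
  interpret u: unitary_operator E E' u
    by (simp add: unitary_operator_def unitary_operator_axioms_def E E' u)
  have H: "u (dil_mult v t x (annihilation (ps_fib P t) E (dil_mult v t) y z)) =
      dil_mult v' t (u x) (annihilation (ps_fib P' t) E' (dil_mult v' t) (u y) (u z))"
    if t: "t \<in> S" and c: "x \<in> carr E" "y \<in> carr E" "z \<in> carr E" for t x y z
  proof -
    interpret v: left_dilation_at S E P v t using v t by (simp add: left_dilation_at_def)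
    interpret v': left_dilation_at S E' P' v' t using v' t by (simp add: left_dilation_at_def)
    have "u (dil_mult v t x (v.annih y z)) = u (dil_semigroup S E P v t (rank_one E x y) z)"
      using c by (simp add: v.dil_semigroup_rank_one)
    also have "\<dots> = dil_semigroup S E' P' v' t (rank_one E' (u x) (u y)) (u z)"
      unfolding conj[symmetric]
      by (rule u.conj_semigroup_rank_one[where \<theta> = "dil_semigroup S E P v", symmetric, OF t c v.dil_semigroup_rank_one_Ba[OF c(1,2)]])
    also have "\<dots> = dil_mult v' t (u x) (v'.annih (u y) (u z))"
      using c by (simp add: v'.dil_semigroup_rank_one)
    finally show ?thesis .
  qed
  have "\<exists>w. is_unique_iso S P P' (intertwines S E P v v' u) w \<and>
    (\<forall>t\<in>S. \<forall>x\<in>carr E. \<forall>z\<in>carr E. w t (annihilation (ps_fib P t) E (dil_mult v t) x z) =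
      annihilation (ps_fib P' t) E' (dil_mult v' t) (u x) (u z))"
    by (rule dilation_isomorphism[OF S v v' u]) (rule H)
  then obtain w where w: "is_unique_iso S P P' (intertwines S E P v v' u) w" by blast
  have "compose (carr (dil_tensor v t)) u (dil_map v t) =
      compose (carr (dil_tensor v t)) (dil_map v' t)
        (tensor_map E (ps_fib P t) (dil_tensor v t) (dil_elem v t)
          (dil_tensor v' t) (dil_elem v' t) u (w t))" if t: "t \<in> S" for t
  proof -
    interpret v: left_dilation_at S E P v t using v t by (simp add: left_dilation_at_def)
    interpret v': left_dilation_at S E' P' v' t using v' t by (simp add: left_dilation_at_def)
    let ?T = "dil_tensor v t" and ?T' = "dil_tensor v' t"
    let ?V = "dil_map v t" and ?V' = "dil_map v' t"
    \<comment> \<open>The intertwining property says that \<open>v'\<^sup>* u v\<close> has the values of \<open>u \<odot> w\<close> on elementary tensors.\<close>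
    define c where "c = (\<lambda>s\<in>carr ?T. adj ?T' E' ?V' (u (?V s)))"
    have cBa: "c \<in> Ba ?T ?T'"
      by (rule BaI[where b = "\<lambda>s\<in>carr ?T'. adj ?T E ?V (adj E E' u (?V' s))"])
        (auto simp: c_def u.ip_apply v.V.ip_apply simp flip: v'.V.ip_apply_right)
    have bu: "bilinear_unitary (ps_fib P t) (ps_fib P' t) (w t)"
      using w product_system_iso_bilinear[OF _ t] unfolding is_unique_iso_def by blast
    have "tensor_map E (ps_fib P t) ?T (dil_elem v t) ?T' (dil_elem v' t) u (w t) = c"
    proof (rule tensor_map_eqI[OF v.elem.T.hilbert_module_axioms v'.elem.T.hilbert_module_axioms
          v.elem.total_elem cBa])
      fix x y assume xy: "x \<in> carr E" "y \<in> fibre P t"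
      have "w t y \<in> fibre P' t"
        by (rule Ba_apply[OF bilinear_unitary_Ba[OF bu] xy(2)])
      moreover have "u (dil_mult v t x y) = dil_mult v' t (u x) (w t y)"
        using w t xy unfolding is_unique_iso_def intertwines_def by blast
      ultimately show "c (dil_elem v t x y) = dil_elem v' t (u x) (w t y)"
        using xy by (simp add: c_def dil_mult_def)
    qed
    then show ?thesis by (simp add: compose_def c_def cong: restrict_cong)
  qed
  with w show ?thesis by blast
qed

lemma unique_iso_of_dilations_of_same_semigroup:
  fixes E :: "('e, 'b::cstar_algebra, 'm) hmodule_scheme"
    and P :: "('x, 'z, 'b) product_system_data" and v :: "('e, 'x, 't, 'b) dilation_data"
    and P' :: "('x2, 'z2, 'b) product_system_data" and v' :: "('e, 'x2, 't2, 'b) dilation_data"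
  assumes S: "index_semigroup S" and v: "left_dilation S E P v" and v': "left_dilation S E P' v'"
    and same: "\<And>t x y z. \<lbrakk>t \<in> S; x \<in> carr E; y \<in> carr E; z \<in> carr E\<rbrakk> \<Longrightarrow>
      dil_semigroup S E P v t (rank_one E x y) z = dil_semigroup S E P' v' t (rank_one E x y) z"
  shows "\<exists>w. is_unique_iso S P P' (intertwines S E P v v' (op_id E)) w \<and>
    is_unique_iso S P P' (\<lambda>w. \<forall>t\<in>S. \<forall>x\<in>carr E. \<forall>y\<in>fibre P t. dil_mult v t x y = dil_mult v' t x (w t y)) w \<and>
    (\<forall>t\<in>S. \<forall>x\<in>carr E. \<forall>z\<in>carr E. w t (annihilation (ps_fib P t) E (dil_mult v t) x z) =
      annihilation (ps_fib P' t) E (dil_mult v' t) x z)"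
proof -
  have E: "hilbert_module E" using v by (simp add: left_dilation_def)
  have id: "op_id E x = x" if "x \<in> carr E" for x using that by (simp add: op_id_def)
  have H: "dil_mult v t x (annihilation (ps_fib P t) E (dil_mult v t) y z) =
      dil_mult v' t x (annihilation (ps_fib P' t) E (dil_mult v' t) y z)"
    if t: "t \<in> S" and c: "x \<in> carr E" "y \<in> carr E" "z \<in> carr E" for t x y z
  proof -
    interpret v: left_dilation_at S E P v t using v t by (simp add: left_dilation_at_def)
    interpret v': left_dilation_at S E P' v' t using v' t by (simp add: left_dilation_at_def)
    show ?thesis using same[OF t c] c by (simp add: v.dil_semigroup_rank_one v'.dil_semigroup_rank_one)
  qed
  have closed: "dil_mult v t x y \<in> carr E" if "t \<in> S" "x \<in> carr E" "y \<in> fibre P t" for t x y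
  proof -
    interpret v: left_dilation_at S E P v t using v that by (simp add: left_dilation_at_def)
    show ?thesis using that by simp
  qed
  have ann_closed: "annihilation (ps_fib P t) E (dil_mult v t) y z \<in> fibre P t"
    if "t \<in> S" "y \<in> carr E" "z \<in> carr E" for t y z
  proof -
    interpret v: left_dilation_at S E P v t using v that by (simp add: left_dilation_at_def)
    show ?thesis using that by simp
  qed
  have "intertwines S E P v v' (op_id E) =
      (\<lambda>w. \<forall>t\<in>S. \<forall>x\<in>carr E. \<forall>y\<in>fibre P t. dil_mult v t x y = dil_mult v' t x (w t y))"
    by (simp add: intertwines_def fun_eq_iff id closed cong: ball_cong)
  moreover have "\<exists>w. is_unique_iso S P P' (intertwines S E P v v' (op_id E)) w \<and>
    (\<forall>t\<in>S. \<forall>x\<in>carr E. \<forall>z\<in>carr E. w t (annihilation (ps_fib P t) E (dil_mult v t) x z) =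
      annihilation (ps_fib P' t) E (dil_mult v' t) (op_id E x) (op_id E z))"
    by (rule dilation_isomorphism[OF S v v' unitary_op_id[OF E]])
      (simp add: id closed ann_closed flip: H)
  ultimately show ?thesis by (simp add: id cong: ball_cong)
qed

text \<open>
  For \<open>\<xi> = y z\<close> the defining formula \<open>w\<^sub>t(M\<^sup>* x \<xi>) = M'\<^sup>* x \<xi>\<close> reads \<open>w\<^sub>t(\<langle>x, y\<rangle> z) = x\<^sup>* \<odot>\<^sub>t (y z)\<close>.
\<close>

lemma unique_iso_to_associated_product_system:
  fixes E :: "('e, 'b::cstar_algebra, 'm) hmodule_scheme"
    and P :: "('x, 'z, 'b) product_system_data" and v :: "('e, 'x, 't, 'b) dilation_data"
    and P' :: "('x2, 'z2, 'b) product_system_data" and v' :: "('e, 'x2, 't2, 'b) dilation_data"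
  assumes S: "index_semigroup S" and v: "left_dilation S E P v"
    and assoc: "associated_product_system S E (dil_semigroup S E P v) P' d'"
    and std: "standard_dilation S E (dil_semigroup S E P v) P' d' v'"
  shows "\<exists>w. is_unique_iso S P P'
      (\<lambda>w. \<forall>t\<in>S. \<forall>x\<in>carr E. \<forall>y\<in>fibre P t. dil_mult v t x y = dil_mult v' t x (w t y)) w \<and>
    is_unique_iso S P P'
      (\<lambda>w. \<forall>t\<in>S. \<forall>x\<in>carr E. \<forall>y\<in>carr E. \<forall>z\<in>fibre P t.
        w t (lact (ps_fib P t) (ip E x y) z) = d' t x (dil_mult v t y z)) w"
    (is "\<exists>w. is_unique_iso S P P' ?Q w \<and> is_unique_iso S P P' ?R w")
proof -
  have v': "left_dilation S E P' v'" using std by (simp add: standard_dilation_def)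
  have P: "product_system S P" "product_system S P'"
    using v v' by (simp_all add: left_dilation_def full_product_system_def)
  have same: "dil_semigroup S E P v t (rank_one E x y) z = dil_semigroup S E P' v' t (rank_one E x y) z"
    if t: "t \<in> S" and c: "x \<in> carr E" "y \<in> carr E" "z \<in> carr E" for t x y z
  proof -
    interpret v': left_dilation_at S E P' v' t using v' t by (simp add: left_dilation_at_def)
    show ?thesis using std t c
      by (simp add: v'.dil_semigroup_rank_one v'.standard_annihilation[OF assoc std] standard_dilation_def)
  qed
  have "\<exists>w. is_unique_iso S P P' (intertwines S E P v v' (op_id E)) w \<and> is_unique_iso S P P' ?Q w \<and>
    (\<forall>t\<in>S. \<forall>x\<in>carr E. \<forall>z\<in>carr E. w t (annihilation (ps_fib P t) E (dil_mult v t) x z) =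
      annihilation (ps_fib P' t) E (dil_mult v' t) x z)"
    by (rule unique_iso_of_dilations_of_same_semigroup[OF S v v']) (rule same)
  then obtain w where w: "is_unique_iso S P P' ?Q w"
    and w_ann: "\<And>t x z. \<lbrakk>t \<in> S; x \<in> carr E; z \<in> carr E\<rbrakk> \<Longrightarrow>
      w t (annihilation (ps_fib P t) E (dil_mult v t) x z) = annihilation (ps_fib P' t) E (dil_mult v' t) x z"
    by blast
  let ?B = "{ip E x x' | x x'. x \<in> carr E \<and> x' \<in> carr E}"
  have "is_unique_iso S P P' ?R w"
  proof (rule unique_iso_by_total_values[OF P w,
      where G = "\<lambda>t. {lact (ps_fib P t) b z | b z. b \<in> ?B \<and> z \<in> fibre P t}"])
    show R: "?R w"
    proof (intro ballI)
      fix t x y z assume t: "t \<in> S" and c: "x \<in> carr E" "y \<in> carr E" "z \<in> fibre P t"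
      interpret v: left_dilation_at S E P v t using v t by (simp add: left_dilation_at_def)
      interpret v': left_dilation_at S E P' v' t using v' t by (simp add: left_dilation_at_def)
      show "w t (lact (ps_fib P t) (ip E x y) z) = d' t x (dil_mult v t y z)"
        using w_ann[OF t c(1), of "dil_mult v t y z"] c
        by (simp add: v.mult.ann_elem v'.standard_annihilation[OF assoc std])
    qed
    show "total (ps_fib P t) {lact (ps_fib P t) b z | b z. b \<in> ?B \<and> z \<in> fibre P t}" if t: "t \<in> S" for t
    proof -
      interpret v: left_dilation_at S E P v t using v t by (simp add: left_dilation_at_def)
      show ?thesis using v.full_module by (intro v.mult.F.total_lact) (simp add: full_def)
    qed
    show "w' t g = w t g" if "?R w'" "t \<in> S" "g \<in> {lact (ps_fib P t) b z | b z. b \<in> ?B \<and> z \<in> fibre P t}"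
      for w' t g
      using that R by auto
  qed
  with w show ?thesis by blast
qed

text \<open>
  On both sides the annihilated vectors are the generators of the associated product systems, so
  the formula on generators is the defining formula of \<open>w\<close>.
\<close>

lemma unique_iso_of_associated_product_systems:
  fixes E :: "('e, 'b::cstar_algebra, 'm) hmodule_scheme"
    and E' :: "('f, 'b, 'n) hmodule_scheme"
    and P :: "('x, 'z, 'b) product_system_data" and v :: "('e, 'x, 't, 'b) dilation_data"
    and P' :: "('x2, 'z2, 'b) product_system_data" and v' :: "('f, 'x2, 't2, 'b) dilation_data"
  assumes S: "index_semigroup S" and u: "unitary E E' u" and \<theta>: "strict_e0_semigroup S E \<theta>"
    and assoc: "associated_product_system S E \<theta> P d" and std: "standard_dilation S E \<theta> P d v"
    and assoc': "associated_product_system S E' (conj_semigroup S E E' (inner_iso E E' u) \<theta>) P' d'"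
    and std': "standard_dilation S E' (conj_semigroup S E E' (inner_iso E E' u) \<theta>) P' d' v'"
  shows "\<exists>w. is_unique_iso S P P' (intertwines S E P v v' u) w \<and>
    is_unique_iso S P P'
      (\<lambda>w. \<forall>t\<in>S. \<forall>x\<in>carr E. \<forall>y\<in>carr E. w t (d t x y) = d' t (u x) (u y)) w"
    (is "\<exists>w. _ w \<and> is_unique_iso S P P' ?R w")
proof -
  have v: "left_dilation S E P v" and v': "left_dilation S E' P' v'"
    using std std' unfolding standard_dilation_def by blast+
  have P: "product_system S P" "product_system S P'"
    using v v' by (simp_all add: left_dilation_def full_product_system_def)
  have E: "hilbert_module E" and E': "hilbert_module E'"
    using v v' by (simp_all add: left_dilation_def)
  interpret u: unitary_operator E E' u
    by (simp add: unitary_operator_def unitary_operator_axioms_def E E' u)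
  have ann: "annihilation (ps_fib P t) E (dil_mult v t) x z = d t x z"
    if "t \<in> S" "x \<in> carr E" "z \<in> carr E" for t x z
    by (rule left_dilation_at.standard_annihilation[OF left_dilation_at.intro[OF v that(1)] assoc std that(2,3)])
  have ann': "annihilation (ps_fib P' t) E' (dil_mult v' t) x z = d' t x z"
    if "t \<in> S" "x \<in> carr E'" "z \<in> carr E'" for t x z
    by (rule left_dilation_at.standard_annihilation[OF left_dilation_at.intro[OF v' that(1)] assoc' std' that(2,3)])
  have H: "u (dil_mult v t x (annihilation (ps_fib P t) E (dil_mult v t) y z)) =
      dil_mult v' t (u x) (annihilation (ps_fib P' t) E' (dil_mult v' t) (u y) (u z))"
    if t: "t \<in> S" and c: "x \<in> carr E" "y \<in> carr E" "z \<in> carr E" for t x y z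
  proof -
    have "\<theta> t \<in> Ba E E \<rightarrow> Ba E E"
      using \<theta> t unfolding strict_e0_semigroup_def e0_semigroup_def unital_star_endo_def by blast
    then have Ba: "\<theta> t (rank_one E x y) \<in> Ba E E"
      using rank_one_Ba[OF E c(1,2)] by blast
    have "u (dil_mult v t x (d t y z)) = u (\<theta> t (rank_one E x y) z)"
      using std t c by (simp add: standard_dilation_def)
    also have "\<dots> = conj_semigroup S E E' (inner_iso E E' u) \<theta> t (rank_one E' (u x) (u y)) (u z)"
      by (rule u.conj_semigroup_rank_one[where \<theta> = \<theta>, OF t c Ba, symmetric])
    also have "\<dots> = dil_mult v' t (u x) (d' t (u y) (u z))"
      using std' t c unfolding standard_dilation_def by simp
    finally show ?thesis using t c by (simp add: ann ann')
  qed
  have "\<exists>w. is_unique_iso S P P' (intertwines S E P v v' u) w \<and>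
    (\<forall>t\<in>S. \<forall>x\<in>carr E. \<forall>z\<in>carr E. w t (annihilation (ps_fib P t) E (dil_mult v t) x z) =
      annihilation (ps_fib P' t) E' (dil_mult v' t) (u x) (u z))"
    by (rule dilation_isomorphism[OF S v v' u]) (rule H)
  then obtain w where w: "is_unique_iso S P P' (intertwines S E P v v' u) w"
    and w_ann: "\<And>t x z. \<lbrakk>t \<in> S; x \<in> carr E; z \<in> carr E\<rbrakk> \<Longrightarrow>
      w t (annihilation (ps_fib P t) E (dil_mult v t) x z) =
      annihilation (ps_fib P' t) E' (dil_mult v' t) (u x) (u z)"
    by blast
  have R: "?R w"
  proof (intro ballI)
    fix t x y assume c: "t \<in> S" "x \<in> carr E" "y \<in> carr E"
    show "w t (d t x y) = d' t (u x) (u y)"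
      using w_ann[OF c] unfolding ann[OF c] ann'[OF c(1) u.apply_closed[OF c(2)] u.apply_closed[OF c(3)]] .
  qed
  have "is_unique_iso S P P' ?R w"
  proof (rule unique_iso_by_total_values[OF P w,
      where G = "\<lambda>t. {d t x y | x y. x \<in> carr E \<and> y \<in> carr E}"])
    show "?R w" by (rule R)
    show "total (ps_fib P t) {d t x y | x y. x \<in> carr E \<and> y \<in> carr E}" if "t \<in> S" for t
      by (rule total_associated[OF assoc that])
    show "w' t g = w t g" if R': "?R w'" and t: "t \<in> S"
      and g: "g \<in> {d t x y | x y. x \<in> carr E \<and> y \<in> carr E}" for w' t g
    proof -
      obtain x y where xy: "x \<in> carr E" "y \<in> carr E" "g = d t x y" using g by blast
      show ?thesis
        unfolding xy(3) R'[rule_format, OF t xy(1,2)] R[rule_format, OF t xy(1,2)] by (rule refl)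
    qed
  qed
  with w show ?thesis by (intro exI conjI)
qed

theorem proposition6p3:
  fixes S :: "real set"
    and E :: "('e, 'b::cstar_algebra) hmodule"
    and E' :: "('f, 'b) hmodule"
    and u :: "'e \<Rightarrow> 'f"
  assumes "index_semigroup S"
    and "hilbert_module E" and "full E"
    and "hilbert_module E'" and "full E'"
    and "unitary E E' u"
  shows
    "(\<forall>(P :: ('x, 'z, 'b) product_system_data) (v :: ('e, 'x, 't, 'b) dilation_data)
        (P' :: ('x2, 'z2, 'b) product_system_data) (v' :: ('f, 'x2, 't2, 'b) dilation_data).
        left_dilation S E P v \<and> left_dilation S E' P' v' \<and>
        conj_semigroup S E E' (inner_iso E E' u) (dil_semigroup S E P v) =
          dil_semigroup S E' P' v' \<longrightarrow>
        (\<exists>w. is_unique_iso S P P'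
               (\<lambda>w. \<forall>t\<in>S. \<forall>x\<in>carr E. \<forall>y\<in>fibre P t.
                  u (dil_mult v t x y) = dil_mult v' t (u x) (w t y)) w \<and>
             (\<forall>t\<in>S. compose (carr (dil_tensor v t)) u (dil_map v t) =
                compose (carr (dil_tensor v t)) (dil_map v' t)
                  (tensor_map E (ps_fib P t) (dil_tensor v t) (dil_elem v t)
                     (dil_tensor v' t) (dil_elem v' t) u (w t)))))
   \<and>
     (\<forall>(P :: ('x, 'z, 'b) product_system_data) (v :: ('e, 'x, 't, 'b) dilation_data)
        (P' :: ('x2, 'z2, 'b) product_system_data) (v' :: ('e, 'x2, 't2, 'b) dilation_data).
        left_dilation S E P v \<and> left_dilation S E P' v' \<and>
        dil_semigroup S E P v = dil_semigroup S E P' v' \<longrightarrow>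
        (\<exists>w. is_unique_iso S P P'
               (\<lambda>w. \<forall>t\<in>S. \<forall>x\<in>carr E. \<forall>y\<in>fibre P t.
                  op_id E (dil_mult v t x y) = dil_mult v' t (op_id E x) (w t y)) w \<and>
             is_unique_iso S P P'
               (\<lambda>w. \<forall>t\<in>S. \<forall>x\<in>carr E. \<forall>y\<in>fibre P t.
                  dil_mult v t x y = dil_mult v' t x (w t y)) w))
   \<and>
     (\<forall>(P :: ('x, 'z, 'b) product_system_data) (v :: ('e, 'x, 't, 'b) dilation_data)
        (P' :: ('x2, 'z2, 'b) product_system_data) (v' :: ('e, 'x2, 't2, 'b) dilation_data) d'.
        left_dilation S E P v \<and>
        associated_product_system S E (dil_semigroup S E P v) P' d' \<and>
        standard_dilation S E (dil_semigroup S E P v) P' d' v' \<longrightarrow>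
        (\<exists>w. is_unique_iso S P P'
               (\<lambda>w. \<forall>t\<in>S. \<forall>x\<in>carr E. \<forall>y\<in>fibre P t.
                  dil_mult v t x y = dil_mult v' t x (w t y)) w \<and>
             is_unique_iso S P P'
               (\<lambda>w. \<forall>t\<in>S. \<forall>x\<in>carr E. \<forall>y\<in>carr E. \<forall>z\<in>fibre P t.
                  w t (lact (ps_fib P t) (ip E x y) z) = d' t x (dil_mult v t y z)) w))
   \<and>
     (\<forall>\<theta> (P :: ('x, 'z, 'b) product_system_data) (v :: ('e, 'x, 't, 'b) dilation_data) d
        (P' :: ('x2, 'z2, 'b) product_system_data) (v' :: ('f, 'x2, 't2, 'b) dilation_data) d'.
        strict_e0_semigroup S E \<theta> \<and>
        associated_product_system S E \<theta> P d \<and> standard_dilation S E \<theta> P d v \<and>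
        associated_product_system S E' (conj_semigroup S E E' (inner_iso E E' u) \<theta>) P' d' \<and>
        standard_dilation S E' (conj_semigroup S E E' (inner_iso E E' u) \<theta>) P' d' v' \<longrightarrow>
        (\<exists>w. is_unique_iso S P P'
               (\<lambda>w. \<forall>t\<in>S. \<forall>x\<in>carr E. \<forall>y\<in>fibre P t.
                  u (dil_mult v t x y) = dil_mult v' t (u x) (w t y)) w \<and>
             is_unique_iso S P P'
               (\<lambda>w. \<forall>t\<in>S. \<forall>x\<in>carr E. \<forall>y\<in>carr E.
                  w t (d t x y) = d' t (u x) (u y)) w))"
proof (intro conjI allI impI; elim conjE)
  fix P :: "('x, 'z, 'b) product_system_data" and v :: "('e, 'x, 't, 'b) dilation_data"
    and P' :: "('x2, 'z2, 'b) product_system_data" and v' :: "('f, 'x2, 't2, 'b) dilation_data"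
  assume "left_dilation S E P v" "left_dilation S E' P' v'"
    "conj_semigroup S E E' (inner_iso E E' u) (dil_semigroup S E P v) = dil_semigroup S E' P' v'"
  from unique_iso_of_conjugate_dilations[OF assms(1,6) this]
  show "\<exists>w. is_unique_iso S P P'
               (\<lambda>w. \<forall>t\<in>S. \<forall>x\<in>carr E. \<forall>y\<in>fibre P t.
                  u (dil_mult v t x y) = dil_mult v' t (u x) (w t y)) w \<and>
             (\<forall>t\<in>S. compose (carr (dil_tensor v t)) u (dil_map v t) =
                compose (carr (dil_tensor v t)) (dil_map v' t)
                  (tensor_map E (ps_fib P t) (dil_tensor v t) (dil_elem v t)
                     (dil_tensor v' t) (dil_elem v' t) u (w t)))"
    unfolding intertwines_def[abs_def] .
next
  fix P :: "('x, 'z, 'b) product_system_data" and v :: "('e, 'x, 't, 'b) dilation_data"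
    and P' :: "('x2, 'z2, 'b) product_system_data" and v' :: "('e, 'x2, 't2, 'b) dilation_data"
  assume v: "left_dilation S E P v" "left_dilation S E P' v'"
    and same: "dil_semigroup S E P v = dil_semigroup S E P' v'"
  have "\<exists>w. is_unique_iso S P P' (intertwines S E P v v' (op_id E)) w \<and>
    is_unique_iso S P P' (\<lambda>w. \<forall>t\<in>S. \<forall>x\<in>carr E. \<forall>y\<in>fibre P t. dil_mult v t x y = dil_mult v' t x (w t y)) w \<and>
    (\<forall>t\<in>S. \<forall>x\<in>carr E. \<forall>z\<in>carr E. w t (annihilation (ps_fib P t) E (dil_mult v t) x z) =
      annihilation (ps_fib P' t) E (dil_mult v' t) x z)"
    by (rule unique_iso_of_dilations_of_same_semigroup[OF assms(1) v]) (simp only: same)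
  then show "\<exists>w. is_unique_iso S P P'
               (\<lambda>w. \<forall>t\<in>S. \<forall>x\<in>carr E. \<forall>y\<in>fibre P t.
                  op_id E (dil_mult v t x y) = dil_mult v' t (op_id E x) (w t y)) w \<and>
             is_unique_iso S P P'
               (\<lambda>w. \<forall>t\<in>S. \<forall>x\<in>carr E. \<forall>y\<in>fibre P t.
                  dil_mult v t x y = dil_mult v' t x (w t y)) w"
    unfolding intertwines_def[abs_def] by blast
next
  fix P :: "('x, 'z, 'b) product_system_data" and v :: "('e, 'x, 't, 'b) dilation_data"
    and P' :: "('x2, 'z2, 'b) product_system_data" and v' :: "('e, 'x2, 't2, 'b) dilation_data"
    and d'
  assume "left_dilation S E P v" "associated_product_system S E (dil_semigroup S E P v) P' d'"
    "standard_dilation S E (dil_semigroup S E P v) P' d' v'"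
  then show "\<exists>w. is_unique_iso S P P'
               (\<lambda>w. \<forall>t\<in>S. \<forall>x\<in>carr E. \<forall>y\<in>fibre P t.
                  dil_mult v t x y = dil_mult v' t x (w t y)) w \<and>
             is_unique_iso S P P'
               (\<lambda>w. \<forall>t\<in>S. \<forall>x\<in>carr E. \<forall>y\<in>carr E. \<forall>z\<in>fibre P t.
                  w t (lact (ps_fib P t) (ip E x y) z) = d' t x (dil_mult v t y z)) w"
    by (rule unique_iso_to_associated_product_system[OF assms(1)])
next
  fix \<theta> d d' and P :: "('x, 'z, 'b) product_system_data" and v :: "('e, 'x, 't, 'b) dilation_data"
    and P' :: "('x2, 'z2, 'b) product_system_data" and v' :: "('f, 'x2, 't2, 'b) dilation_data"
  assume "strict_e0_semigroup S E \<theta>"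
    "associated_product_system S E \<theta> P d" "standard_dilation S E \<theta> P d v"
    "associated_product_system S E' (conj_semigroup S E E' (inner_iso E E' u) \<theta>) P' d'"
    "standard_dilation S E' (conj_semigroup S E E' (inner_iso E E' u) \<theta>) P' d' v'"
  from unique_iso_of_associated_product_systems[OF assms(1,6) this]
  show "\<exists>w. is_unique_iso S P P'
               (\<lambda>w. \<forall>t\<in>S. \<forall>x\<in>carr E. \<forall>y\<in>fibre P t.
                  u (dil_mult v t x y) = dil_mult v' t (u x) (w t y)) w \<and>
             is_unique_iso S P P'
               (\<lambda>w. \<forall>t\<in>S. \<forall>x\<in>carr E. \<forall>y\<in>carr E.
                  w t (d t x y) = d' t (u x) (u y)) w"
    unfolding intertwines_def[abs_def] .
qed

end
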